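(* Let $(\Omega,\mathcal F,P)$ be a complete probability space with a filtration $\mathbb F=\{\mathcal F(t),t\ge 0\}$ satisfying the usual conditions, and let $W$ be a $d$-dimensional $\mathbb F$-Brownian motion. For an $\mathcal M^d$-valued $\mathbb F$-progressively measurable process $b$ set $V^b(t)=\int_0^t\big(\int_0^r b(u)\,dW(u)\big)^T dW(r)$, and let $h(t)=2t\log\log(1/t)$. (a) If $b$ is an $\mathcal M^d$-valued, $\mathbb F$-progressively measurable process with $|b(t)|\le 1$ for all $t\ge 0$, then almost surely $$\limsup_{t\searrow 0}\frac{|2V^b(t)|}{h(t)}\le 1.$$ (b) Let $\beta\in\mathcal S^d$ with largest eigenvalue $\lambda^*(\beta)\ge 0$. If $b$ is a bounded, $\mathcal S^d$-valued, $\mathbb F$-progressively measurable process such that $b(t)\ge\beta$ for all $t\ge 0$, then almost surely $$\limsup_{t\searrow 0}\frac{2V^b(t)}{h(t)}\ge \lambda^*(\beta).$$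
   Context: $\mathcal M^d$ denotes the set of real $d\times d$ matrices, $\mathcal S^d$ the symmetric ones, $T$ denotes transposition. For $\beta\in\mathcal M^d$, $|\beta|=\sup_{|y|=1}|\beta y|$ (Euclidean norm on $\mathbb R^d$). For $\beta\in\mathcal S^d$, $\lambda^*(\beta)=\max\{y^T\beta y:|y|=1\}$ and $\lambda_*(\beta)=\min\{y^T\beta y:|y|=1\}$; the partial order on $\mathcal S^d$ is $\beta\ge\alpha$ iff $\lambda_*(\beta-\alpha)\ge 0$. *)

theory Defs
  imports "HOL-Probability.Probability"
begin

definition mat_norm :: "real^'d^'d \<Rightarrow> real" where
  "mat_norm \<beta> = Sup {norm (\<beta> *v y) | y. norm y = 1}"

definition lambda_max :: "real^'d^'d \<Rightarrow> real" where
  "lambda_max \<beta> = Sup {y \<bullet> (\<beta> *v y) | y. norm y = 1}"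

definition lambda_min :: "real^'d^'d \<Rightarrow> real" where
  "lambda_min \<beta> = Inf {y \<bullet> (\<beta> *v y) | y. norm y = 1}"

definition symmetric_mat :: "real^'d^'d \<Rightarrow> bool" where
  "symmetric_mat \<beta> \<longleftrightarrow> transpose \<beta> = \<beta>"

definition mat_ge :: "real^'d^'d \<Rightarrow> real^'d^'d \<Rightarrow> bool" where
  "mat_ge \<beta> \<alpha> \<longleftrightarrow> lambda_min (\<beta> - \<alpha>) \<ge> 0"

definition usual_filtration :: "'a measure \<Rightarrow> (real \<Rightarrow> 'a measure) \<Rightarrow> bool" where
  "usual_filtration M F \<longleftrightarrow>
     (\<forall>t\<ge>0. space (F t) = space M \<and> sets (F t) \<subseteq> sets M) \<and>
     (\<forall>s t. 0 \<le> s \<and> s \<le> t \<longrightarrow> sets (F s) \<subseteq> sets (F t)) \<and>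
     (\<forall>t\<ge>0. sets (F t) = (\<Inter>s\<in>{t<..}. sets (F s))) \<and>
     null_sets M \<subseteq> sets (F 0)"

definition brownian_motion ::
  "'a measure \<Rightarrow> (real \<Rightarrow> 'a measure) \<Rightarrow> (real \<Rightarrow> 'a \<Rightarrow> real^'d) \<Rightarrow> bool" where
  "brownian_motion M F W \<longleftrightarrow>
     (\<forall>t\<ge>0. W t \<in> borel_measurable (F t)) \<and>
     (\<forall>\<omega>\<in>space M. W 0 \<omega> = 0) \<and>
     (AE \<omega> in M. continuous_on {0..} (\<lambda>t. W t \<omega>)) \<and>
     (\<forall>s t. 0 \<le> s \<and> s < t \<longrightarrow>
        distributed M lborel (\<lambda>\<omega>. W t \<omega> - W s \<omega>)
          (\<lambda>x. ennreal (\<Prod>i\<in>UNIV. normal_density 0 (sqrt (t - s)) (x $ i))) \<and>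
        (\<forall>A\<in>sets (F s). \<forall>B\<in>sets (borel :: (real^'d) measure).
           measure M (A \<inter> {\<omega>\<in>space M. W t \<omega> - W s \<omega> \<in> B})
             = measure M A * measure M {\<omega>\<in>space M. W t \<omega> - W s \<omega> \<in> B}))"

definition progressive ::
  "(real \<Rightarrow> 'a measure) \<Rightarrow> (real \<Rightarrow> 'a \<Rightarrow> 'b::topological_space) \<Rightarrow> bool" where
  "progressive F X \<longleftrightarrow>
     (\<forall>t\<ge>0. (\<lambda>(s, \<omega>). X s \<omega>) \<in> measurable (restrict_space borel {0..t} \<Otimes>\<^sub>M F t) borel)"

definition simple_pred ::
  "'a measure \<Rightarrow> (real \<Rightarrow> 'a measure) \<Rightarrow> nat \<Rightarrow> (nat \<Rightarrow> real) \<Rightarrow> (nat \<Rightarrow> 'a \<Rightarrow> real^'d) \<Rightarrow> bool" where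
  "simple_pred M F n \<tau> \<xi> \<longleftrightarrow> \<tau> 0 = 0 \<and> (\<forall>k<n. \<tau> k \<le> \<tau> (Suc k)) \<and>
     (\<forall>k<n. \<xi> k \<in> borel_measurable (F (\<tau> k))) \<and>
     (\<exists>C. \<forall>k<n. \<forall>\<omega>\<in>space M. norm (\<xi> k \<omega>) \<le> C)"

definition simple_proc ::
  "nat \<Rightarrow> (nat \<Rightarrow> real) \<Rightarrow> (nat \<Rightarrow> 'a \<Rightarrow> real^'d) \<Rightarrow> real \<Rightarrow> 'a \<Rightarrow> real^'d" where
  "simple_proc n \<tau> \<xi> t \<omega> = (\<Sum>k<n. if \<tau> k < t \<and> t \<le> \<tau> (Suc k) then \<xi> k \<omega> else 0)"

definition simple_int ::
  "(real \<Rightarrow> 'a \<Rightarrow> real^'d) \<Rightarrow> nat \<Rightarrow> (nat \<Rightarrow> real) \<Rightarrow> (nat \<Rightarrow> 'a \<Rightarrow> real^'d) \<Rightarrow> real \<Rightarrow> 'a \<Rightarrow> real" where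
  "simple_int W n \<tau> \<xi> t \<omega> =
     (\<Sum>k<n. \<xi> k \<omega> \<bullet> (W (min t (\<tau> (Suc k))) \<omega> - W (min t (\<tau> k)) \<omega>))"

definition ito_integral ::
  "'a measure \<Rightarrow> (real \<Rightarrow> 'a measure) \<Rightarrow> (real \<Rightarrow> 'a \<Rightarrow> real^'d)
     \<Rightarrow> (real \<Rightarrow> 'a \<Rightarrow> real^'d) \<Rightarrow> (real \<Rightarrow> 'a \<Rightarrow> real) \<Rightarrow> bool" where
  "ito_integral M F W H I \<longleftrightarrow>
     progressive F H \<and>
     (\<forall>t\<ge>0. I t \<in> borel_measurable (F t)) \<and>
     (AE \<omega> in M. continuous_on {0..} (\<lambda>t. I t \<omega>)) \<and>
     (\<forall>T>0. \<exists>n \<tau> \<xi>. (\<forall>j. simple_pred M F (n j) (\<tau> j) (\<xi> j)) \<and>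
        (\<lambda>j. \<integral>\<^sup>+\<omega>. (\<integral>\<^sup>+s\<in>{0..T}.
              ennreal ((norm (simple_proc (n j) (\<tau> j) (\<xi> j) s \<omega> - H s \<omega>))\<^sup>2) \<partial>lborel) \<partial>M)
          \<longlonglongrightarrow> 0 \<and>
        (\<forall>t\<in>{0..T}. \<forall>\<epsilon>>0.
           (\<lambda>j. measure M {\<omega>\<in>space M. \<bar>simple_int W (n j) (\<tau> j) (\<xi> j) t \<omega> - I t \<omega>\<bar> > \<epsilon>})
             \<longlonglongrightarrow> 0))"

definition lil_h :: "real \<Rightarrow> real" where
  "lil_h t = 2 * t * ln (ln (1 / t))"

end

theory Submission
  imports Defs "HOL-Real_Asymp.Real_Asymp"
begin

text \<open>For a piecewise constant integrand with values in the unit ball of the operator norm, and for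
  \<open>0 < 2 p T < 1\<close>, the process \<open>exp (2 p V\<^sub>k + (p / r\<^sub>k - p) |X\<^sub>k|\<^sup>2) / r\<^sub>k\<^bsup>d/2\<^esup>\<close> with
  \<open>r\<^sub>k = 1 - 2 p (T - s\<^sub>k)\<close> is a supermartingale along the grid \<open>s\<close>: the Gaussian computation is exact and
  leaves no discretisation error. The maximal inequality yields
  \<open>P (max 2 V \<ge> \<alpha>) \<le> exp (- p \<alpha>) / (1 - 2 p T)\<^bsup>d/2\<^esup>\<close>, the isometry carries it over to general
  integrands, and the first Borel-Cantelli lemma along \<open>\<theta>\<^sup>m\<close> gives (a).

  For (b) choose \<open>\<rho>\<close> so large that \<open>A = \<beta> + \<rho> I\<close> is positive definite and \<open>b\<close> stays within operator
  distance \<open>\<rho>\<close> of \<open>A\<close>. The argument for (a), applied to \<open>b - A\<close>, bounds \<open>|W \<bullet> A W - 2 V| / h\<close> by \<open>\<rho>\<close> in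
  the limit. For a unit vector \<open>v\<close> and \<open>u = A v / |A v|\<close> the Cauchy-Schwarz inequality of \<open>A\<close> gives
  \<open>W \<bullet> A W \<ge> (v \<bullet> A v) (u \<bullet> W)\<^sup>2\<close>, and the law of the iterated logarithm for \<open>u \<bullet> W\<close> leaves
  \<open>v \<bullet> A v - \<rho> = v \<bullet> \<beta> v\<close>.\<close>

section \<open>Gaussian exponential moments\<close>

text \<open>The Ito integral is given only through step processes that converge in mean square and
  whose integrals converge in probability. Estimates are therefore proved on finite grids, where
  conditioning is an explicit Gaussian integral. The obstacle is that mean-square approximation
  loses the bound on the operator norm, on which the exponential estimate rests; projecting the
  approximants onto a closed convex ball of matrices restores it. The weights \<open>r k\<close>
  come from the extremal case. The supermartingale is exp (p (2 V - |X|^2)) times exp (p |X|^2 / r)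
  / r^(d/2), and the second factor is the mean of exp (p |X + Z|^2) for a centred Gaussian Z with
  covariance T - s times the identity: what the remaining time would yield if the integrand were the
  identity. A contraction does no better. In (b) the form of b - \<beta> is nonnegative and bounded,
  so for large \<rho> it lies between 0 and 2 \<rho>, and subtracting \<rho> centres it. The \<rho>
  lost in the upper estimate for b - A is exactly the \<rho> gained in the form of A, so the size of
  b does not enter the result.\<close>

lemma nn_integral_exp_quadratic_normal:
  fixes a c v :: real
  assumes "0 < v" "2 * c * v < 1"
  shows "(\<integral>\<^sup>+x. ennreal (exp (a * x + c * x\<^sup>2) * normal_density 0 (sqrt v) x) \<partial>lborel)
    = ennreal (exp (v * a\<^sup>2 / (2 * (1 - 2 * c * v))) / sqrt (1 - 2 * c * v))"
proof -
  define q where "q = 1 - 2 * c * v"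
  have q: "0 < q" using assms by (simp add: q_def)
  define K where "K = exp (v * a\<^sup>2 / (2 * q)) / sqrt q"
  have c: "c = (1 - q) / (2 * v)" using assms(1) by (simp add: q_def field_simps)
  \<comment> \<open>Completing the square: up to the constant \<open>K\<close> the tilted density is
    again normal, with mean \<open>a * v / q\<close> and variance \<open>v / q\<close>.\<close>
  have "exp (a * x + c * x\<^sup>2) * normal_density 0 (sqrt v) x
      = K * normal_density (a * v / q) (sqrt (v / q)) x" for x
  proof -
    have e: "a * x + c * x\<^sup>2 - x\<^sup>2 / (2 * v)
        = v * a\<^sup>2 / (2 * q) - (x - a * v / q)\<^sup>2 / (2 * (v / q))"
      using assms(1) q unfolding c by (simp add: divide_simps) (simp add: power2_eq_square algebra_simps)
    have "exp (a * x + c * x\<^sup>2) * normal_density 0 (sqrt v) x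
        = 1 / sqrt (2 * pi * v) * exp (a * x + c * x\<^sup>2 - x\<^sup>2 / (2 * v))"
      using assms(1) by (simp add: normal_density_def flip: exp_add)
    also have "... = 1 / sqrt (2 * pi * v) * exp (v * a\<^sup>2 / (2 * q))
        * exp (- (x - a * v / q)\<^sup>2 / (2 * (v / q)))" by (simp only: e mult.assoc mult_exp_exp) simp
    also have "... = K * normal_density (a * v / q) (sqrt (v / q)) x" using assms(1) q
      by (simp add: normal_density_def K_def real_sqrt_divide real_sqrt_mult divide_simps)
    finally show ?thesis .
  qed
  then have "(\<integral>\<^sup>+x. ennreal (exp (a * x + c * x\<^sup>2) * normal_density 0 (sqrt v) x) \<partial>lborel)
      = (\<integral>\<^sup>+x. ennreal K * ennreal (normal_density (a * v / q) (sqrt (v / q)) x) \<partial>lborel)"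
    using q by (intro nn_integral_cong) (simp only: ennreal_mult'' normal_density_nonneg)
  also have "... = ennreal K * (\<integral>\<^sup>+x. ennreal (normal_density (a * v / q) (sqrt (v / q)) x) \<partial>lborel)"
    by (rule nn_integral_cmult) simp
  also have "(\<integral>\<^sup>+x. ennreal (normal_density (a * v / q) (sqrt (v / q)) x) \<partial>lborel) = 1"
    using assms(1) q by (subst nn_integral_eq_integral) auto
  finally show ?thesis by (simp add: K_def q_def)
qed

definition gauss_vec :: "real \<Rightarrow> (real^'d) measure" where
  "gauss_vec v = density lborel (\<lambda>x. ennreal (\<Prod>i\<in>UNIV. normal_density 0 (sqrt v) (x $ i)))"

lemma sets_gauss_vec [measurable_cong, simp]: "sets (gauss_vec v) = sets borel" by (simp add: gauss_vec_def)

lemma space_gauss_vec [simp]: "space (gauss_vec v) = UNIV" by (simp add: gauss_vec_def)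

lemma Basis_vec_real: "(Basis :: (real^'d) set) = (\<lambda>i. axis i 1) ` UNIV" by (auto simp: Basis_vec_def)

text \<open>Density and exponent both split over the coordinates, so the integral is a product of
  one-dimensional ones.\<close>

lemma nn_integral_exp_quadratic_gauss:
  fixes a :: "real^'d"
  assumes "0 < v" "2 * c * v < 1"
  shows "(\<integral>\<^sup>+z. ennreal (exp (a \<bullet> z + c * (norm z)\<^sup>2)) \<partial>gauss_vec v)
    = ennreal (exp (v * (norm a)\<^sup>2 / (2 * (1 - 2 * c * v))) / sqrt (1 - 2 * c * v) ^ CARD('d))"
proof -
  define f where "f b x = ennreal (exp (a \<bullet> b * x + c * x\<^sup>2) * normal_density 0 (sqrt v) x)" for b :: "real^'d" and x
  have [measurable]: "f b \<in> borel_measurable borel" for b unfolding f_def by measurable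
  have inj: "inj (\<lambda>i::'d. axis i (1::real))" by (auto simp: inj_on_def axis_eq_axis)
  have P: "(\<Prod>b\<in>Basis. g b) = (\<Prod>i\<in>UNIV. g (axis i 1))" for g :: "real^'d \<Rightarrow> 'x::comm_monoid_mult"
    unfolding Basis_vec_real by (subst prod.reindex[OF inj]) simp
  have n2: "(norm z)\<^sup>2 = (\<Sum>i\<in>UNIV. (z $ i)\<^sup>2)" for z :: "real^'d"
    unfolding power2_norm_eq_inner inner_vec_def by (simp add: power2_eq_square)
  have "(\<integral>\<^sup>+z. ennreal (exp (a \<bullet> z + c * (norm z)\<^sup>2)) \<partial>gauss_vec v)
      = (\<integral>\<^sup>+z. ennreal (\<Prod>i\<in>UNIV. normal_density 0 (sqrt v) (z $ i)) * ennreal (exp (a \<bullet> z + c * (norm z)\<^sup>2)) \<partial>lborel)"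
    unfolding gauss_vec_def by (rule nn_integral_density) measurable
  also have "... = (\<integral>\<^sup>+z. (\<Prod>b\<in>Basis. f b (z \<bullet> b)) \<partial>lborel)"
  proof (rule nn_integral_cong)
    fix z :: "real^'d"
    have "a \<bullet> z + c * (norm z)\<^sup>2 = (\<Sum>i\<in>UNIV. a $ i * z $ i + c * (z $ i)\<^sup>2)"
      unfolding n2 by (simp add: inner_vec_def sum.distrib sum_distrib_left)
    then have "exp (a \<bullet> z + c * (norm z)\<^sup>2) = (\<Prod>i\<in>UNIV. exp (a $ i * z $ i + c * (z $ i)\<^sup>2))"
      by (simp add: exp_sum)
    then show "ennreal (\<Prod>i\<in>UNIV. normal_density 0 (sqrt v) (z $ i)) * ennreal (exp (a \<bullet> z + c * (norm z)\<^sup>2))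
        = (\<Prod>b\<in>Basis. f b (z \<bullet> b))" unfolding P f_def
      by (simp add: inner_axis prod_ennreal ennreal_mult''[symmetric] prod_nonneg prod.distrib mult.commute)
  qed
  also have "... = (\<Prod>b\<in>Basis. \<integral>\<^sup>+x. f b x \<partial>lborel)" by (rule nn_integral_lborel_prod) auto
  also have "... = (\<Prod>i\<in>UNIV. ennreal (exp (v * (a $ i)\<^sup>2 / (2 * (1 - 2 * c * v))) / sqrt (1 - 2 * c * v)))"
    unfolding P f_def nn_integral_exp_quadratic_normal[OF assms] by (simp add: inner_axis)
  also have "... = ennreal (exp (\<Sum>i\<in>UNIV. v * (a $ i)\<^sup>2 / (2 * (1 - 2 * c * v))) / sqrt (1 - 2 * c * v) ^ CARD('d))"
    using assms by (subst prod_ennreal) (auto simp: prod_dividef exp_sum)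
  also have "(\<Sum>i\<in>UNIV. v * (a $ i)\<^sup>2 / (2 * (1 - 2 * c * v))) = v * (norm a)\<^sup>2 / (2 * (1 - 2 * c * v))"
    by (simp add: n2 sum_distrib_left sum_divide_distrib)
  finally show ?thesis .
qed

lemma nn_integral_exp_gauss:
  fixes a :: "real^'d"
  assumes "0 < v"
  shows "(\<integral>\<^sup>+z. ennreal (exp (a \<bullet> z)) \<partial>gauss_vec v) = ennreal (exp (v * (norm a)\<^sup>2 / 2))"
  using nn_integral_exp_quadratic_gauss[of v 0 a] assms by simp

lemma prob_space_gauss_vec:
  assumes "0 < v"
  shows "prob_space (gauss_vec v :: (real^'d) measure)"
  using nn_integral_exp_gauss[OF assms, of "0::real^'d"] by (auto intro!: prob_spaceI)

text \<open>The right side is the square of \<open>exp (x/2) - exp (-(x/2))\<close>. For nonnegative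
  \<open>x\<close> this difference dominates \<open>x\<close>, because its derivative is at least 1;
  evenness covers the other sign.\<close>

lemma square_le_cosh: "(x::real)\<^sup>2 \<le> exp x + exp (- x) - 2"
proof -
  have *: "x\<^sup>2 \<le> exp x + exp (- x) - 2" if "0 \<le> x" for x :: real
  proof -
    have "exp (x/2) - exp (-(x/2)) \<ge> x"
    proof -
      let ?g = "\<lambda>y::real. exp (y/2) - exp (-(y/2)) - y"
      have "?g 0 \<le> ?g x"
      proof (rule DERIV_nonneg_imp_nondecreasing[OF that])
        fix y :: real
        have "(?g has_real_derivative (exp (y/2) / 2 + exp (-(y/2)) / 2 - 1)) (at y)"
          by (auto intro!: derivative_eq_intros)
        moreover have "exp (y/2) / 2 + exp (-(y/2)) / 2 - 1 \<ge> 0"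
          using exp_ge_add_one_self[of "y/2"] exp_ge_add_one_self[of "-(y/2)"] by linarith
        ultimately show "\<exists>D. (?g has_real_derivative D) (at y) \<and> 0 \<le> D" by blast
      qed
      then show ?thesis by simp
    qed
    then have "x\<^sup>2 \<le> (exp (x/2) - exp (-(x/2)))\<^sup>2" using that by (intro power_mono) auto
    also have "... = exp x + exp (- x) - 2"
    proof -
      have "exp x = exp (x/2) * exp (x/2)" "exp (-x) = exp (-(x/2)) * exp (-(x/2))"
        "exp (x/2) * exp (-(x/2)) = 1" by (simp_all flip: exp_add)
      then show ?thesis by (simp add: power2_eq_square algebra_simps)
    qed
    finally show ?thesis .
  qed
  show ?thesis using *[of x] *[of "-x"] by (cases "0 \<le> x") auto
qed

text \<open>Only exponential moments enter: integrate \<open>c\<^sup>2 y\<^sup>2 \<le> exp (c y) + exp (- c y) - 2\<close> and let \<open>c\<close> tend to 0.\<close>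

lemma nn_integral_square_gauss_le:
  fixes h :: "real^'d"
  assumes "0 < v"
  shows "(\<integral>\<^sup>+z. ennreal ((s + h \<bullet> z)\<^sup>2) \<partial>gauss_vec v) \<le> ennreal (s\<^sup>2 + v * (norm h)\<^sup>2)"
proof -
  let ?v = "v * (norm h)\<^sup>2"
  let ?p = "\<lambda>c z. ennreal (exp (c * s) * exp ((c *\<^sub>R h) \<bullet> z))"
  let ?J = "(\<integral>\<^sup>+z. ennreal ((s + h \<bullet> z)\<^sup>2) \<partial>gauss_vec v)"
  interpret N: prob_space "gauss_vec v :: (real^'d) measure" by (rule prob_space_gauss_vec[OF assms])
  have *: "?J \<le> ennreal ((exp (c * s) * exp (c\<^sup>2 * ?v / 2) + exp (- (c * s)) * exp (c\<^sup>2 * ?v / 2) - 2) / c\<^sup>2)"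
    if "0 < c" for c
  proof -
    have E: "(\<integral>\<^sup>+z. ?p d z \<partial>gauss_vec v) = ennreal (exp (d * s) * exp (c\<^sup>2 * ?v / 2))"
      if "d\<^sup>2 = c\<^sup>2" for d
    proof -
      have "(\<integral>\<^sup>+z. ?p d z \<partial>gauss_vec v)
          = ennreal (exp (d * s)) * (\<integral>\<^sup>+z. ennreal (exp ((d *\<^sub>R h) \<bullet> z)) \<partial>gauss_vec v)"
        unfolding ennreal_mult'[OF exp_ge_zero] by (rule nn_integral_cmult) measurable
      also have "... = ennreal (exp (d * s)) * ennreal (exp (v * (norm (d *\<^sub>R h))\<^sup>2 / 2))"
        by (simp only: nn_integral_exp_gauss[OF assms])
      also have "v * (norm (d *\<^sub>R h))\<^sup>2 / 2 = c\<^sup>2 * ?v / 2" using that by (simp add: power_mult_distrib)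
      finally show ?thesis by (simp add: ennreal_mult')
    qed
    have pw: "ennreal (c\<^sup>2 * (s + h \<bullet> z)\<^sup>2) + ennreal 2
        \<le> ?p c z + ?p (-c) z" for z
    proof -
      have "(c * (s + h \<bullet> z))\<^sup>2 \<le> exp (c * (s + h \<bullet> z)) + exp (- (c * (s + h \<bullet> z))) - 2"
        by (rule square_le_cosh)
      then have "c\<^sup>2 * (s + h \<bullet> z)\<^sup>2 + 2 \<le> exp (c * s) * exp ((c *\<^sub>R h) \<bullet> z) + exp ((-c) * s) * exp (((-c) *\<^sub>R h) \<bullet> z)"
        unfolding power_mult_distrib exp_add[symmetric] by (simp add: algebra_simps)
      moreover have "ennreal (c\<^sup>2 * (s + h \<bullet> z)\<^sup>2) + ennreal 2 = ennreal (c\<^sup>2 * (s + h \<bullet> z)\<^sup>2 + 2)"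
        by (rule ennreal_plus[symmetric]) auto
      moreover have "?p c z + ?p (-c) z
          = ennreal (exp (c * s) * exp ((c *\<^sub>R h) \<bullet> z) + exp ((-c) * s) * exp (((-c) *\<^sub>R h) \<bullet> z))"
        by (rule ennreal_plus[symmetric]) auto
      ultimately show ?thesis by (simp only: ennreal_leI)
    qed
    have "ennreal (c\<^sup>2) * ?J + ennreal 2 = (\<integral>\<^sup>+z. ennreal (c\<^sup>2 * (s + h \<bullet> z)\<^sup>2) + ennreal 2 \<partial>gauss_vec v)"
      by (subst nn_integral_add) (auto simp: ennreal_mult' nn_integral_cmult N.emeasure_space_1[simplified])
    also have "... \<le> (\<integral>\<^sup>+z. ?p c z + ?p (-c) z \<partial>gauss_vec v)" by (rule nn_integral_mono) (rule pw)
    also have "... = (\<integral>\<^sup>+z. ?p c z \<partial>gauss_vec v) + (\<integral>\<^sup>+z. ?p (-c) z \<partial>gauss_vec v)"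
      by (rule nn_integral_add) measurable
    also have "... = ennreal (exp (c * s) * exp (c\<^sup>2 * ?v / 2)) + ennreal (exp ((-c) * s) * exp (c\<^sup>2 * ?v / 2))"
      by (subst (1 2) E) auto
    finally have b: "ennreal (c\<^sup>2) * ?J + ennreal 2 \<le> ennreal (exp (c * s) * exp (c\<^sup>2 * ?v / 2) + exp (-(c * s)) * exp (c\<^sup>2 * ?v / 2))"
      by (simp flip: ennreal_plus)
    \<comment> \<open>The summand 2 can be moved across only among reals, so finiteness of
      \<open>?J\<close> is extracted from the bound first.\<close>
    have "ennreal (c\<^sup>2) * ?J \<noteq> \<top>" using b by (metis ennreal_neq_top ennreal_add_eq_top neq_top_trans)
    then have "?J \<noteq> \<top>" using that by (auto simp: ennreal_mult_eq_top_iff)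
    then obtain j where j: "?J = ennreal j" "0 \<le> j" by (cases ?J) auto
    have "ennreal (c\<^sup>2) * ennreal j + ennreal 2 = ennreal (c\<^sup>2 * j + 2)"
      using j(2) by (subst ennreal_mult[symmetric]) (auto simp del: ennreal_numeral intro!: ennreal_plus[symmetric])
    with b have "ennreal (c\<^sup>2 * j + 2) \<le> ennreal (exp (c * s) * exp (c\<^sup>2 * ?v / 2) + exp (-(c * s)) * exp (c\<^sup>2 * ?v / 2))"
      unfolding j(1) by (simp only:)
    then have "c\<^sup>2 * j + 2 \<le> exp (c * s) * exp (c\<^sup>2 * ?v / 2) + exp (-(c * s)) * exp (c\<^sup>2 * ?v / 2)"
      by (subst (asm) ennreal_le_iff) (auto simp: add_nonneg_nonneg)
    then show ?thesis unfolding j(1) using that by (intro ennreal_leI) (simp add: field_simps)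
  qed
  \<comment> \<open>The numerator is 2 exp (c^2 u / 2) cosh (c s) - 2, whose expansion at 0 begins
    with c^2 (s^2 + u).\<close>
  have lim: "((\<lambda>c. (exp (c * s) * exp (c\<^sup>2 * u / 2) + exp (- (c * s)) * exp (c\<^sup>2 * u / 2) - 2) / c\<^sup>2) \<longlongrightarrow> s\<^sup>2 + u) (at_right 0)" for u
  proof -
    have e: "s\<^sup>2 + u = u + s * s" by (simp add: power2_eq_square)
    show ?thesis unfolding e by real_asymp
  qed
  show ?thesis by (rule tendsto_lowerbound[OF tendsto_ennrealI[OF lim[of ?v]]])
      (auto intro!: eventually_at_rightI[of 0 1] *)
qed

section \<open>Brownian increments and their independence of the past\<close>

locale brownian_setup = prob_space M for M :: "'a measure" +
  fixes F :: "real \<Rightarrow> 'a measure" and W :: "real \<Rightarrow> 'a \<Rightarrow> real^'d"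
  assumes filtration: "usual_filtration M F" and brownian: "brownian_motion M F W"
begin

lemma subalg: "0 \<le> t \<Longrightarrow> subalgebra M (F t)"
  using filtration[unfolded usual_filtration_def, THEN conjunct1, rule_format, of t]
  by (simp add: subalgebra_def)

lemma space_F [simp]: "0 \<le> t \<Longrightarrow> space (F t) = space M" using subalg[of t] by (simp add: subalgebra_def)

lemma subalg_mono: "0 \<le> s \<Longrightarrow> s \<le> t \<Longrightarrow> subalgebra (F t) (F s)"
  using filtration[unfolded usual_filtration_def, THEN conjunct2, THEN conjunct1, rule_format, of s t]
  by (simp add: subalgebra_def)

lemma measurable_F_mono:
  assumes "f \<in> measurable (F s) N" "0 \<le> s" "s \<le> t"
  shows "f \<in> measurable (F t) N"
proof -
  have "subalgebra (F t) (F s)" by (rule subalg_mono[OF assms(2,3)])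
  then show ?thesis by (rule measurable_from_subalg[OF _ assms(1)])
qed

lemma measurable_F_M: "f \<in> measurable (F s) N \<Longrightarrow> 0 \<le> s \<Longrightarrow> f \<in> measurable M N"
  by (rule measurable_from_subalg[OF subalg])

lemma W_adapted: "0 \<le> t \<Longrightarrow> W t \<in> borel_measurable (F t)" using brownian by (auto simp: brownian_motion_def)

lemma W_measurable: "0 \<le> t \<Longrightarrow> W t \<in> borel_measurable M" by (rule measurable_F_M[OF W_adapted])

lemma W_0: "w \<in> space M \<Longrightarrow> W 0 w = 0" using brownian by (auto simp: brownian_motion_def)

lemma distr_increment:
  assumes "0 \<le> s" "s < t"
  shows "distr M borel (\<lambda>w. W t w - W s w) = gauss_vec (t - s)"
proof -
  have "distributed M lborel (\<lambda>w. W t w - W s w)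
      (\<lambda>x. ennreal (\<Prod>i\<in>UNIV. normal_density 0 (sqrt (t - s)) (x $ i)))"
    using brownian assms by (auto simp: brownian_motion_def)
  then have "distr M lborel (\<lambda>w. W t w - W s w) = gauss_vec (t - s)"
    by (simp add: distributed_def gauss_vec_def)
  moreover have "distr M lborel (\<lambda>w. W t w - W s w) = distr M borel (\<lambda>w. W t w - W s w)"
    by (rule distr_cong) auto
  ultimately show ?thesis by simp
qed

lemma increment_indep:
  assumes "0 \<le> s" "s < t" "A \<in> sets (F s)" "B \<in> sets borel"
  shows "prob (A \<inter> {w\<in>space M. W t w - W s w \<in> B}) = prob A * prob {w\<in>space M. W t w - W s w \<in> B}"
  using brownian[unfolded brownian_motion_def, THEN conjunct2, THEN conjunct2, THEN conjunct2,
    rule_format, of s t, THEN conjunct2, rule_format, of A B] assms by simp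

text \<open>This takes the place of conditional expectation. By independence the joint law of
  \<open>w\<close>, seen through \<open>F s\<close>, and the increment agrees with a product measure
  on rectangles, hence everywhere; Tonelli then integrates the increment out while the past stays
  fixed.\<close>

lemma nn_integral_freeze:
  assumes st: "0 \<le> s" "s < t" and \<phi>: "\<phi> \<in> borel_measurable (F s \<Otimes>\<^sub>M borel)"
  shows "(\<integral>\<^sup>+w. \<phi> (w, W t w - W s w) \<partial>M) = (\<integral>\<^sup>+w. \<integral>\<^sup>+z. \<phi> (w, z) \<partial>gauss_vec (t - s) \<partial>M)"
proof -
  let ?R = "restr_to_subalg M (F s)" and ?N = "gauss_vec (t - s) :: (real^'d) measure"
  let ?D = "\<lambda>w. W t w - W s w"
  note sub = subalg[OF st(1)]
  have sets_R [measurable_cong]: "sets ?R = sets (F s)" by (rule sets_restr_to_subalg[OF sub])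
  have [measurable]: "?D \<in> borel_measurable M" using W_measurable st by auto
  interpret R: prob_space ?R by (rule prob_space_restr_to_subalg[OF sub prob_space_axioms])
  interpret N: prob_space ?N by (rule prob_space_gauss_vec) (use st in simp)
  have id: "(\<lambda>w. w) \<in> measurable M (F s)" using sub by (auto simp: subalgebra_def intro: measurable_from_subalg)
  have pr [measurable]: "(\<lambda>w. (w, ?D w)) \<in> measurable M (F s \<Otimes>\<^sub>M borel)" using id by measurable
  have "?R \<Otimes>\<^sub>M ?N = distr M (F s \<Otimes>\<^sub>M borel) (\<lambda>w. (w, ?D w))"
  proof (rule pair_measure_eqI)
    show "sigma_finite_measure ?R" "sigma_finite_measure ?N" by unfold_locales
    show "sets (?R \<Otimes>\<^sub>M ?N) = sets (distr M (F s \<Otimes>\<^sub>M borel) (\<lambda>w. (w, ?D w)))"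
      unfolding sets_distr by (rule sets_pair_measure_cong[OF sets_R sets_gauss_vec])
  next
    fix A B assume "A \<in> sets ?R" "B \<in> sets ?N"
    then have A: "A \<in> sets (F s)" and B [measurable]: "B \<in> sets borel" by (simp_all add: sets_R)
    have A': "A \<in> sets M" using A sub by (auto simp: subalgebra_def)
    have "emeasure ?N B = emeasure (distr M borel ?D) B" unfolding distr_increment[OF st] ..
    also have "... = prob {w\<in>space M. ?D w \<in> B}"
      by (subst emeasure_distr) (auto simp: emeasure_eq_measure vimage_def Int_def conj_commute)
    finally have NB: "emeasure ?N B = prob {w\<in>space M. ?D w \<in> B}" .
    have "emeasure (distr M (F s \<Otimes>\<^sub>M borel) (\<lambda>w. (w, ?D w))) (A \<times> B) = prob (A \<inter> {w\<in>space M. ?D w \<in> B})"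
    proof (subst emeasure_distr)
      show "A \<times> B \<in> sets (F s \<Otimes>\<^sub>M borel)" using A B by auto
      have "(\<lambda>w. (w, ?D w)) -` (A \<times> B) \<inter> space M = A \<inter> {w\<in>space M. ?D w \<in> B}"
        using sets.sets_into_space[OF A'] by auto
      then show "emeasure M ((\<lambda>w. (w, ?D w)) -` (A \<times> B) \<inter> space M) = prob (A \<inter> {w\<in>space M. ?D w \<in> B})"
        by (simp add: emeasure_eq_measure)
    qed (fact pr)
    then show "emeasure ?R A * emeasure ?N B = emeasure (distr M (F s \<Otimes>\<^sub>M borel) (\<lambda>w. (w, ?D w))) (A \<times> B)"
      unfolding emeasure_restr_to_subalg[OF sub A] NB increment_indep[OF st A B]
      by (simp add: emeasure_eq_measure ennreal_mult)
  qed
  note eq = this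
  have \<phi>' [measurable]: "\<phi> \<in> borel_measurable (?R \<Otimes>\<^sub>M ?N)"
    using \<phi> by (simp cong: measurable_cong_sets add: sets_R cong: sets_pair_measure_cong)
  have "(\<integral>\<^sup>+w. \<phi> (w, ?D w) \<partial>M) = (\<integral>\<^sup>+p. \<phi> p \<partial>distr M (F s \<Otimes>\<^sub>M borel) (\<lambda>w. (w, ?D w)))"
    by (rule nn_integral_distr[symmetric]) (use \<phi> pr in auto)
  also have "... = (\<integral>\<^sup>+w. \<integral>\<^sup>+z. \<phi> (w, z) \<partial>?N \<partial>?R)"
    unfolding eq[symmetric] by (rule N.nn_integral_fst[symmetric]) (fact \<phi>')
  also have "... = (\<integral>\<^sup>+w. \<integral>\<^sup>+z. \<phi> (w, z) \<partial>?N \<partial>M)" by (rule nn_integral_subalgebra2[OF sub])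
      (use N.borel_measurable_nn_integral_fst[OF \<phi>'] in \<open>simp cong: measurable_cong_sets add: sets_R\<close>)
  finally show ?thesis .
qed

end

section \<open>A maximal inequality on a grid\<close>

lemma borel_measurable_matrix_vector_mult [measurable (raw)]:
  fixes A :: "'b \<Rightarrow> real^'m^'n" and x :: "'b \<Rightarrow> real^'m"
  assumes "A \<in> borel_measurable N" "x \<in> borel_measurable N"
  shows "(\<lambda>u. A u *v x u) \<in> borel_measurable N" by (rule borel_measurable_continuous_Pair[OF assms])
    (auto simp: matrix_vector_mult_def intro!: continuous_intros)

text \<open>Pairing \<open>x v* B\<close> with itself moves \<open>B\<close> onto one factor, where
  the bound applies: a contraction has a contractive transpose.\<close>

lemma norm_vector_matrix_le:
  fixes B :: "real^'n^'m"
  assumes "\<And>y. norm (B *v y) \<le> norm y"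
  shows "norm (x v* B) \<le> norm x"
proof -
  have "(norm (x v* B))\<^sup>2 = x \<bullet> (B *v (x v* B))" by (metis dot_lmul_matrix power2_norm_eq_inner)
  also have "... \<le> norm x * norm (B *v (x v* B))" by (rule norm_cauchy_schwarz)
  also have "... \<le> norm x * norm (x v* B)" using assms by (intro mult_left_mono) auto
  finally have "norm (x v* B) * norm (x v* B) \<le> norm x * norm (x v* B)" by (simp add: power2_eq_square)
  then show ?thesis by (cases "norm (x v* B) = 0") (auto dest: mult_right_le_imp_le)
qed

text \<open>Steps are strict so that every increment of \<open>W\<close> over a cell is a
  nondegenerate Gaussian. Values of \<open>s\<close> beyond index \<open>N\<close> are
  arbitrary.\<close>

definition grid :: "real \<Rightarrow> nat \<Rightarrow> (nat \<Rightarrow> real) \<Rightarrow> bool" where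
  "grid T N s \<longleftrightarrow> s 0 = 0 \<and> s N = T \<and> (\<forall>l<N. s l < s (Suc l))"

lemma grid_less:
  assumes "grid T N s" "l < m" "m \<le> N"
  shows "s l < s m" using assms(2,3)
proof (induction m)
  case (Suc m)
  then have "s m < s (Suc m)" using assms(1) by (auto simp: grid_def)
  with Suc show ?case by (cases "l = m") (auto dest: less_trans)
qed simp

lemma grid_mono: "grid T N s \<Longrightarrow> l \<le> m \<Longrightarrow> m \<le> N \<Longrightarrow> s l \<le> s m"
  using grid_less[of T N s l m] by (cases "l = m") auto

lemma grid_nonneg: "grid T N s \<Longrightarrow> l \<le> N \<Longrightarrow> 0 \<le> s l" using grid_mono[of T N s 0 l] by (auto simp: grid_def)

lemma grid_le: "grid T N s \<Longrightarrow> l \<le> N \<Longrightarrow> s l \<le> T" using grid_mono[of T N s l N] by (auto simp: grid_def)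

context brownian_setup
begin

definition incr :: "(nat \<Rightarrow> real) \<Rightarrow> nat \<Rightarrow> 'a \<Rightarrow> real^'d" where
  "incr s l w = W (s (Suc l)) w - W (s l) w"

text \<open>Applied to \<open>vint s B\<close>, whose value at \<open>l\<close> stops before the
  increment over cell \<open>l\<close>, this is a double sum without diagonal terms, the discrete
  form of an iterated Ito integral.\<close>

definition dint :: "(nat \<Rightarrow> real) \<Rightarrow> (nat \<Rightarrow> 'a \<Rightarrow> real^'d) \<Rightarrow> nat \<Rightarrow> 'a \<Rightarrow> real" where
  "dint s G m w = (\<Sum>l<m. G l w \<bullet> incr s l w)"

definition vint :: "(nat \<Rightarrow> real) \<Rightarrow> (nat \<Rightarrow> 'a \<Rightarrow> real^'d^'d) \<Rightarrow> nat \<Rightarrow> 'a \<Rightarrow> real^'d" where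
  "vint s B m w = (\<Sum>l<m. B l w *v incr s l w)"

lemma increment_measurable:
  assumes "grid T N s" "l < m" "m \<le> N"
  shows "incr s l \<in> borel_measurable (F (s m))"
proof -
  have "W (s k) \<in> borel_measurable (F (s m))" if "k \<le> m" for k by (rule measurable_F_mono[OF W_adapted])
      (use assms that grid_nonneg[OF assms(1)] grid_mono[OF assms(1)] in auto)
  then show ?thesis using assms(2) unfolding incr_def by (intro borel_measurable_diff) auto
qed

lemma dint_measurable:
  assumes "grid T N s" "m \<le> N" "\<And>l. l < m \<Longrightarrow> G l \<in> borel_measurable (F (s l))"
  shows "dint s G m \<in> borel_measurable (F (s m))" unfolding dint_def
proof (intro borel_measurable_sum borel_measurable_inner)
  fix l assume "l \<in> {..<m}"
  then have l: "l < m" by simp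
  show "G l \<in> borel_measurable (F (s m))" by (rule measurable_F_mono[OF assms(3)[OF l]])
      (use l assms(2) grid_nonneg[OF assms(1)] grid_mono[OF assms(1)] in auto)
  show "incr s l \<in> borel_measurable (F (s m))" by (rule increment_measurable[OF assms(1) l assms(2)])
qed

lemma vint_measurable:
  assumes "grid T N s" "m \<le> N" "\<And>l. l < m \<Longrightarrow> B l \<in> borel_measurable (F (s l))"
  shows "vint s B m \<in> borel_measurable (F (s m))" unfolding vint_def
proof (intro borel_measurable_sum borel_measurable_matrix_vector_mult)
  fix l assume "l \<in> {..<m}"
  then have l: "l < m" by simp
  show "B l \<in> borel_measurable (F (s m))" by (rule measurable_F_mono[OF assms(3)[OF l]])
      (use l assms(2) grid_nonneg[OF assms(1)] grid_mono[OF assms(1)] in auto)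
  show "incr s l \<in> borel_measurable (F (s m))" by (rule increment_measurable[OF assms(1) l assms(2)])
qed

text \<open>With the past frozen at \<open>s\<close>, only a Gaussian integral in the increment
  remains. Contractivity replaces \<open>norm (B w *v z)\<close> by \<open>norm z\<close>, and
  enlarging \<open>\<nu> - p\<close> to \<open>\<nu>\<close> in the denominators gives a recursion
  that closes up: \<open>\<nu>\<close> becomes \<open>\<nu> / (1 - 2 * \<nu> * (t - s))\<close>. The
  event \<open>A\<close> will be that the level has not been reached so far.\<close>

lemma nn_integral_exp_step:
  assumes st: "0 \<le> s" "s < t" and A: "A \<in> sets (F s)"
    and [measurable]: "V \<in> borel_measurable (F s)" "X \<in> borel_measurable (F s)" "B \<in> borel_measurable (F s)"
    and B: "\<And>w y. w \<in> space M \<Longrightarrow> norm (B w *v y) \<le> norm y"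
    and p: "0 < p" "p \<le> \<nu>" "2 * \<nu> * (t - s) < 1"
  shows "(\<integral>\<^sup>+w. indicator A w * ennreal (exp (2 * p * (V w + X w \<bullet> (W t w - W s w))
          + (\<nu> - p) * (norm (X w + B w *v (W t w - W s w)))\<^sup>2)) \<partial>M)
    \<le> (\<integral>\<^sup>+w. indicator A w * ennreal (exp (2 * p * V w + (\<nu> / (1 - 2 * \<nu> * (t - s)) - p) * (norm (X w))\<^sup>2)
          / sqrt (1 - 2 * \<nu> * (t - s)) ^ CARD('d)) \<partial>M)"
proof -
  let ?dt = "t - s" and ?\<mu> = "\<nu> - p"
  let ?sn = "sqrt (1 - 2 * \<nu> * ?dt) ^ CARD('d)" and ?sm = "sqrt (1 - 2 * ?\<mu> * ?dt) ^ CARD('d)"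
    and ?g = "\<lambda>w. 2 * p * V w + (\<nu> / (1 - 2 * \<nu> * ?dt) - p) * (norm (X w))\<^sup>2"
    and ?lo = "\<lambda>a :: real^'d. ?dt * (norm a)\<^sup>2 / (2 * (1 - 2 * ?\<mu> * ?dt))"
    and ?hi = "\<lambda>w. ?dt * (4 * \<nu>\<^sup>2 * (norm (X w))\<^sup>2) / (2 * (1 - 2 * \<nu> * ?dt))"
  have [measurable]: "A \<in> sets (F s)" by (rule A)
  define \<phi> where "\<phi> = (\<lambda>(w, z). indicator A w * ennreal (exp (2 * p * (V w + X w \<bullet> z) + ?\<mu> * (norm (X w + B w *v z))\<^sup>2)))"
  have \<phi>: "\<phi> \<in> borel_measurable (F s \<Otimes>\<^sub>M borel)" unfolding \<phi>_def by measurable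
  have d: "0 < ?dt" using st by simp
  have \<mu>: "0 \<le> ?\<mu>" "?\<mu> \<le> \<nu>" using p by auto
  have "?\<mu> * ?dt \<le> \<nu> * ?dt" using \<mu>(2) d by (intro mult_right_mono) auto
  then have q: "2 * ?\<mu> * ?dt < 1" "1 - 2 * \<nu> * ?dt \<le> 1 - 2 * ?\<mu> * ?dt" "0 < 1 - 2 * \<nu> * ?dt"
    using p(3) unfolding mult.assoc by (linarith, linarith, linarith)
  have "(\<integral>\<^sup>+w. \<phi> (w, W t w - W s w) \<partial>M) = (\<integral>\<^sup>+w. \<integral>\<^sup>+z. \<phi> (w, z) \<partial>gauss_vec ?dt \<partial>M)"
    by (rule nn_integral_freeze[OF st \<phi>])
  also have "... \<le> (\<integral>\<^sup>+w. indicator A w * ennreal (exp (?g w)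
          / ?sn) \<partial>M)"
  proof (rule nn_integral_mono)
    fix w assume w: "w \<in> space M"
    define a where "a = (2 * p) *\<^sub>R X w + (2 * ?\<mu>) *\<^sub>R (X w v* B w)"
    define k where "k = 2 * p * V w + ?\<mu> * (norm (X w))\<^sup>2"
    have pw: "2 * p * (V w + X w \<bullet> z) + ?\<mu> * (norm (X w + B w *v z))\<^sup>2 \<le> k + (a \<bullet> z + ?\<mu> * (norm z)\<^sup>2)" for z
    proof -
      have "(norm (X w + B w *v z))\<^sup>2 = (norm (X w))\<^sup>2 + 2 * (X w \<bullet> (B w *v z)) + (norm (B w *v z))\<^sup>2"
        by (simp add: power2_norm_eq_inner inner_simps inner_commute)
      also have "... \<le> (norm (X w))\<^sup>2 + 2 * ((X w v* B w) \<bullet> z) + (norm z)\<^sup>2"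
        using B[OF w, of z] by (auto simp: dot_lmul_matrix intro!: power_mono)
      finally have "?\<mu> * (norm (X w + B w *v z))\<^sup>2 \<le> ?\<mu> * ((norm (X w))\<^sup>2 + 2 * ((X w v* B w) \<bullet> z) + (norm z)\<^sup>2)"
        using \<mu>(1) by (rule mult_left_mono)
      then show ?thesis unfolding a_def k_def inner_add_left inner_scaleR_left by (simp add: algebra_simps)
    qed
    \<comment> \<open>The two parts of \<open>a\<close> have lengths at most 2 p |X| and 2 (\<nu> -
      p) |X|, which add up to 2 \<nu> |X|.\<close>
    have na: "(norm a)\<^sup>2 \<le> 4 * \<nu>\<^sup>2 * (norm (X w))\<^sup>2"
    proof -
      have "norm a \<le> 2 * p * norm (X w) + 2 * ?\<mu> * norm (X w v* B w)"
        unfolding a_def by (rule norm_triangle_le) (use p \<mu> in simp)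
      also have "... \<le> 2 * p * norm (X w) + 2 * ?\<mu> * norm (X w)"
        using norm_vector_matrix_le[OF B[OF w], of "X w"] \<mu> by (intro add_left_mono mult_left_mono) auto
      also have "... = 2 * \<nu> * norm (X w)" by (simp add: algebra_simps)
      finally have "(norm a)\<^sup>2 \<le> (2 * \<nu> * norm (X w))\<^sup>2" by (rule power_mono) simp
      then show ?thesis by (simp add: power_mult_distrib)
    qed
    have "(\<integral>\<^sup>+z. \<phi> (w, z) \<partial>gauss_vec ?dt) \<le> (\<integral>\<^sup>+z. (indicator A w * ennreal (exp k)) * ennreal (exp (a \<bullet> z + ?\<mu> * (norm z)\<^sup>2)) \<partial>gauss_vec ?dt)"
      unfolding \<phi>_def using pw
      by (intro nn_integral_mono) (auto simp: indicator_def ennreal_mult''[symmetric] exp_add[symmetric] intro!: ennreal_leI)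
    also have "... = (indicator A w * ennreal (exp k)) * (\<integral>\<^sup>+z. ennreal (exp (a \<bullet> z + ?\<mu> * (norm z)\<^sup>2)) \<partial>gauss_vec ?dt)"
      by (rule nn_integral_cmult) measurable
    also have "... = indicator A w * ennreal (exp k * (exp (?lo a) / ?sm))"
      unfolding nn_integral_exp_quadratic_gauss[OF d q(1)] by (simp only: ennreal_mult' exp_ge_zero mult.assoc)
    also have "... \<le> indicator A w * ennreal (exp (?g w)
          / ?sn)"
    proof (intro mult_left_mono ennreal_leI)
      have "?lo a \<le> ?hi w" using na d q by (intro frac_le mult_left_mono) auto
      then have "k + ?lo a \<le> k + ?hi w" by simp
      also have "... = ?g w" using q(3) unfolding k_def by (simp add: field_simps power2_eq_square)
      finally have e: "exp k * exp (?lo a) \<le> exp (?g w)" by (simp flip: exp_add)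
      have "?sn \<le> ?sm" using q by (intro power_mono) auto
      moreover have "0 < ?sn" using q(3) by simp
      ultimately show "exp k * (exp (?lo a) / ?sm)
        \<le> exp (?g w) / ?sn" using e unfolding times_divide_eq_right by (intro frac_le) auto
    qed simp
    finally show "(\<integral>\<^sup>+z. \<phi> (w, z) \<partial>gauss_vec ?dt) \<le> ..." .
  qed
  finally show ?thesis by (simp add: \<phi>_def)
qed

text \<open>Doob's maximal inequality with the stopping built into the process: the mean of
  \<open>Z\<close> does not increase along the grid, it starts at
  \<open>1 / sqrt (1 - 2 * p * T) ^ CARD('d)\<close>, and \<open>Z\<close> ends at or above
  \<open>exp (p * \<alpha>)\<close> on the event in question.\<close>

lemma prob_max_iterated_integral_le:
  assumes part: "grid T N s" and Bm: "\<And>l. l < N \<Longrightarrow> B l \<in> borel_measurable (F (s l))"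
    and B: "\<And>l w y. l < N \<Longrightarrow> w \<in> space M \<Longrightarrow> norm (B l w *v y) \<le> norm y"
    and p: "0 < p" "2 * p * T < 1"
  shows "prob {w\<in>space M. \<exists>m\<le>N. \<alpha> \<le> 2 * dint s (vint s B) m w}
    \<le> exp (- p * \<alpha>) / sqrt (1 - 2 * p * T) ^ CARD('d)"
proof -
  define V where "V m = dint s (vint s B) m" for m
  define X where "X m = vint s B m" for m
  \<comment> \<open>\<open>r\<close> increases to 1 at the last node, where the quadratic term drops
    out of \<open>U\<close>. At node 0 both sums are empty and \<open>U 0\<close> is a constant, the
    prefactor of the claim.\<close>
  define r where "r k = 1 - 2 * p * (T - s k)" for k
  define U where "U k w = exp (2 * p * V k w + (p / r k - p) * (norm (X k w))\<^sup>2) / sqrt (r k) ^ CARD('d)" for k w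
  \<comment> \<open>Only indices below \<open>k\<close> are tested, so \<open>H (Suc k)\<close> is
    decided at time \<open>s k\<close> and is independent of the increment over the cell that starts
    there.\<close>
  define H where "H k = {w\<in>space M. \<exists>l<k. \<alpha> \<le> 2 * V l w}" for k
  define Z where "Z k w = indicator (H k) w * ennreal (exp (p * \<alpha>)) + indicator (space M - H k) w * ennreal (U k w)" for k w
  \<comment> \<open>\<open>Z\<close> is the supermartingale \<open>U\<close>, frozen at the level \<open>exp (p * \<alpha>)\<close> once \<open>2 * V\<close> has reached \<open>\<alpha>\<close>.\<close>
  have nn: "0 \<le> s k" "s k \<le> T" if "k \<le> N" for k using grid_nonneg[OF part that] grid_le[OF part that] by auto
  have r: "0 < r k" "r k \<le> 1" if "k \<le> N" for k
    using p nn[OF that] mult_left_mono[of "T - s k" T "2 * p"] unfolding r_def by (linarith, simp)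
  have X0: "X m \<in> borel_measurable (F (s m))" if "m \<le> N" for m
    unfolding X_def using vint_measurable[OF part that] Bm that by auto
  have V0: "V m \<in> borel_measurable (F (s m))" if "m \<le> N" for m unfolding V_def
  proof (rule dint_measurable[OF part that])
    show "vint s B l \<in> borel_measurable (F (s l))" if "l < m" for l
      using X0[of l] that \<open>m \<le> N\<close> by (simp add: X_def)
  qed
  have XM: "X m \<in> borel_measurable M" and VM: "V m \<in> borel_measurable M" if "m \<le> N" for m
    using measurable_F_M[OF X0[OF that]] measurable_F_M[OF V0[OF that]] nn[OF that] by auto
  have HF: "space M - H (Suc k) \<in> sets (F (s k))" if "k \<le> N" for k
  proof -
    have [measurable]: "V l \<in> borel_measurable (F (s k))" if "l \<in> {..k}" for l
      using that \<open>k \<le> N\<close> by (intro measurable_F_mono[OF V0] nn grid_mono[OF part]) auto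
    have "{w\<in>space (F (s k)). \<not> (\<exists>l\<in>{..k}. \<alpha> \<le> 2 * V l w)} \<in> sets (F (s k))" by measurable
    also have "{w\<in>space (F (s k)). \<not> (\<exists>l\<in>{..k}. \<alpha> \<le> 2 * V l w)} = space M - H (Suc k)"
      using nn[OF that] by (auto simp: H_def less_Suc_eq_le)
    finally show ?thesis .
  qed
  have HM [measurable]: "H k \<in> sets M" if "k \<le> Suc N" for k
  proof -
    have [measurable]: "V l \<in> borel_measurable M" if "l \<in> {..<k}" for l using VM that \<open>k \<le> Suc N\<close> by auto
    have "{w\<in>space M. \<exists>l\<in>{..<k}. \<alpha> \<le> 2 * V l w} \<in> sets M" by measurable
    then show ?thesis by (simp add: H_def Bex_def)
  qed
  have UM: "U k \<in> borel_measurable M" if "k \<le> N" for k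
    unfolding U_def[abs_def] using XM[OF that] VM[OF that] by measurable
  \<comment> \<open>Since \<open>r k\<close> is at most 1, both the quadratic term and the division
    can only increase \<open>U k\<close> beyond exp (2 p V).\<close>
  have hit: "exp (p * \<alpha>) \<le> U k w" if "k \<le> N" "\<alpha> \<le> 2 * V k w" for k w
  proof -
    have "1 \<le> 1 / r k" using r[OF that(1)] by (simp add: field_simps)
    then have "p \<le> p / r k" using p(1) mult_left_mono[of 1 "1 / r k" p] by simp
    then have "0 \<le> (p / r k - p) * (norm (X k w))\<^sup>2" by simp
    moreover have "p * \<alpha> \<le> 2 * p * V k w" using mult_left_mono[OF that(2), of p] p(1) by simp
    ultimately have "exp (p * \<alpha>) \<le> exp (2 * p * V k w + (p / r k - p) * (norm (X k w))\<^sup>2)" by simp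
    moreover have "0 < sqrt (r k) ^ CARD('d)" "sqrt (r k) ^ CARD('d) \<le> 1"
      using r[OF that(1)] by (auto intro!: power_le_one)
    ultimately show ?thesis unfolding U_def using frac_le[of "exp (2 * p * V k w + (p / r k - p) * (norm (X k w))\<^sup>2)" "exp (p * \<alpha>)" "sqrt (r k) ^ CARD('d)" 1]
      by simp
  qed
  have step: "(\<integral>\<^sup>+w. Z (Suc k) w \<partial>M) \<le> (\<integral>\<^sup>+w. Z k w \<partial>M)" if k: "k < N" for k
  proof -
    let ?A = "space M - H (Suc k)" and ?\<nu> = "p / r (Suc k)" and ?dt = "s (Suc k) - s k"
    have sk: "0 \<le> s k" "s k < s (Suc k)" using nn[of k] part k by (auto simp: grid_def)
    have rr: "r (Suc k) = r k + 2 * p * ?dt" by (simp add: r_def algebra_simps)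
    have r1: "0 < r (Suc k)" "r (Suc k) \<le> 1" "0 < r k" using r k by auto
    \<comment> \<open>This identity dictates \<open>r\<close>: for the coefficient
      \<open>p / r (Suc k)\<close> the one-step factor is a quotient of consecutive values, so that
      the coefficient becomes \<open>p / r k\<close> and the normalisations telescope.\<close>
    have q: "1 - 2 * ?\<nu> * ?dt = r k / r (Suc k)" using r1 rr by (simp add: field_simps)
    have c: "0 < sqrt (r (Suc k)) ^ CARD('d)" using r1 by simp
    let ?f = "\<lambda>w. exp (2 * p * (V k w + X k w \<bullet> (W (s (Suc k)) w - W (s k) w))
          + (?\<nu> - p) * (norm (X k w + B k w *v (W (s (Suc k)) w - W (s k) w)))\<^sup>2)"
    let ?h = "\<lambda>w. exp (2 * p * V k w + (?\<nu> / (1 - 2 * ?\<nu> * ?dt) - p) * (norm (X k w))\<^sup>2)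
          / sqrt (1 - 2 * ?\<nu> * ?dt) ^ CARD('d)"
    let ?c = "ennreal (1 / sqrt (r (Suc k)) ^ CARD('d))"
    have "(\<integral>\<^sup>+w. indicator ?A w * ennreal (U (Suc k) w) \<partial>M)
      = (\<integral>\<^sup>+w. ?c * (indicator ?A w * ennreal (?f w)) \<partial>M)" unfolding U_def by (intro nn_integral_cong)
        (use c in \<open>auto simp: V_def X_def dint_def vint_def incr_def indicator_def ennreal_mult'[symmetric] simp del: zero_less_power_eq\<close>)
    also have "... = ?c * (\<integral>\<^sup>+w. indicator ?A w * ennreal (?f w) \<partial>M)"
    proof (rule nn_integral_cmult)
      have [measurable]: "X k \<in> borel_measurable M" "V k \<in> borel_measurable M" "B k \<in> borel_measurable M"
        "W (s (Suc k)) \<in> borel_measurable M" "W (s k) \<in> borel_measurable M" "H (Suc k) \<in> sets M"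
        using XM VM k measurable_F_M[OF Bm[OF k]] sk W_measurable HM by auto
      show "(\<lambda>w. indicator ?A w * ennreal (?f w)) \<in> borel_measurable M" by measurable
    qed
    also have "... \<le> ?c * (\<integral>\<^sup>+w. indicator ?A w * ennreal (?h w) \<partial>M)"
    proof (rule mult_left_mono[OF nn_integral_exp_step[OF sk HF V0 X0 Bm B p(1)]])
      show "p \<le> ?\<nu>" using r1 p(1) by (simp add: field_simps)
      have "0 < 1 - 2 * ?\<nu> * ?dt" unfolding q using r1 by simp
      then show "2 * ?\<nu> * ?dt < 1" by simp
    qed (use k in auto)
    also have "... = (\<integral>\<^sup>+w. ?c * (indicator ?A w * ennreal (?h w)) \<partial>M)"
    proof (rule nn_integral_cmult[symmetric])
      have [measurable]: "X k \<in> borel_measurable M" "V k \<in> borel_measurable M" "H (Suc k) \<in> sets M"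
        using XM VM k HM by auto
      show "(\<lambda>w. indicator ?A w * ennreal (?h w)) \<in> borel_measurable M" by measurable
    qed
    also have "... = (\<integral>\<^sup>+w. indicator ?A w * ennreal (U k w) \<partial>M)"
    proof (intro nn_integral_cong)
      fix w
      have e1: "?\<nu> / (1 - 2 * ?\<nu> * ?dt) = p / r k" unfolding q using r1 by simp
      have e2: "sqrt (1 - 2 * ?\<nu> * ?dt) ^ CARD('d) = sqrt (r k) ^ CARD('d) / sqrt (r (Suc k)) ^ CARD('d)"
        unfolding q by (simp add: real_sqrt_divide power_divide)
      have "1 / sqrt (r (Suc k)) ^ CARD('d) * (?h w) = U k w" using c r1(1) unfolding U_def e1 e2 by simp
      then show "?c * (indicator ?A w * ennreal (?h w)) = indicator ?A w * ennreal (U k w)"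
        using c by (simp only: mult.left_commute[of "?c"] ennreal_mult'[symmetric] divide_nonneg_nonneg zero_le_one less_imp_le)
    qed
    finally have main: "(\<integral>\<^sup>+w. indicator ?A w * ennreal (U (Suc k) w) \<partial>M) \<le> (\<integral>\<^sup>+w. indicator ?A w * ennreal (U k w) \<partial>M)" .
    have [measurable]: "U k \<in> borel_measurable M" "U (Suc k) \<in> borel_measurable M" "H (Suc k) \<in> sets M"
      using UM HM k by auto
    let ?i = "\<lambda>w. indicator (H (Suc k)) w * ennreal (exp (p * \<alpha>))"
    have "(\<integral>\<^sup>+w. Z (Suc k) w \<partial>M) = (\<integral>\<^sup>+w. ?i w \<partial>M) + (\<integral>\<^sup>+w. indicator ?A w * ennreal (U (Suc k) w) \<partial>M)"
      unfolding Z_def by (rule nn_integral_add) measurable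
    also have "... \<le> (\<integral>\<^sup>+w. ?i w \<partial>M) + (\<integral>\<^sup>+w. indicator ?A w * ennreal (U k w) \<partial>M)"
      using main by (rule add_left_mono)
    also have "... = (\<integral>\<^sup>+w. ?i w + indicator ?A w * ennreal (U k w) \<partial>M)"
      by (rule nn_integral_add[symmetric]) measurable
    also have "... \<le> (\<integral>\<^sup>+w. Z k w \<partial>M)"
    proof (rule nn_integral_mono)
      fix w assume w: "w \<in> space M"
      \<comment> \<open>Paths that reach the level exactly at index \<open>k\<close> exchange
        \<open>U k\<close> for the constant, which \<open>hit\<close> shows to be no larger.\<close>
      show "?i w + indicator ?A w * ennreal (U k w) \<le> Z k w"
        using hit[of k w] k w by (auto simp: Z_def indicator_def H_def less_Suc_eq intro!: ennreal_leI)
    qed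
    finally show ?thesis .
  qed
  have Z: "(\<integral>\<^sup>+w. Z k w \<partial>M) \<le> (\<integral>\<^sup>+w. Z 0 w \<partial>M)" if "k \<le> N" for k using that
  proof (induction k)
    case (Suc k)
    then show ?case using step[of k] by (auto dest: order_trans)
  qed simp
  have "(\<integral>\<^sup>+w. Z 0 w \<partial>M) = (\<integral>\<^sup>+w. ennreal (1 / sqrt (1 - 2 * p * T) ^ CARD('d)) \<partial>M)"
    using part by (intro nn_integral_cong)
      (auto simp: Z_def H_def U_def V_def X_def dint_def vint_def r_def grid_def)
  also have "... = ennreal (1 / sqrt (1 - 2 * p * T) ^ CARD('d))" by (simp add: emeasure_space_1)
  finally have Z0: "(\<integral>\<^sup>+w. Z N w \<partial>M) \<le> ennreal (1 / sqrt (1 - 2 * p * T) ^ CARD('d))" using Z[of N] by simp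
  have "ennreal (exp (p * \<alpha>) * prob (H (Suc N))) = (\<integral>\<^sup>+w. ennreal (exp (p * \<alpha>)) * indicator (H (Suc N)) w \<partial>M)"
    by (subst nn_integral_cmult_indicator) (auto simp: HM emeasure_eq_measure ennreal_mult')
  also have "... \<le> (\<integral>\<^sup>+w. Z N w \<partial>M)"
  proof (rule nn_integral_mono)
    fix w assume w: "w \<in> space M"
    \<comment> \<open>\<open>Z N\<close> has not tested index \<open>N\<close> itself; paths that
      reach the level only there are covered by \<open>hit\<close>.\<close>
    show "ennreal (exp (p * \<alpha>)) * indicator (H (Suc N)) w \<le> Z N w"
      using hit[of N w] w by (auto simp: Z_def indicator_def H_def less_Suc_eq intro!: ennreal_leI)
  qed
  finally have "ennreal (exp (p * \<alpha>) * prob (H (Suc N))) \<le> ennreal (1 / sqrt (1 - 2 * p * T) ^ CARD('d))" using Z0 by (rule order_trans)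
  then have "exp (p * \<alpha>) * prob (H (Suc N)) \<le> 1 / sqrt (1 - 2 * p * T) ^ CARD('d)"
    using p by (subst (asm) ennreal_le_iff) auto
  then have "exp (- (p * \<alpha>)) * (exp (p * \<alpha>) * prob (H (Suc N))) \<le> exp (- (p * \<alpha>)) * (1 / sqrt (1 - 2 * p * T) ^ CARD('d))"
    by (rule mult_left_mono) simp
  then have "prob (H (Suc N)) \<le> exp (- p * \<alpha>) / sqrt (1 - 2 * p * T) ^ CARD('d)"
    by (simp add: mult.assoc[symmetric] flip: exp_add)
  then show ?thesis by (simp add: H_def V_def less_Suc_eq_le)
qed

end

section \<open>The isometry for simple integrands\<close>

lemma ex_grid:
  assumes "finite S" "S \<subseteq> {0..T}" "0 < T"
  shows "\<exists>N s. grid T N s \<and> s ` {..N} = insert 0 (insert T S)"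
proof -
  define S' where "S' = insert 0 (insert T S)"
  define xs where "xs = sorted_list_of_set S'"
  have fin: "finite S'" using assms by (simp add: S'_def)
  have set: "set xs = S'" using fin by (simp add: xs_def)
  have srt: "sorted_wrt (<) xs" using fin by (simp add: xs_def)
  have bd: "x \<in> {0..T}" if "x \<in> S'" for x using that assms by (auto simp: S'_def)
  have len: "0 < length xs" using set by (auto simp: S'_def)
  have mono: "xs ! i \<le> xs ! j" if "i \<le> j" "j < length xs" for i j
    using sorted_wrt_nth_less[OF srt, of i j] that by (cases "i = j") auto
  obtain i where i: "i < length xs" "xs ! i = 0" using set by (metis S'_def in_set_conv_nth insertI1)
  obtain j where j: "j < length xs" "xs ! j = T" using set by (metis S'_def in_set_conv_nth insertI1 insertI2)
  have "xs ! 0 = 0" using mono[of 0 i] i bd[of "xs ! 0"] len set nth_mem[OF len] by auto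
  moreover have "xs ! (length xs - 1) = T"
  proof -
    have "xs ! (length xs - 1) \<in> S'" using set len by (metis diff_less nth_mem zero_less_one)
    then show ?thesis using mono[of j "length xs - 1"] j bd[of "xs ! (length xs - 1)"] by auto
  qed
  moreover have "xs ! l < xs ! Suc l" if "l < length xs - 1" for l
    using sorted_wrt_nth_less[OF srt, of l "Suc l"] that by auto
  ultimately have "grid T (length xs - 1) ((!) xs)" by (simp add: grid_def)
  moreover have "(!) xs ` {..length xs - 1} = S'"
  proof -
    have "{..length xs - 1} = {..<length xs}" using len by (cases xs) (auto simp: lessThan_Suc_atMost)
    then show ?thesis using set by (auto simp: set_conv_nth)
  qed
  ultimately show ?thesis unfolding S'_def by blast
qed

lemma sum_indicator_grid:
  assumes "grid T N s" "m \<le> N"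
  shows "(\<Sum>l<m. indicator {s l<..s (Suc l)} r) = (indicator {0<..s m} r :: 'b::semiring_1)" using assms(2)
proof (induction m)
  case 0
  then show ?case using assms(1) by (simp add: grid_def)
next
  case (Suc m)
  then have "0 \<le> s m" "s m < s (Suc m)"
    using grid_nonneg[OF assms(1), of m] grid_less[OF assms(1), of m "Suc m"] by auto
  then show ?case using Suc by (auto simp: indicator_def)
qed

text \<open>Because \<open>c\<close> is a node or lies beyond \<open>s m\<close>, it cuts no cell in
  two: each cell contributes its whole increment or nothing.\<close>

lemma telescope_grid:
  fixes f :: "real \<Rightarrow> 'v::ab_group_add"
  assumes "grid T N s" "m \<le> N" "0 \<le> c" "c \<in> s ` {..N} \<or> s m \<le> c"
  shows "f (min (s m) c) - f 0 = (\<Sum>l<m. if s l < c then f (s (Suc l)) - f (s l) else 0)" using assms(2,4)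
proof (induction m)
  case 0
  then show ?case using assms(1,3) by (simp add: grid_def)
next
  case (Suc m)
  have lt: "s m < s (Suc m)" using grid_less[OF assms(1), of m "Suc m"] Suc.prems by simp
  have IH: "f (min (s m) c) - f 0 = (\<Sum>l<m. if s l < c then f (s (Suc l)) - f (s l) else 0)"
    using Suc lt by auto
  have "s (Suc m) \<le> c" if "s m < c" using Suc.prems(2)
  proof
    assume "c \<in> s ` {..N}"
    then obtain j where j: "c = s j" "j \<le> N" by auto
    then have "m < j" using that grid_mono[OF assms(1), of j m] Suc.prems(1) by (cases "m < j") auto
    then show ?thesis using j grid_mono[OF assms(1), of "Suc m" j] by auto
  qed
  then have "f (min (s (Suc m)) c) - f (min (s m) c) = (if s m < c then f (s (Suc m)) - f (s m) else 0)"
    using lt by (auto simp: min_def)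
  then show ?case using IH by (simp add: algebra_simps)
qed

lemma norm_diff_square_le:
  fixes a b c :: "'v::real_normed_vector"
  shows "(norm (a - c))\<^sup>2 \<le> 2 * (norm (a - b))\<^sup>2 + 2 * (norm (b - c))\<^sup>2"
proof -
  have "norm (a - c) \<le> norm (a - b) + norm (b - c)" using norm_triangle_ineq[of "a - b" "b - c"] by simp
  then have "(norm (a - c))\<^sup>2 \<le> (norm (a - b) + norm (b - c))\<^sup>2" by (rule power_mono) simp
  also have "... \<le> 2 * (norm (a - b))\<^sup>2 + 2 * (norm (b - c))\<^sup>2"
    using zero_le_power2[of "norm (a - b) - norm (b - c)"] by (simp add: power2_eq_square algebra_simps)
  finally show ?thesis .
qed

section \<open>Mean-square limits and distances of processes\<close>

context prob_space
begin

text \<open>Fatou's lemma along a subsequence. Tolerances and failure probabilities of size 2^-k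
  make the convergence almost sure by Borel-Cantelli, and \<open>k \<le> J k\<close> lets the errors
  \<open>e (J k)\<close> vanish as well.\<close>

lemma nn_integral_square_le_of_tendsto_prob:
  fixes Y Z :: "'a \<Rightarrow> real"
  assumes [measurable]: "Y \<in> borel_measurable M" "Z \<in> borel_measurable M" "\<And>j. U j \<in> borel_measurable M"
    and conv: "\<And>\<epsilon>. 0 < \<epsilon> \<Longrightarrow> (\<lambda>j. prob {w\<in>space M. \<epsilon> < \<bar>U j w - Z w\<bar>}) \<longlonglongrightarrow> 0"
    and bd: "\<And>j. (\<integral>\<^sup>+w. ennreal ((Y w - U j w)\<^sup>2) \<partial>M) \<le> c + e j" and e: "e \<longlonglongrightarrow> 0"
  shows "(\<integral>\<^sup>+w. ennreal ((Y w - Z w)\<^sup>2) \<partial>M) \<le> c"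
proof -
  have "\<exists>j\<ge>k. prob {w\<in>space M. (1/2)^k < \<bar>U j w - Z w\<bar>} < (1/2)^k" for k :: nat
  proof -
    have "eventually (\<lambda>j. prob {w\<in>space M. (1/2)^k < \<bar>U j w - Z w\<bar>} < (1/2)^k) sequentially"
      by (rule order_tendstoD(2)[OF conv]) auto
    then obtain n where "\<And>j. n \<le> j \<Longrightarrow> prob {w\<in>space M. (1/2)^k < \<bar>U j w - Z w\<bar>} < (1/2)^k"
      unfolding eventually_sequentially by blast
    then show ?thesis by (intro exI[of _ "max k n"]) simp
  qed
  then obtain J where J: "\<And>k. k \<le> J k" "\<And>k. prob {w\<in>space M. (1/2)^k < \<bar>U (J k) w - Z w\<bar>} < (1/2)^k" by metis
  have "AE w in M. eventually (\<lambda>k. w \<in> space M - {w\<in>space M. (1/2)^k < \<bar>U (J k) w - Z w\<bar>}) sequentially"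
  proof (rule borel_cantelli_AE1)
    show "summable (\<lambda>k. prob {w\<in>space M. (1/2)^k < \<bar>U (J k) w - Z w\<bar>})"
      by (rule summable_comparison_test'[OF summable_geometric[of "1/2::real"], of 0])
        (use J(2) in \<open>auto intro: less_imp_le\<close>)
  qed (auto simp: less_top[symmetric])
  then have ae: "AE w in M. (\<lambda>k. U (J k) w) \<longlonglongrightarrow> Z w"
  proof (rule AE_mp, intro AE_I2 impI)
    fix w assume "w \<in> space M" and ev: "\<forall>\<^sub>F k in sequentially. w \<in> space M - {w\<in>space M. (1/2)^k < \<bar>U (J k) w - Z w\<bar>}"
    have "(\<lambda>k. U (J k) w - Z w) \<longlonglongrightarrow> 0"
    proof (rule Lim_null_comparison)
      show "\<forall>\<^sub>F k in sequentially. norm (U (J k) w - Z w) \<le> (1/2)^k"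
        using ev by eventually_elim (auto simp: not_less)
      show "(\<lambda>k. (1/2::real)^k) \<longlonglongrightarrow> 0" by (rule LIMSEQ_power_zero) simp
    qed
    then show "(\<lambda>k. U (J k) w) \<longlonglongrightarrow> Z w" by (simp add: LIM_zero_iff)
  qed
  have "(\<integral>\<^sup>+w. ennreal ((Y w - Z w)\<^sup>2) \<partial>M) = (\<integral>\<^sup>+w. liminf (\<lambda>k. ennreal ((Y w - U (J k) w)\<^sup>2)) \<partial>M)"
  proof (rule nn_integral_cong_AE)
    show "AE w in M. ennreal ((Y w - Z w)\<^sup>2) = liminf (\<lambda>k. ennreal ((Y w - U (J k) w)\<^sup>2))" using ae
    proof eventually_elim
      case (elim w)
      have "(\<lambda>k. ennreal ((Y w - U (J k) w)\<^sup>2)) \<longlonglongrightarrow> ennreal ((Y w - Z w)\<^sup>2)"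
        by (intro tendsto_ennrealI tendsto_intros elim)
      then show ?case by (rule lim_imp_Liminf[symmetric, rotated]) simp
    qed
  qed
  also have "... \<le> liminf (\<lambda>k. \<integral>\<^sup>+w. ennreal ((Y w - U (J k) w)\<^sup>2) \<partial>M)"
    by (rule nn_integral_liminf) measurable
  also have "... \<le> liminf (\<lambda>k. c + e (J k))" by (rule Liminf_mono) (simp add: bd)
  also have "... = c"
  proof -
    have "filterlim J sequentially sequentially"
      by (rule filterlim_at_top_mono[OF filterlim_ident]) (simp add: J(1))
    then have "(\<lambda>k. e (J k)) \<longlonglongrightarrow> 0" by (rule filterlim_compose[OF e])
    then have "(\<lambda>k. c + e (J k)) \<longlonglongrightarrow> c + 0" by (intro tendsto_add tendsto_const)
    then show ?thesis by (simp add: lim_imp_Liminf)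
  qed
  finally show ?thesis .
qed

text \<open>Progressive measurability at time \<open>T\<close> speaks only about
  \<open>{0..T}\<close>. Extension by zero gives a function on the whole product with
  \<open>lborel\<close>, where Tonelli applies.\<close>

definition on_time :: "real \<Rightarrow> (real \<Rightarrow> 'a \<Rightarrow> 'v::euclidean_space) \<Rightarrow> 'a \<times> real \<Rightarrow> 'v" where
  "on_time T f p = (if snd p \<in> {0..T} then f (snd p) (fst p) else 0)"

definition joint_measurable :: "real \<Rightarrow> (real \<Rightarrow> 'a \<Rightarrow> 'v::euclidean_space) \<Rightarrow> bool" where
  "joint_measurable T f \<longleftrightarrow> on_time T f \<in> borel_measurable (M \<Otimes>\<^sub>M lborel)"

definition dist2 :: "real \<Rightarrow> (real \<Rightarrow> 'a \<Rightarrow> 'v::euclidean_space) \<Rightarrow> (real \<Rightarrow> 'a \<Rightarrow> 'v) \<Rightarrow> ennreal" where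
  "dist2 T f g = (\<integral>\<^sup>+w. (\<integral>\<^sup>+r\<in>{0..T}. ennreal ((norm (f r w - g r w))\<^sup>2) \<partial>lborel) \<partial>M)"

definition sq_dist :: "real \<Rightarrow> (real \<Rightarrow> 'a \<Rightarrow> 'v::euclidean_space) \<Rightarrow> (real \<Rightarrow> 'a \<Rightarrow> 'v) \<Rightarrow> 'a \<times> real \<Rightarrow> ennreal" where
  "sq_dist T f g x = ennreal ((norm (on_time T f x - on_time T g x))\<^sup>2)"

lemma sq_dist_measurable:
  assumes "joint_measurable T f" "joint_measurable T g"
  shows "sq_dist T f g \<in> borel_measurable (M \<Otimes>\<^sub>M lborel)"
proof -
  have [measurable]: "on_time T f \<in> borel_measurable (M \<Otimes>\<^sub>M lborel)" "on_time T g \<in> borel_measurable (M \<Otimes>\<^sub>M lborel)"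
    using assms by (auto simp: joint_measurable_def)
  show ?thesis unfolding sq_dist_def by measurable
qed

lemma dist2_pair:
  assumes "joint_measurable T f" "joint_measurable T g"
  shows "dist2 T f g = (\<integral>\<^sup>+x. sq_dist T f g x \<partial>(M \<Otimes>\<^sub>M lborel))"
proof -
  have "(\<integral>\<^sup>+x. sq_dist T f g x \<partial>(M \<Otimes>\<^sub>M lborel)) = (\<integral>\<^sup>+w. \<integral>\<^sup>+r. sq_dist T f g (w, r) \<partial>lborel \<partial>M)"
    by (rule lborel.nn_integral_fst[symmetric]) (rule sq_dist_measurable[OF assms])
  also have "... = dist2 T f g"
    unfolding dist2_def sq_dist_def by (intro nn_integral_cong) (auto simp: indicator_def on_time_def)
  finally show ?thesis ..
qed

lemma dist2_triangle:
  assumes "joint_measurable T f" "joint_measurable T g" "joint_measurable T h"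
  shows "dist2 T f h \<le> 2 * dist2 T f g + 2 * dist2 T g h"
proof -
  note [measurable] = sq_dist_measurable[OF assms(1,2)] sq_dist_measurable[OF assms(2,3)]
  have "dist2 T f h \<le> (\<integral>\<^sup>+x. 2 * sq_dist T f g x + 2 * sq_dist T g h x \<partial>(M \<Otimes>\<^sub>M lborel))"
    unfolding dist2_pair[OF assms(1,3)]
  proof (rule nn_integral_mono)
    fix x
    let ?n = "\<lambda>f g. (norm (on_time T f x - on_time T g x))\<^sup>2"
    have "ennreal (?n f h) \<le> ennreal (2 * ?n f g + 2 * ?n g h)" by (intro ennreal_leI norm_diff_square_le)
    also have "... = 2 * ennreal (?n f g) + 2 * ennreal (?n g h)"
      by (simp only: ennreal_plus ennreal_mult' zero_le_numeral zero_le_power2 mult_nonneg_nonneg ennreal_numeral)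
    finally show "sq_dist T f h x \<le> 2 * sq_dist T f g x + 2 * sq_dist T g h x" unfolding sq_dist_def .
  qed
  also have "... = 2 * (\<integral>\<^sup>+x. sq_dist T f g x \<partial>(M \<Otimes>\<^sub>M lborel)) + 2 * (\<integral>\<^sup>+x. sq_dist T g h x \<partial>(M \<Otimes>\<^sub>M lborel))"
    by (subst nn_integral_add) (auto simp: nn_integral_cmult)
  finally show ?thesis unfolding dist2_pair[OF assms(1,2)] dist2_pair[OF assms(2,3)] .
qed

lemma dist2_commute: "dist2 T f g = dist2 T g f" unfolding dist2_def by (simp add: norm_minus_commute)

end

section \<open>Step processes on a common grid and their integrals\<close>

context brownian_setup
begin

lemma joint_measurable_progressive:
  assumes "progressive F f" "0 \<le> T"
  shows "joint_measurable T f"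
proof -
  let ?\<Omega> = "{p \<in> space (M \<Otimes>\<^sub>M lborel). snd p \<in> {0..T}}"
  have f: "(\<lambda>(r, w). f r w) \<in> measurable (restrict_space borel {0..T} \<Otimes>\<^sub>M F T) borel"
    using assms by (auto simp: progressive_def)
  have id: "(\<lambda>w. w) \<in> measurable M (F T)"
    using subalg[OF assms(2)] by (auto simp: subalgebra_def intro: measurable_from_subalg)
  have "(\<lambda>p. (snd p, fst p)) \<in> measurable (restrict_space (M \<Otimes>\<^sub>M lborel) ?\<Omega>) (restrict_space borel {0..T} \<Otimes>\<^sub>M F T)"
  proof (rule measurable_Pair)
    show "(\<lambda>p. snd p) \<in> measurable (restrict_space (M \<Otimes>\<^sub>M lborel) ?\<Omega>) (restrict_space borel {0..T})"
      by (rule measurable_restrict_space2) (auto simp: space_restrict_space intro!: measurable_restrict_space1)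
    show "(\<lambda>p. fst p) \<in> measurable (restrict_space (M \<Otimes>\<^sub>M lborel) ?\<Omega>) (F T)"
      using measurable_compose[OF measurable_fst id] by (auto intro!: measurable_restrict_space1)
  qed
  from measurable_compose[OF this f]
  have m: "(\<lambda>p. f (snd p) (fst p)) \<in> borel_measurable (restrict_space (M \<Otimes>\<^sub>M lborel) ?\<Omega>)" by simp
  have "?\<Omega> \<in> sets (M \<Otimes>\<^sub>M lborel)" by measurable
  then have "(\<lambda>p. if p \<in> ?\<Omega> then f (snd p) (fst p) else 0) \<in> borel_measurable (M \<Otimes>\<^sub>M lborel)"
    using m by (subst measurable_If_restrict_space_iff) auto
  then show ?thesis unfolding joint_measurable_def
    by (rule measurable_cong[THEN iffD1, rotated]) (auto simp: on_time_def)
qed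

definition adapted_simple :: "nat \<Rightarrow> (nat \<Rightarrow> real) \<Rightarrow> (nat \<Rightarrow> 'a \<Rightarrow> real^'d) \<Rightarrow> bool" where
  "adapted_simple n \<tau> \<xi> \<longleftrightarrow> \<tau> 0 = 0 \<and> (\<forall>k<n. \<tau> k \<le> \<tau> (Suc k)) \<and> (\<forall>k<n. \<xi> k \<in> borel_measurable (F (\<tau> k)))"

lemma adapted_simple_nonneg:
  assumes "adapted_simple n \<tau> \<xi>" "k \<le> n"
  shows "0 \<le> \<tau> k" using assms(2)
proof (induction k)
  case (Suc k)
  then have "\<tau> k \<le> \<tau> (Suc k)" using assms(1) by (simp add: adapted_simple_def)
  with Suc show ?case by simp
qed (use assms(1) in \<open>simp add: adapted_simple_def\<close>)

lemma joint_measurable_simple_proc: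
  assumes "adapted_simple n \<tau> \<xi>"
  shows "joint_measurable T (simple_proc n \<tau> \<xi>)"
proof -
  have [measurable]: "\<xi> k \<in> borel_measurable M" if "k \<in> {..<n}" for k
    using assms that by (intro measurable_F_M[OF _ adapted_simple_nonneg[OF assms]]) (auto simp: adapted_simple_def)
  show ?thesis unfolding joint_measurable_def simple_proc_def on_time_def by measurable
qed

lemma simple_int_measurable:
  assumes "adapted_simple n \<tau> \<xi>" "0 \<le> t"
  shows "simple_int W n \<tau> \<xi> t \<in> borel_measurable M"
proof -
  have [measurable]: "\<xi> k \<in> borel_measurable M" if "k \<in> {..<n}" for k
    using assms that by (intro measurable_F_M[OF _ adapted_simple_nonneg[OF assms(1)]]) (auto simp: adapted_simple_def)
  have [measurable]: "W (min t (\<tau> k)) \<in> borel_measurable M" if "k \<le> n" for k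
    using assms(2) adapted_simple_nonneg[OF assms(1) that] by (intro W_measurable) auto
  have [measurable]: "W (min t (\<tau> k)) \<in> borel_measurable M" "W (min t (\<tau> (Suc k))) \<in> borel_measurable M" if "k \<in> {..<n}" for k
    using that by auto
  show ?thesis unfolding simple_int_def by measurable
qed

text \<open>The value of the step process on the cell that begins at \<open>s l\<close>. The closed
  and open ends are swapped compared with \<open>simple_proc\<close> because the process is read
  just to the right of \<open>s l\<close>.\<close>

definition refine :: "nat \<Rightarrow> (nat \<Rightarrow> real) \<Rightarrow> (nat \<Rightarrow> 'a \<Rightarrow> real^'d) \<Rightarrow> (nat \<Rightarrow> real) \<Rightarrow> nat \<Rightarrow> 'a \<Rightarrow> real^'d" where
  "refine n \<tau> \<xi> s l w = (\<Sum>k<n. if \<tau> k \<le> s l \<and> s l < \<tau> (Suc k) then \<xi> k w else 0)"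

lemma refine_measurable:
  assumes "adapted_simple n \<tau> \<xi>" "grid T N s" "l \<le> N"
  shows "refine n \<tau> \<xi> s l \<in> borel_measurable (F (s l))" unfolding refine_def
proof (rule borel_measurable_sum)
  fix k assume "k \<in> {..<n}"
  then have k: "k < n" by simp
  show "(\<lambda>w. if \<tau> k \<le> s l \<and> s l < \<tau> (Suc k) then \<xi> k w else 0) \<in> borel_measurable (F (s l))"
  proof (cases "\<tau> k \<le> s l \<and> s l < \<tau> (Suc k)")
    case True
    have "\<xi> k \<in> borel_measurable (F (s l))" by (rule measurable_F_mono[of _ "\<tau> k"])
        (use True assms k adapted_simple_nonneg[OF assms(1), of k] in \<open>auto simp: adapted_simple_def\<close>)
    then show ?thesis using True by simp
  next
    case False
    show ?thesis by (simp only: False if_False borel_measurable_const)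
  qed
qed

text \<open>Telescoping splits each increment of \<open>W\<close> between consecutive
  \<open>\<tau> k\<close> into whole cells; exchanging the two sums then collects the coefficients
  cell by cell.\<close>

lemma simple_int_refine:
  assumes simp: "adapted_simple n \<tau> \<xi>" and part: "grid T N s"
    and sub: "\<And>k. k \<le> n \<Longrightarrow> \<tau> k \<in> s ` {..N} \<or> T \<le> \<tau> k"
  shows "simple_int W n \<tau> \<xi> T w = dint s (refine n \<tau> \<xi> s) N w"
proof -
  let ?D = "\<lambda>l. incr s l w"
  have T: "s N = T" using part by (simp add: grid_def)
  have tel: "W (min T (\<tau> k)) w - W 0 w = (\<Sum>l<N. if s l < \<tau> k then ?D l else 0)" if "k \<le> n" for k
    unfolding incr_def using telescope_grid[OF part le_refl adapted_simple_nonneg[OF simp that], of "\<lambda>t. W t w"] sub[OF that] T by auto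
  have "W (min T (\<tau> (Suc k))) w - W (min T (\<tau> k)) w = (\<Sum>l<N. if \<tau> k \<le> s l \<and> s l < \<tau> (Suc k) then ?D l else 0)"
    if k: "k < n" for k
  proof -
    have le: "\<tau> k \<le> \<tau> (Suc k)" using simp k by (simp add: adapted_simple_def)
    have "W (min T (\<tau> (Suc k))) w - W (min T (\<tau> k)) w
        = (W (min T (\<tau> (Suc k))) w - W 0 w) - (W (min T (\<tau> k)) w - W 0 w)" by simp
    also have "... = (\<Sum>l<N. (if s l < \<tau> (Suc k) then ?D l else 0) - (if s l < \<tau> k then ?D l else 0))"
      unfolding tel[OF Suc_leI[OF k]] tel[OF less_imp_le[OF k]] by (simp only: sum_subtractf)
    also have "... = (\<Sum>l<N. if \<tau> k \<le> s l \<and> s l < \<tau> (Suc k) then ?D l else 0)"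
      using le by (intro sum.cong) auto
    finally show ?thesis .
  qed
  then have "simple_int W n \<tau> \<xi> T w = (\<Sum>k<n. \<xi> k w \<bullet> (\<Sum>l<N. if \<tau> k \<le> s l \<and> s l < \<tau> (Suc k) then ?D l else 0))"
    unfolding simple_int_def by (intro sum.cong) auto
  also have "... = (\<Sum>k<n. \<Sum>l<N. (if \<tau> k \<le> s l \<and> s l < \<tau> (Suc k) then \<xi> k w else 0) \<bullet> ?D l)"
    unfolding inner_sum_right by (intro sum.cong) auto
  also have "... = (\<Sum>l<N. \<Sum>k<n. (if \<tau> k \<le> s l \<and> s l < \<tau> (Suc k) then \<xi> k w else 0) \<bullet> ?D l)" by (rule sum.swap)
  also have "... = dint s (refine n \<tau> \<xi> s) N w" unfolding dint_def refine_def inner_sum_left ..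
  finally show ?thesis .
qed

lemma simple_proc_refine:
  assumes part: "grid T N s" and sub: "\<And>k. k \<le> n \<Longrightarrow> \<tau> k \<in> s ` {..N} \<or> T \<le> \<tau> k"
    and l: "l < N" "s l < r" "r \<le> s (Suc l)"
  shows "simple_proc n \<tau> \<xi> r w = refine n \<tau> \<xi> s l w"
proof -
  have key: "\<tau> k < r \<longleftrightarrow> \<tau> k \<le> s l" if "k \<le> n" for k using sub[OF that]
  proof
    assume "T \<le> \<tau> k"
    moreover have "s (Suc l) \<le> T" using grid_le[OF part] l(1) by auto
    ultimately show ?thesis using l by linarith
  next
    assume "\<tau> k \<in> s ` {..N}"
    then obtain j where j: "\<tau> k = s j" "j \<le> N" by auto
    show ?thesis
    proof (cases "j \<le> l")
      case True
      then have "s j \<le> s l" using grid_mono[OF part] l by auto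
      then show ?thesis using j l by auto
    next
      case False
      then have "s (Suc l) \<le> s j" using grid_mono[OF part, of "Suc l" j] j by auto
      then show ?thesis using j l by auto
    qed
  qed
  have "\<tau> k < r \<and> r \<le> \<tau> (Suc k) \<longleftrightarrow> \<tau> k \<le> s l \<and> s l < \<tau> (Suc k)" if "k < n" for k
    using key[of k] key[of "Suc k"] that by auto
  then show ?thesis unfolding simple_proc_def refine_def by (intro sum.cong) auto
qed

text \<open>Freezing the past before the last increment removes the mixed term, since a centred
  Gaussian has no first moment. Stated as an inequality between nonnegative integrals, the induction
  never has to discuss integrability of that mixed term.\<close>

lemma dint_isometry_le:
  assumes part: "grid T N s" and G: "\<And>l. l < N \<Longrightarrow> G l \<in> borel_measurable (F (s l))" and "m \<le> N"
  shows "(\<integral>\<^sup>+w. ennreal ((dint s G m w)\<^sup>2) \<partial>M) \<le> (\<Sum>l<m. \<integral>\<^sup>+w. ennreal (s (Suc l) - s l) * ennreal ((norm (G l w))\<^sup>2) \<partial>M)"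
  using assms(3)
proof (induction m)
  case 0
  then show ?case by (simp add: dint_def)
next
  case (Suc m)
  have sm: "0 \<le> s m" "s m < s (Suc m)" using Suc.prems grid_nonneg[OF part, of m] grid_less[OF part, of m "Suc m"] by auto
  let ?dt = "s (Suc m) - s m"
  have mF [measurable]: "G m \<in> borel_measurable (F (s m))" "dint s G m \<in> borel_measurable (F (s m))"
    using dint_measurable[OF part, of m G] G Suc.prems by auto
  have gM [measurable]: "G m \<in> borel_measurable M" "dint s G m \<in> borel_measurable M"
    by (rule measurable_F_M[OF mF(1) sm(1)], rule measurable_F_M[OF mF(2) sm(1)])
  define \<phi> where "\<phi> = (\<lambda>(w, z). ennreal ((dint s G m w + G m w \<bullet> z)\<^sup>2))"
  have \<phi>: "\<phi> \<in> borel_measurable (F (s m) \<Otimes>\<^sub>M borel)" unfolding \<phi>_def by measurable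
  have "(\<integral>\<^sup>+w. ennreal ((dint s G (Suc m) w)\<^sup>2) \<partial>M) = (\<integral>\<^sup>+w. \<phi> (w, W (s (Suc m)) w - W (s m) w) \<partial>M)"
    by (simp add: \<phi>_def dint_def incr_def)
  also have "... = (\<integral>\<^sup>+w. \<integral>\<^sup>+z. \<phi> (w, z) \<partial>gauss_vec ?dt \<partial>M)" by (rule nn_integral_freeze[OF sm \<phi>])
  also have "... \<le> (\<integral>\<^sup>+w. ennreal ((dint s G m w)\<^sup>2) + ennreal ?dt * ennreal ((norm (G m w))\<^sup>2) \<partial>M)"
  proof (rule nn_integral_mono)
    fix w
    have "(\<integral>\<^sup>+z. \<phi> (w, z) \<partial>gauss_vec ?dt) \<le> ennreal ((dint s G m w)\<^sup>2 + ?dt * (norm (G m w))\<^sup>2)"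
      unfolding \<phi>_def prod.case by (rule nn_integral_square_gauss_le) (use sm in simp)
    also have "... = ennreal ((dint s G m w)\<^sup>2) + ennreal ?dt * ennreal ((norm (G m w))\<^sup>2)"
      using sm by (subst ennreal_plus) (auto simp: ennreal_mult')
    finally show "(\<integral>\<^sup>+z. \<phi> (w, z) \<partial>gauss_vec ?dt) \<le> ..." .
  qed
  also have "... = (\<integral>\<^sup>+w. ennreal ((dint s G m w)\<^sup>2) \<partial>M) + (\<integral>\<^sup>+w. ennreal ?dt * ennreal ((norm (G m w))\<^sup>2) \<partial>M)"
    by (rule nn_integral_add) measurable
  also have "... \<le> (\<Sum>l<Suc m. \<integral>\<^sup>+w. ennreal (s (Suc l) - s l) * ennreal ((norm (G l w))\<^sup>2) \<partial>M)"
    using Suc by (simp add: add_right_mono)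
  finally show ?case .
qed

text \<open>On a common refinement of the two partitions the difference is a single discrete
  integral, to which the isometry bound applies. Time 0 is separate because a grid needs positive
  length.\<close>

lemma simple_int_diff_le:
  assumes a: "adapted_simple n \<tau> \<xi>" and a': "adapted_simple n' \<tau>' \<xi>'" and t: "0 \<le> t" "t \<le> T"
  shows "(\<integral>\<^sup>+w. ennreal ((simple_int W n \<tau> \<xi> t w - simple_int W n' \<tau>' \<xi>' t w)\<^sup>2) \<partial>M)
    \<le> dist2 T (simple_proc n \<tau> \<xi>) (simple_proc n' \<tau>' \<xi>')"
proof (cases "t = 0")
  case True
  have "simple_int W n \<tau> \<xi> t w = 0" if "adapted_simple n \<tau> \<xi>" for n \<tau> \<xi> w
    using True adapted_simple_nonneg[OF that] by (auto simp: simple_int_def intro!: sum.neutral)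
  then show ?thesis using a a' by simp
next
  case False
  then have "0 < t" using t by simp
  moreover have "finite ((\<tau> ` {..n} \<union> \<tau>' ` {..n'}) \<inter> {0..t})" by simp
  ultimately obtain N s where part: "grid t N s" and s: "s ` {..N} = insert 0 (insert t ((\<tau> ` {..n} \<union> \<tau>' ` {..n'}) \<inter> {0..t}))"
    using ex_grid[of "(\<tau> ` {..n} \<union> \<tau>' ` {..n'}) \<inter> {0..t}" t] by blast
  have sub: "\<tau> k \<in> s ` {..N} \<or> t \<le> \<tau> k" if "k \<le> n" for k
    unfolding s using adapted_simple_nonneg[OF a that] that by auto
  have sub': "\<tau>' k \<in> s ` {..N} \<or> t \<le> \<tau>' k" if "k \<le> n'" for k
    unfolding s using adapted_simple_nonneg[OF a' that] that by auto
  define G where "G l w = refine n \<tau> \<xi> s l w - refine n' \<tau>' \<xi>' s l w" for l w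
  have Gm: "G l \<in> borel_measurable (F (s l))" if "l < N" for l
    unfolding G_def[abs_def] using refine_measurable[OF a part, of l] refine_measurable[OF a' part, of l] that by auto
  have GM: "G l \<in> borel_measurable M" if "l < N" for l
    using measurable_F_M[OF Gm[OF that]] grid_nonneg[OF part, of l] that by auto
  have pos: "s l < s (Suc l)" if "l < N" for l using part that by (simp add: grid_def)
  have "(\<integral>\<^sup>+w. ennreal ((simple_int W n \<tau> \<xi> t w - simple_int W n' \<tau>' \<xi>' t w)\<^sup>2) \<partial>M) = (\<integral>\<^sup>+w. ennreal ((dint s G N w)\<^sup>2) \<partial>M)"
  proof -
    have "simple_int W n \<tau> \<xi> t w = dint s (refine n \<tau> \<xi> s) N w" for w
      by (rule simple_int_refine[OF a part sub])
    moreover have "simple_int W n' \<tau>' \<xi>' t w = dint s (refine n' \<tau>' \<xi>' s) N w" for w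
      by (rule simple_int_refine[OF a' part sub'])
    ultimately show ?thesis by (simp add: dint_def G_def inner_diff_left sum_subtractf)
  qed
  also have "... \<le> (\<Sum>l<N. \<integral>\<^sup>+w. ennreal (s (Suc l) - s l) * ennreal ((norm (G l w))\<^sup>2) \<partial>M)"
    by (rule dint_isometry_le[OF part Gm le_refl])
  also have "... = (\<integral>\<^sup>+w. (\<Sum>l<N. ennreal (s (Suc l) - s l) * ennreal ((norm (G l w))\<^sup>2)) \<partial>M)"
    by (rule nn_integral_sum[symmetric]) (use GM in auto)
  also have "... \<le> dist2 T (simple_proc n \<tau> \<xi>) (simple_proc n' \<tau>' \<xi>')" unfolding dist2_def
  proof (rule nn_integral_mono)
    fix w
    let ?f = "\<lambda>r. ennreal ((norm (simple_proc n \<tau> \<xi> r w - simple_proc n' \<tau>' \<xi>' r w))\<^sup>2)"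
    have "(\<Sum>l<N. ennreal (s (Suc l) - s l) * ennreal ((norm (G l w))\<^sup>2)) = (\<Sum>l<N. \<integral>\<^sup>+r. ennreal ((norm (G l w))\<^sup>2) * indicator {s l<..s (Suc l)} r \<partial>lborel)"
      by (intro sum.cong refl, subst nn_integral_cmult_indicator) (auto simp: mult.commute dest: pos)
    also have "... = (\<integral>\<^sup>+r. (\<Sum>l<N. ennreal ((norm (G l w))\<^sup>2) * indicator {s l<..s (Suc l)} r) \<partial>lborel)"
      by (rule nn_integral_sum[symmetric]) measurable
    also have "... \<le> (\<integral>\<^sup>+r\<in>{0..T}. ?f r \<partial>lborel)"
    proof (rule nn_integral_mono)
      fix r
      have "(\<Sum>l<N. ennreal ((norm (G l w))\<^sup>2) * indicator {s l<..s (Suc l)} r) = (\<Sum>l<N. ?f r * indicator {s l<..s (Suc l)} r)"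
        by (intro sum.cong refl) (auto simp: indicator_def G_def simple_proc_refine[OF part sub] simple_proc_refine[OF part sub'])
      also have "... = ?f r * indicator {0<..s N} r"
        unfolding sum_distrib_left[symmetric] sum_indicator_grid[OF part le_refl] ..
      also have "... \<le> ?f r * indicator {0..T} r"
        using t part by (intro mult_left_mono) (auto simp: indicator_def grid_def)
      finally show "(\<Sum>l<N. ennreal ((norm (G l w))\<^sup>2) * indicator {s l<..s (Suc l)} r) \<le> ?f r * indicator {0..T} r" .
    qed
    finally show "(\<Sum>l<N. ennreal (s (Suc l) - s l) * ennreal ((norm (G l w))\<^sup>2)) \<le> (\<integral>\<^sup>+r\<in>{0..T}. ?f r \<partial>lborel)" .
  qed
  finally show ?thesis .
qed

lemma ito_integral_approximation:
  assumes ito: "ito_integral M F W H I" and T: "0 < T"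
  obtains n \<tau> \<xi> where "\<forall>j. adapted_simple (n j) (\<tau> j) (\<xi> j)"
    "(\<lambda>j. dist2 T (simple_proc (n j) (\<tau> j) (\<xi> j)) H) \<longlonglongrightarrow> 0"
    "\<forall>t\<in>{0..T}. \<forall>\<epsilon>>0.
      (\<lambda>j. prob {w\<in>space M. \<epsilon> < \<bar>simple_int W (n j) (\<tau> j) (\<xi> j) t w - I t w\<bar>}) \<longlonglongrightarrow> 0"
proof -
  from ito[unfolded ito_integral_def, THEN conjunct2, THEN conjunct2, THEN conjunct2, rule_format, OF T]
  obtain n \<tau> \<xi> where sp: "\<And>j. simple_pred M F (n j) (\<tau> j) (\<xi> j)"
    and l2: "(\<lambda>j. dist2 T (simple_proc (n j) (\<tau> j) (\<xi> j)) H) \<longlonglongrightarrow> 0"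
    and pr: "\<forall>t\<in>{0..T}. \<forall>\<epsilon>>0.
      (\<lambda>j. prob {w\<in>space M. \<epsilon> < \<bar>simple_int W (n j) (\<tau> j) (\<xi> j) t w - I t w\<bar>}) \<longlonglongrightarrow> 0"
    unfolding dist2_def by blast
  have "\<forall>j. adapted_simple (n j) (\<tau> j) (\<xi> j)" using sp by (simp add: simple_pred_def adapted_simple_def)
  then show ?thesis using l2 pr by (rule that)
qed

text \<open>The defining sequence of \<open>I\<close> serves only as an intermediary: any step
  process close to \<open>H\<close> has its integral close to \<open>I\<close>. This frees the later
  construction to choose its own grids and to modify the coefficients. The factor 2 is the price of
  the triangle inequality for squares.\<close>

lemma simple_int_ito_diff_le:
  assumes ito: "ito_integral M F W H I" and a: "adapted_simple n \<tau> \<xi>" and t: "0 \<le> t" "t \<le> T" "0 < T"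
  shows "(\<integral>\<^sup>+w. ennreal ((simple_int W n \<tau> \<xi> t w - I t w)\<^sup>2) \<partial>M) \<le> 2 * dist2 T (simple_proc n \<tau> \<xi>) H"
proof -
  obtain n' \<tau>' \<xi>' where a': "\<forall>j. adapted_simple (n' j) (\<tau>' j) (\<xi>' j)"
    and l2: "(\<lambda>j. dist2 T (simple_proc (n' j) (\<tau>' j) (\<xi>' j)) H) \<longlonglongrightarrow> 0"
    and pr: "\<forall>t\<in>{0..T}. \<forall>\<epsilon>>0.
      (\<lambda>j. prob {w\<in>space M. \<epsilon> < \<bar>simple_int W (n' j) (\<tau>' j) (\<xi>' j) t w - I t w\<bar>}) \<longlonglongrightarrow> 0"
    by (rule ito_integral_approximation[OF ito t(3)])
  note a' = a'[rule_format]
  let ?p = "\<lambda>j. simple_proc (n' j) (\<tau>' j) (\<xi>' j)" and ?i = "\<lambda>j. simple_int W (n' j) (\<tau>' j) (\<xi>' j)"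
  have Im: "I t \<in> borel_measurable M"
    using ito t(1) by (intro measurable_F_M[of _ t]) (auto simp: ito_integral_def)
  have Hm: "joint_measurable T H"
    using ito t(3) by (intro joint_measurable_progressive) (auto simp: ito_integral_def)
  show ?thesis
  proof (rule nn_integral_square_le_of_tendsto_prob[where U = "\<lambda>j. ?i j t"
        and e = "\<lambda>j. 2 * dist2 T (?p j) H"])
    fix j
    have "(\<integral>\<^sup>+w. ennreal ((simple_int W n \<tau> \<xi> t w - ?i j t w)\<^sup>2) \<partial>M)
      \<le> dist2 T (simple_proc n \<tau> \<xi>) (?p j)" by (rule simple_int_diff_le[OF a a' t(1,2)])
    also have "... \<le> 2 * dist2 T (simple_proc n \<tau> \<xi>) H + 2 * dist2 T H (?p j)"
      by (rule dist2_triangle[OF joint_measurable_simple_proc[OF a] Hm joint_measurable_simple_proc[OF a']])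
    finally show "(\<integral>\<^sup>+w. ennreal ((simple_int W n \<tau> \<xi> t w - ?i j t w)\<^sup>2) \<partial>M)
      \<le> 2 * dist2 T (simple_proc n \<tau> \<xi>) H + 2 * dist2 T (?p j) H" by (simp add: dist2_commute)
  next
    show "(\<lambda>j. prob {w\<in>space M. \<epsilon> < \<bar>?i j t w - I t w\<bar>}) \<longlonglongrightarrow> 0" if "0 < \<epsilon>" for \<epsilon> using pr that t by simp
    show "(\<lambda>j. 2 * dist2 T (?p j) H) \<longlonglongrightarrow> 0" using ennreal_tendsto_cmult[OF _ l2, of 2] by simp
  qed (use simple_int_measurable a a' t Im in auto)
qed

end

section \<open>Approximation of double integrals\<close>

lemma grid_Suc_le:
  assumes "grid T N s" "x \<in> s ` {..N}" "l < N" "s l < x"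
  shows "s (Suc l) \<le> x"
proof -
  obtain j where j: "x = s j" "j \<le> N" using assms(2) by auto
  then have "l < j" using grid_mono[OF assms(1), of j l] assms(3,4) by (cases "l < j") auto
  then show ?thesis using grid_mono[OF assms(1), of "Suc l" j] j by simp
qed

lemma grid_cell:
  assumes "grid T N s" "0 < r" "r \<le> T"
  obtains l where "l < N" "s l < r" "r \<le> s (Suc l)"
proof -
  have "\<exists>l<m. s l < r \<and> r \<le> s (Suc l)" if "m \<le> N" "r \<le> s m" for m using that
  proof (induction m)
    case 0
    then show ?case using assms by (simp add: grid_def)
  next
    case (Suc m)
    show ?case
    proof (cases "r \<le> s m")
      case True
      then show ?thesis using Suc by (meson Suc_leD less_SucI)
    next
      case False
      then show ?thesis using Suc.prems by (intro exI[of _ m]) auto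
    qed
  qed
  then show ?thesis using that assms by (auto simp: grid_def)
qed

text \<open>The multiples of \<open>T / q\<close> are added to \<open>S\<close>. No cell jumps over
  one of them, so none is longer than \<open>T / q\<close>.\<close>

lemma ex_grid_mesh:
  assumes "finite S" "S \<subseteq> {0..T}" "0 < T" "0 < \<eta>"
  obtains N s where "grid T N s" "S \<subseteq> s ` {..N}" "\<forall>l<N. s (Suc l) - s l \<le> \<eta>"
proof -
  obtain q :: nat where q: "T / \<eta> < real q" using reals_Archimedean2 by blast
  have q0: "0 < real q" using q assms(3,4) by (meson divide_pos_pos less_trans)
  have Tq: "T / real q \<le> \<eta>" using q q0 assms(3,4) by (simp add: field_simps)
  define G where "G = (\<lambda>k. real k * T / real q) ` {..q}"
  have "finite (S \<union> G)" "S \<union> G \<subseteq> {0..T}" using assms q0 by (auto simp: G_def field_simps)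
  then obtain N s where p: "grid T N s" and s: "s ` {..N} = insert 0 (insert T (S \<union> G))"
    using ex_grid assms(3) by meson
  have "s (Suc l) - s l \<le> \<eta>" if l: "l < N" for l
  proof -
    have sl: "0 \<le> s l" "s l < T" using grid_nonneg[OF p, of l] grid_less[OF p l le_refl] l p
      by (auto simp: grid_def)
    define k where "k = nat \<lfloor>s l * real q / T\<rfloor>"
    have nn: "0 \<le> s l * real q / T" using sl assms(3) by simp
    have k1: "real k \<le> s l * real q / T" "s l * real q / T < real k + 1"
    proof -
      have "real k = of_int \<lfloor>s l * real q / T\<rfloor>" using nn by (simp add: k_def)
      then show "real k \<le> s l * real q / T" "s l * real q / T < real k + 1"
        using floor_correct[of "s l * real q / T"] by simp_all
    qed
    have "s l * real q / T < real q" using sl q0 assms(3) by (simp add: field_simps)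
    then have "Suc k \<le> q" using k1(1) by linarith
    then have "real (Suc k) * T / real q \<in> s ` {..N}" unfolding s G_def by blast
    moreover have "s l < real (Suc k) * T / real q" using k1(2) q0 assms(3) by (simp add: field_simps)
    ultimately have "s (Suc l) \<le> real (Suc k) * T / real q" by (rule grid_Suc_le[OF p _ l])
    also have "... = real k * T / real q + T / real q" by (simp add: add_divide_distrib distrib_right)
    also have "... \<le> s l + T / real q" using k1(1) q0 assms(3) by (simp add: field_simps)
    finally show ?thesis using Tq by linarith
  qed
  moreover have "S \<subseteq> s ` {..N}" unfolding s by auto
  ultimately show ?thesis using that[OF p] by simp
qed

lemma borel_measurable_vec_lambda:
  fixes f :: "'n::finite \<Rightarrow> 'b \<Rightarrow> 'v::euclidean_space"
  assumes "\<And>i. f i \<in> borel_measurable N"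
  shows "(\<lambda>x. \<chi> i. f i x) \<in> borel_measurable N"
proof (subst borel_measurable_euclidean_space, intro ballI)
  fix e :: "'v^'n" assume "e \<in> Basis"
  then obtain i u where e: "e = axis i u" by (auto simp: Basis_vec_def)
  have "(\<lambda>x. (\<chi> i. f i x) \<bullet> e) = (\<lambda>x. f i x \<bullet> u)" unfolding e by (simp add: inner_axis)
  then show "(\<lambda>x. (\<chi> i. f i x) \<bullet> e) \<in> borel_measurable N" using assms[of i] by simp
qed

lemma borel_measurable_vec_nth [measurable (raw)]:
  fixes f :: "'b \<Rightarrow> 'v::euclidean_space^'n"
  assumes "f \<in> borel_measurable N"
  shows "(\<lambda>x. f x $ i) \<in> borel_measurable N"
  by (rule borel_measurable_continuous_on[OF linear_continuous_on[OF bounded_linear_vec_nth] assms])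

lemma power2_norm_vec: "(norm (x :: 'v::real_normed_vector^'n))\<^sup>2 = (\<Sum>i\<in>UNIV. (norm (x $ i))\<^sup>2)"
  unfolding norm_vec_def L2_set_def by (simp add: sum_nonneg)

text \<open>Quantifying over vectors exhibits the ball as an intersection of closed convex sets,
  which is what the projection needs; membership for centre 0 and radius 1 is the contraction
  hypothesis of the maximal inequality.\<close>

definition op_ball :: "real^'d^'d \<Rightarrow> real \<Rightarrow> (real^'d^'d) set" where
  "op_ball A \<rho> = {B. \<forall>y. norm ((B - A) *v y) \<le> \<rho> * norm y}"

lemma closed_op_ball: "closed (op_ball A \<rho>)"
proof -
  have "op_ball A \<rho> = (\<Inter>y. {B. norm ((B - A) *v y) \<le> \<rho> * norm y})" by (auto simp: op_ball_def)
  moreover have "closed {B. norm ((B - A) *v y) \<le> \<rho> * norm y}" for y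
    unfolding matrix_vector_mult_def by (intro closed_Collect_le continuous_intros)
  ultimately show ?thesis by auto
qed

lemma convex_op_ball:
  fixes A :: "real^'d^'d"
  shows "convex (op_ball A \<rho>)"
proof (rule convexI)
  fix B C :: "real^'d^'d" and u v :: real
  assume B: "B \<in> op_ball A \<rho>" and C: "C \<in> op_ball A \<rho>" and uv: "0 \<le> u" "0 \<le> v" "u + v = 1"
  have "norm ((u *\<^sub>R B + v *\<^sub>R C - A) *v y) \<le> \<rho> * norm y" for y
  proof -
    have "u *\<^sub>R B + v *\<^sub>R C - A = u *\<^sub>R (B - A) + v *\<^sub>R (C - A)"
      using uv(3) by (simp add: algebra_simps flip: scaleR_left_distrib)
    then have "(u *\<^sub>R B + v *\<^sub>R C - A) *v y = u *\<^sub>R ((B - A) *v y) + v *\<^sub>R ((C - A) *v y)"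
      by (simp only: matrix_vector_mult_add_rdistrib scaleR_matrix_vector_assoc)
    then have "norm ((u *\<^sub>R B + v *\<^sub>R C - A) *v y) \<le> u * norm ((B - A) *v y) + v * norm ((C - A) *v y)"
      using norm_triangle_ineq[of "u *\<^sub>R ((B - A) *v y)" "v *\<^sub>R ((C - A) *v y)"] uv by simp
    also have "... \<le> u * (\<rho> * norm y) + v * (\<rho> * norm y)"
      using B C uv by (intro add_mono mult_left_mono) (auto simp: op_ball_def)
    also have "... = \<rho> * norm y" using uv(3) by (simp flip: distrib_right)
    finally show ?thesis .
  qed
  then show "u *\<^sub>R B + v *\<^sub>R C \<in> op_ball A \<rho>" by (simp add: op_ball_def)
qed

text \<open>A crude entrywise estimate: it only has to be uniform over the ball, since it gets
  multiplied by a mesh that may be chosen small.\<close>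

lemma op_ball_row_bound:
  fixes B :: "real^'d^'d"
  assumes "B \<in> op_ball A \<rho>" "0 \<le> \<rho>"
  shows "(norm (B $ i))\<^sup>2 \<le> (norm A + real CARD('d) * \<rho>)\<^sup>2"
proof (rule power_mono)
  have e: "\<bar>(B - A) $ i $ j\<bar> \<le> \<rho>" for j
  proof -
    have "(B - A) $ i $ j = ((B - A) *v axis j 1) $ i" by (simp add: matrix_vector_mult_basis column_def)
    also have "\<bar>...\<bar> \<le> norm ((B - A) *v axis j 1)" by (rule component_le_norm_cart)
    also have "... \<le> \<rho>" using assms(1)[unfolded op_ball_def, simplified, rule_format, of "axis j 1"] by simp
    finally show ?thesis .
  qed
  have "norm (B $ i) \<le> norm (A $ i) + norm ((B - A) $ i)"
    using norm_triangle_ineq[of "A $ i" "(B - A) $ i"] by simp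
  also have "norm ((B - A) $ i) \<le> (\<Sum>j\<in>UNIV. \<bar>(B - A) $ i $ j\<bar>)" by (rule norm_le_l1_cart)
  also have "... \<le> (\<Sum>j\<in>(UNIV::'d set). \<rho>)" by (intro sum_mono e)
  also have "norm (A $ i) \<le> norm A" by (rule Finite_Cartesian_Product.norm_nth_le)
  finally show "norm (B $ i) \<le> norm A + real CARD('d) * \<rho>" by simp
qed simp

context prob_space
begin

lemma dist2_le_sum:
  assumes "joint_measurable T f" "joint_measurable T g"
    and "\<And>i. i \<in> I \<Longrightarrow> joint_measurable T (p i)" "\<And>i. i \<in> I \<Longrightarrow> joint_measurable T (q i)"
    and le: "\<And>r w. r \<in> {0..T} \<Longrightarrow> w \<in> space M \<Longrightarrow>
      (norm (f r w - g r w))\<^sup>2 \<le> (\<Sum>i\<in>I. (norm (p i r w - q i r w))\<^sup>2)"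
  shows "dist2 T f g \<le> (\<Sum>i\<in>I. dist2 T (p i) (q i))"
proof -
  have "dist2 T f g \<le> (\<integral>\<^sup>+x. (\<Sum>i\<in>I. sq_dist T (p i) (q i) x) \<partial>(M \<Otimes>\<^sub>M lborel))"
    unfolding dist2_pair[OF assms(1,2)]
  proof (rule nn_integral_mono)
    fix x assume "x \<in> space (M \<Otimes>\<^sub>M (lborel :: real measure))"
    then have "fst x \<in> space M" by (auto simp: space_pair_measure)
    then have "(norm (on_time T f x - on_time T g x))\<^sup>2 \<le> (\<Sum>i\<in>I. (norm (on_time T (p i) x - on_time T (q i) x))\<^sup>2)"
      using le[of "snd x" "fst x"] by (auto simp: on_time_def)
    then show "sq_dist T f g x \<le> (\<Sum>i\<in>I. sq_dist T (p i) (q i) x)"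
      unfolding sq_dist_def by (subst sum_ennreal) (auto intro: ennreal_leI)
  qed
  also have "... = (\<Sum>i\<in>I. \<integral>\<^sup>+x. sq_dist T (p i) (q i) x \<partial>(M \<Otimes>\<^sub>M lborel))"
    by (rule nn_integral_sum) (rule sq_dist_measurable[OF assms(3,4)])
  also have "... = (\<Sum>i\<in>I. dist2 T (p i) (q i))"
    using assms(3,4) by (intro sum.cong refl dist2_pair[symmetric]) auto
  finally show ?thesis .
qed

lemma dist2_mono_time: "t \<le> T \<Longrightarrow> dist2 t f g \<le> dist2 T f g"
  unfolding dist2_def by (intro nn_integral_mono mult_left_mono) (auto simp: indicator_def)

text \<open>Tonelli with time as the outer variable. Time 0, which lies in no cell of a grid, is a
  null set and may be left out of the hypothesis.\<close>

lemma dist2_le_sections: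
  assumes "joint_measurable T f" "joint_measurable T g" "0 \<le> T"
    and le: "\<And>r. 0 < r \<Longrightarrow> r \<le> T \<Longrightarrow> (\<integral>\<^sup>+w. ennreal ((norm (f r w - g r w))\<^sup>2) \<partial>M) \<le> c"
  shows "dist2 T f g \<le> c * ennreal T"
proof -
  interpret P: pair_sigma_finite M lborel ..
  have "dist2 T f g = (\<integral>\<^sup>+r. \<integral>\<^sup>+w. sq_dist T f g (w, r) \<partial>M \<partial>lborel)"
    unfolding dist2_pair[OF assms(1,2)] by (rule P.nn_integral_snd[symmetric]) (rule sq_dist_measurable[OF assms(1,2)])
  also have "... \<le> (\<integral>\<^sup>+r. c * indicator {0..T} r \<partial>lborel)"
  proof (rule nn_integral_mono_AE)
    show "AE r in lborel. (\<integral>\<^sup>+w. sq_dist T f g (w, r) \<partial>M) \<le> c * indicator {0..T} r"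
      using AE_lborel_singleton[of 0]
    proof eventually_elim
      case (elim r)
      then show ?case using le[of r] by (cases "r \<in> {0..T}") (auto simp: sq_dist_def on_time_def)
    qed
  qed
  also have "... = c * ennreal T" using assms(3) by (simp add: nn_integral_cmult_indicator)
  finally show ?thesis .
qed

end

context brownian_setup
begin

lemma adapted_simple_grid:
  assumes "grid T N s" "\<And>l. l < n \<Longrightarrow> G l \<in> borel_measurable (F (s l))" "n \<le> N"
  shows "adapted_simple n s G" using assms by (auto simp: adapted_simple_def grid_def less_imp_le)

lemma simple_proc_grid:
  fixes G :: "nat \<Rightarrow> 'a \<Rightarrow> real^'d"
  assumes "grid T N s" "l < n" "n \<le> N" "s l < r" "r \<le> s (Suc l)"
  shows "simple_proc n s G r w = G l w"
proof -
  have "s k < r \<and> r \<le> s (Suc k) \<longleftrightarrow> k = l" if "k < n" for k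
  proof -
    consider "k < l" | "k = l" | "l < k" by linarith
    then show ?thesis
    proof cases
      case 1
      then show ?thesis using grid_mono[OF assms(1), of "Suc k" l] assms by auto
    next
      case 3
      then show ?thesis using grid_mono[OF assms(1), of "Suc l" k] assms that by auto
    qed (use assms in auto)
  qed
  then have "simple_proc n s G r w = (\<Sum>k<n. if k = l then G k w else 0)"
    unfolding simple_proc_def by (intro sum.cong) auto
  then show ?thesis using assms(2) by simp
qed

lemma simple_proc_beyond:
  fixes G :: "nat \<Rightarrow> 'a \<Rightarrow> real^'d"
  assumes "grid T N s" "n \<le> N" "s n < r"
  shows "simple_proc n s G r w = 0" unfolding simple_proc_def
proof (intro sum.neutral ballI)
  fix k assume "k \<in> {..<n}"
  then have "s (Suc k) \<le> s n" using grid_mono[OF assms(1), of "Suc k" n] assms(2) by auto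
  then show "(if s k < r \<and> r \<le> s (Suc k) then G k w else 0) = 0" using assms(3) by auto
qed

lemma simple_proc_zero:
  fixes G :: "nat \<Rightarrow> 'a \<Rightarrow> real^'d"
  assumes "grid T N s" "n \<le> N"
  shows "simple_proc n s G 0 w = 0" unfolding simple_proc_def
proof (intro sum.neutral ballI)
  fix k assume "k \<in> {..<n}"
  then have "0 \<le> s k" using grid_nonneg[OF assms(1), of k] assms(2) by auto
  then show "(if s k < 0 \<and> 0 \<le> s (Suc k) then G k w else 0) = 0" by auto
qed

lemma simple_int_before:
  assumes "grid T N s" "n \<le> N" "s n \<le> r"
  shows "simple_int W n s G r w = dint s G n w" unfolding simple_int_def dint_def
proof (intro sum.cong refl)
  fix k assume "k \<in> {..<n}"
  then have "s k \<le> s n" "s (Suc k) \<le> s n" using grid_mono[OF assms(1), of _ n] assms(2) by auto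
  then show "G k w \<bullet> (W (min r (s (Suc k))) w - W (min r (s k)) w) = G k w \<bullet> incr s k w"
    using assms(3) by (simp add: min_absorb2 incr_def)
qed

lemma simple_int_at:
  assumes "grid T N s" "m \<le> N"
  shows "simple_int W N s G (s m) w = dint s G m w"
proof -
  have "simple_int W N s G (s m) w = (\<Sum>k<N. if k < m then G k w \<bullet> incr s k w else 0)" unfolding simple_int_def
  proof (intro sum.cong refl)
    fix k assume "k \<in> {..<N}"
    then show "G k w \<bullet> (W (min (s m) (s (Suc k))) w - W (min (s m) (s k)) w)
        = (if k < m then G k w \<bullet> incr s k w else 0)"
      using grid_mono[OF assms(1), of "Suc k" m] grid_mono[OF assms(1), of k m]
        grid_mono[OF assms(1), of m k] grid_mono[OF assms(1), of m "Suc k"] assms(2)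
      by (cases "k < m") (auto simp: min_absorb1 min_absorb2 incr_def)
  qed
  also have "... = dint s G m w"
    unfolding dint_def using assms(2) by (subst sum.If_cases) (auto intro!: sum.cong)
  finally show ?thesis .
qed

lemma vint_component: "vint s B m w $ i = dint s (\<lambda>l w. B l w $ i) m w"
  by (simp add: vint_def dint_def matrix_vector_mul_component)

end

locale double_integral = brownian_setup M F W
  for M :: "'a measure" and F :: "real \<Rightarrow> 'a measure" and W :: "real \<Rightarrow> 'a \<Rightarrow> real^'d" +
  fixes b :: "real \<Rightarrow> 'a \<Rightarrow> real^'d^'d" and X :: "real \<Rightarrow> 'a \<Rightarrow> real^'d" and V :: "real \<Rightarrow> 'a \<Rightarrow> real"
    and A :: "real^'d^'d" and \<rho> :: real
  assumes rows: "\<And>i. ito_integral M F W (\<lambda>t w. b t w $ i) (\<lambda>t w. X t w $ i)"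
    and V: "ito_integral M F W X V"
    and b: "\<And>t w. 0 \<le> t \<Longrightarrow> w \<in> space M \<Longrightarrow> b t w \<in> op_ball A \<rho>"
    and \<rho>_pos: "0 < \<rho>"
begin

lemma V_measurable: "0 \<le> t \<Longrightarrow> V t \<in> borel_measurable M"
  using V by (intro measurable_F_M[of _ t]) (auto simp: ito_integral_def)

text \<open>The rows of \<open>b\<close> are approximated separately, brought onto one grid and
  projected as a matrix into the ball. The discrete inner integral freezes at the left end of each
  cell, so the mesh must be small too. Including \<open>D\<close> among the nodes allows evaluation
  at prescribed times.\<close>

lemma ito_approx:
  assumes T: "0 < T" and D: "finite D" "D \<subseteq> {0..T}" and e: "0 < e"
  obtains N s B where "grid T N s" "D \<subseteq> s ` {..N}" "\<forall>l<N. s (Suc l) - s l \<le> e"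
    "\<forall>l<N. B l \<in> borel_measurable (F (s l))" "\<forall>l w. B l w \<in> op_ball A \<rho>"
    "\<forall>m\<le>N. (\<integral>\<^sup>+w. ennreal ((dint s (vint s B) m w - V (s m) w)\<^sup>2) \<partial>M) \<le> ennreal e"
proof -
  let ?b = "\<lambda>i t w. b t w $ i"
  let ?K = "op_ball A \<rho>" and ?d = "real CARD('d)"
  note \<rho> = less_imp_le[OF \<rho>_pos]
  define c where "c = (norm A + ?d * \<rho>)\<^sup>2"
  \<comment> \<open>The final error is \<open>8 * T * ?d * (c * \<eta> + ?d * e1)\<close>, and
    \<open>e1\<close> and \<open>\<eta>\<close> give each part at most \<open>e / 2\<close>. The 8
    is made of three factors 2: the outer and the inner comparison with the Ito integral, and one
    triangle inequality. The \<open>?d\<close> inside the bracket appears because projection mixes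
    the rows, the other one from summing components. The summand 1 in \<open>c + 1\<close> keeps the
    divisor positive.\<close>
  define e1 where "e1 = e / (16 * T * ?d\<^sup>2)"
  define \<eta> where "\<eta> = min e (e / (16 * T * ?d * (c + 1)))"
  have c: "0 \<le> c" by (simp add: c_def)
  have pos: "0 < e1" "0 < \<eta>" "\<eta> \<le> e" using e T c by (auto simp: e1_def \<eta>_def)
  have small: "8 * T * ?d * (c * \<eta> + ?d * e1) \<le> e"
  proof -
    have "c * \<eta> \<le> (c + 1) * (e / (16 * T * ?d * (c + 1)))" using c pos by (intro mult_mono) (auto simp: \<eta>_def)
    also have "... = e / (16 * T * ?d)" using c by simp
    finally have "8 * T * ?d * (c * \<eta>) \<le> 8 * T * ?d * (e / (16 * T * ?d))"
      using T by (intro mult_left_mono) auto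
    moreover have "8 * T * ?d * (e / (16 * T * ?d)) = e / 2" "8 * T * ?d * (?d * e1) = e / 2"
      using T by (simp_all add: e1_def power2_eq_square)
    ultimately show ?thesis by (simp add: distrib_left)
  qed
  have "\<exists>n \<tau> \<xi>. adapted_simple n \<tau> \<xi> \<and> dist2 T (simple_proc n \<tau> \<xi>) (?b i) \<le> ennreal e1" for i
  proof -
    obtain n' \<tau>' \<xi>' where a': "\<forall>j. adapted_simple (n' j) (\<tau>' j) (\<xi>' j)"
      and l2: "(\<lambda>j. dist2 T (simple_proc (n' j) (\<tau>' j) (\<xi>' j)) (?b i)) \<longlonglongrightarrow> 0"
      by (rule ito_integral_approximation[OF rows T])
    have "eventually (\<lambda>j. dist2 T (simple_proc (n' j) (\<tau>' j) (\<xi>' j)) (?b i) < ennreal e1) sequentially"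
      by (rule order_tendstoD(2)[OF l2]) (use pos in simp)
    then obtain j where "dist2 T (simple_proc (n' j) (\<tau>' j) (\<xi>' j)) (?b i) < ennreal e1"
      unfolding eventually_sequentially by blast
    with a' show ?thesis by (meson less_imp_le)
  qed
  then obtain n \<tau> \<xi> where ad: "\<And>i. adapted_simple (n i) (\<tau> i) (\<xi> i)"
    and l2: "\<And>i. dist2 T (simple_proc (n i) (\<tau> i) (\<xi> i)) (?b i) \<le> ennreal e1" by metis
  define S where "S = ((\<Union>i. \<tau> i ` {..n i}) \<inter> {0..T}) \<union> D"
  have fS: "finite S" "S \<subseteq> {0..T}" using D by (auto simp: S_def)
  obtain N s where part: "grid T N s" and S: "S \<subseteq> s ` {..N}"
    and mesh_all: "\<forall>l<N. s (Suc l) - s l \<le> \<eta>" by (rule ex_grid_mesh[OF fS T pos(2)])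
  note mesh = mesh_all[rule_format]
  have sub: "\<tau> i k \<in> s ` {..N} \<or> T \<le> \<tau> i k" if "k \<le> n i" for i k
  proof (cases "\<tau> i k \<le> T")
    case True
    then have "\<tau> i k \<in> S" using adapted_simple_nonneg[OF ad that] that unfolding S_def by auto
    then show ?thesis using S by blast
  qed simp
  define Z where "Z l w = (\<chi> i. refine (n i) (\<tau> i) (\<xi> i) s l w)" for l w
  define B where "B l w = closest_point ?K (Z l w)" for l w
  \<comment> \<open>The projection is 1-Lipschitz and fixes \<open>b\<close>, so it does not spoil the approximation.\<close>
  have K: "convex ?K" "closed ?K" "?K \<noteq> {}"
    using convex_op_ball closed_op_ball \<rho> by (auto simp: op_ball_def intro: exI[of _ A])
  have BK: "B l w \<in> ?K" for l w unfolding B_def by (rule closest_point_in_set[OF K(2,3)])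
  have Bm: "B l \<in> borel_measurable (F (s l))" if "l < N" for l unfolding B_def[abs_def] Z_def
    by (rule borel_measurable_continuous_on[OF continuous_on_closest_point[OF K]])
      (intro borel_measurable_vec_lambda refine_measurable[OF ad part] less_imp_le[OF that])
  define G where "G i = (\<lambda>l w. B l w $ i)" for i
  have Gm: "G i l \<in> borel_measurable (F (s l))" if "l < N" for i l
    unfolding G_def using Bm[OF that] by measurable
  have Ga: "adapted_simple m s (G i)" if "m \<le> N" for i m
    by (rule adapted_simple_grid[OF part _ that]) (use Gm that in auto)
  have jb: "joint_measurable t (?b i)" if "0 \<le> t" for i t
    using rows[of i] that by (intro joint_measurable_progressive) (auto simp: ito_integral_def)
  have GB: "dist2 T (simple_proc N s (G i)) (?b i) \<le> ennreal (?d * e1)" for i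
  proof -
    have "dist2 T (simple_proc N s (G i)) (?b i)
        \<le> (\<Sum>i\<in>UNIV. dist2 T (simple_proc (n i) (\<tau> i) (\<xi> i)) (?b i))"
    proof (rule dist2_le_sum)
      fix r w assume r: "r \<in> {0..T}" and w: "w \<in> space M"
      show "(norm (simple_proc N s (G i) r w - b r w $ i))\<^sup>2
        \<le> (\<Sum>i\<in>UNIV. (norm (simple_proc (n i) (\<tau> i) (\<xi> i) r w - b r w $ i))\<^sup>2)"
      \<comment> \<open>Time 0 belongs to no cell. There every step process is 0, and the claim is
        that one term is at most the sum.\<close>
      proof (cases "r = 0")
        case True
        have "simple_proc (n i) (\<tau> i) (\<xi> i) 0 w = 0" for i unfolding simple_proc_def
        proof (intro sum.neutral ballI)
          fix k assume "k \<in> {..<n i}"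
          then have "0 \<le> \<tau> i k" using adapted_simple_nonneg[OF ad, of k i] by auto
          then show "(if \<tau> i k < 0 \<and> 0 \<le> \<tau> i (Suc k) then \<xi> i k w else 0) = 0" by auto
        qed
        then show ?thesis unfolding True simple_proc_zero[OF part le_refl]
          by (auto intro: member_le_sum[where f = "\<lambda>i. (norm (b 0 w $ i))\<^sup>2"])
      next
        case False
        then obtain l where l: "l < N" "s l < r" "r \<le> s (Suc l)" using grid_cell[OF part, of r] r by auto
        have bK: "b r w \<in> ?K" using b r w by auto
        have "norm (simple_proc N s (G i) r w - b r w $ i) = norm ((B l w - b r w) $ i)"
          using simple_proc_grid[OF part l(1) le_refl l(2,3)] by (simp add: G_def)
        also have "... \<le> norm (B l w - b r w)" by (rule Finite_Cartesian_Product.norm_nth_le)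
        also have "... = dist (closest_point ?K (Z l w)) (closest_point ?K (b r w))"
          by (simp add: B_def closest_point_self[OF bK] dist_norm)
        also have "... \<le> norm (Z l w - b r w)" using closest_point_lipschitz[OF K] by (simp add: dist_norm)
        finally have "(norm (simple_proc N s (G i) r w - b r w $ i))\<^sup>2 \<le> (norm (Z l w - b r w))\<^sup>2"
          by (rule power_mono) simp
        also have "... = (\<Sum>i\<in>UNIV. (norm (simple_proc (n i) (\<tau> i) (\<xi> i) r w - b r w $ i))\<^sup>2)"
          unfolding power2_norm_vec by (simp add: Z_def simple_proc_refine[OF part sub l])
        finally show ?thesis .
      qed
    qed (use Ga ad T jb in \<open>auto intro: joint_measurable_simple_proc\<close>)
    also have "... \<le> (\<Sum>i\<in>(UNIV::'d set). ennreal e1)" by (intro sum_mono l2)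
    also have "... = ennreal (?d * e1)" using pos by (simp add: ennreal_mult ennreal_of_nat_eq_real_of_nat)
    finally show ?thesis .
  qed
  define p where "p = 4 * ?d * (c * \<eta> + ?d * e1)"
  have p0: "0 \<le> p" using c pos by (simp add: p_def)
  let ?k = "4 * (c * \<eta> + ?d * e1)"
  have comp: "(\<integral>\<^sup>+w. ennreal ((vint s B l w $ i - X r w $ i)\<^sup>2) \<partial>M) \<le> ennreal ?k"
    if l: "l < N" "s l < r" "r \<le> s (Suc l)" for i l r
  proof -
    have sl: "0 \<le> s l" using grid_nonneg[OF part] l by auto
    have rT: "0 < r" "r \<le> T" using sl l grid_le[OF part, of "Suc l"] by auto
    have lN: "l \<le> N" using l by simp
    have "(\<integral>\<^sup>+w. ennreal ((vint s B l w $ i - X r w $ i)\<^sup>2) \<partial>M)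
        = (\<integral>\<^sup>+w. ennreal ((simple_int W l s (G i) r w - X r w $ i)\<^sup>2) \<partial>M)"
      using simple_int_before[OF part lN, of r "G i"] l by (simp add: vint_component G_def)
    also have "... \<le> 2 * dist2 r (simple_proc l s (G i)) (?b i)"
      by (rule simple_int_ito_diff_le[OF rows Ga[OF lN]]) (use rT in auto)
    also have "... \<le> 2 * (2 * dist2 r (simple_proc l s (G i)) (simple_proc N s (G i)) + 2 * dist2 r (simple_proc N s (G i)) (?b i))"
      by (intro mult_left_mono dist2_triangle joint_measurable_simple_proc Ga jb) (use l rT in auto)
    also have "... \<le> 2 * (2 * ennreal (c * \<eta>) + 2 * ennreal (?d * e1))"
    proof (intro mult_left_mono add_mono)
      show "dist2 r (simple_proc N s (G i)) (?b i) \<le> ennreal (?d * e1)"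
        using dist2_mono_time[OF rT(2)] GB by (rule order_trans)
      have "dist2 r (simple_proc l s (G i)) (simple_proc N s (G i)) \<le> (\<integral>\<^sup>+w. ennreal (c * \<eta>) \<partial>M)"
        unfolding dist2_def
      proof (rule nn_integral_mono)
        fix w assume w: "w \<in> space M"
        let ?q = "\<lambda>u. ennreal ((norm (simple_proc l s (G i) u w - simple_proc N s (G i) u w))\<^sup>2)"
        have "(\<integral>\<^sup>+u\<in>{0..r}. ?q u \<partial>lborel)
          \<le> (\<integral>\<^sup>+u. ennreal c * indicator {s l..r} u \<partial>lborel)"
        proof (rule nn_integral_mono)
          fix u
          show "?q u * indicator {0..r} u
            \<le> ennreal c * indicator {s l..r} u"
          proof (cases "u \<in> {0..r}")
            case True
            consider "u = 0" | "0 < u" "u \<le> s l" | "s l < u" using True by force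
            then show ?thesis
            proof cases
              case 1
              then show ?thesis using simple_proc_zero[OF part lN] simple_proc_zero[OF part le_refl] by simp
            next
              case 2
              have "u \<le> T" using 2 grid_le[OF part lN] by simp
              then obtain k where k: "k < N" "s k < u" "u \<le> s (Suc k)" using grid_cell[OF part 2(1)] by auto
              have "k < l"
              proof (rule ccontr)
                assume "\<not> k < l"
                then have "s l \<le> s k" using grid_mono[OF part, of l k] k(1) by auto
                then show False using k(2) 2 by auto
              qed
              then show ?thesis
                using simple_proc_grid[OF part _ lN k(2,3)] simple_proc_grid[OF part k(1) le_refl k(2,3)] by simp
            next
              case 3
              have ul: "u \<le> s (Suc l)" using True l by auto
              have "(norm (simple_proc l s (G i) u w - simple_proc N s (G i) u w))\<^sup>2 = (norm (B l w $ i))\<^sup>2"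
                using simple_proc_beyond[OF part lN 3] simple_proc_grid[OF part l(1) le_refl 3 ul] by (simp add: G_def)
              also have "... \<le> c" unfolding c_def by (rule op_ball_row_bound[OF BK \<rho>])
              finally show ?thesis using 3 True by (simp add: ennreal_leI)
            qed
          qed simp
        qed
        also have "... = ennreal (c * (r - s l))"
          using l c by (simp add: nn_integral_cmult_indicator ennreal_mult')
        also have "... \<le> ennreal (c * \<eta>)" using mesh[OF l(1)] l c by (intro ennreal_leI mult_left_mono) auto
        finally show "(\<integral>\<^sup>+u\<in>{0..r}. ?q u \<partial>lborel) \<le> ennreal (c * \<eta>)" .
      qed
      then show "dist2 r (simple_proc l s (G i)) (simple_proc N s (G i)) \<le> ennreal (c * \<eta>)"
        by (simp add: emeasure_space_1)
    qed auto
    also have "... = ennreal ?k"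
    proof -
      have "ennreal ?k = ennreal 2 * (ennreal 2 * ennreal (c * \<eta>) + ennreal 2 * ennreal (?d * e1))"
        using c pos by (simp add: distrib_left flip: ennreal_plus ennreal_mult' ennreal_numeral)
      then show ?thesis by simp
    qed
    finally show ?thesis .
  qed
  have vm: "vint s B l \<in> borel_measurable (F (s l))" if "l < N" for l
    by (rule vint_measurable[OF part]) (use that Bm in auto)
  have va: "adapted_simple N s (vint s B)" by (rule adapted_simple_grid[OF part vm le_refl])
  have vM: "vint s B l \<in> borel_measurable M" if "l < N" for l
    by (rule measurable_F_M[OF vm[OF that] grid_nonneg[OF part]]) (use that in simp)
  have XM: "X r \<in> borel_measurable M" if "0 \<le> r" for r
  proof -
    have "(\<lambda>w. \<chi> i. X r w $ i) \<in> borel_measurable M"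
    proof (rule borel_measurable_vec_lambda)
      show "(\<lambda>w. X r w $ i) \<in> borel_measurable M" for i
        by (rule measurable_F_M[OF _ that]) (use rows[of i] that in \<open>simp add: ito_integral_def\<close>)
    qed
    then show ?thesis by simp
  qed
  have VX: "dist2 T (simple_proc N s (vint s B)) X \<le> ennreal p * ennreal T"
  proof (rule dist2_le_sections)
    show "joint_measurable T X" using V T by (intro joint_measurable_progressive) (auto simp: ito_integral_def)
    fix r assume r: "0 < r" "r \<le> T"
    then obtain l where l: "l < N" "s l < r" "r \<le> s (Suc l)" using grid_cell[OF part] by auto
    have "(\<integral>\<^sup>+w. ennreal ((norm (simple_proc N s (vint s B) r w - X r w))\<^sup>2) \<partial>M)
      = (\<integral>\<^sup>+w. (\<Sum>i\<in>UNIV. ennreal ((vint s B l w $ i - X r w $ i)\<^sup>2)) \<partial>M)"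
      unfolding simple_proc_grid[OF part l(1) le_refl l(2,3)]
      by (intro nn_integral_cong, subst sum_ennreal) (auto simp: power2_norm_vec)
    also have "... = (\<Sum>i\<in>UNIV. \<integral>\<^sup>+w. ennreal ((vint s B l w $ i - X r w $ i)\<^sup>2) \<partial>M)"
    proof (rule nn_integral_sum)
      have [measurable]: "vint s B l \<in> borel_measurable M" "X r \<in> borel_measurable M" using vM[OF l(1)] XM r by auto
      show "(\<lambda>w. ennreal ((vint s B l w $ i - X r w $ i)\<^sup>2)) \<in> borel_measurable M" for i by measurable
    qed
    also have "... \<le> (\<Sum>i\<in>(UNIV::'d set). ennreal ?k)" by (intro sum_mono comp l)
    also have "... = ennreal p"
    proof -
      have "(\<Sum>i\<in>(UNIV::'d set). ennreal ?k) = ennreal (\<Sum>i\<in>(UNIV::'d set). ?k)"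
        using c pos by (intro sum_ennreal) auto
      also have "(\<Sum>i\<in>(UNIV::'d set). ?k) = p" by (simp add: p_def)
      finally show ?thesis .
    qed
    finally show "(\<integral>\<^sup>+w. ennreal ((norm (simple_proc N s (vint s B) r w - X r w))\<^sup>2) \<partial>M) \<le> ennreal p" .
  qed (use T va in \<open>auto intro: joint_measurable_simple_proc\<close>)
  have fin: "(\<integral>\<^sup>+w. ennreal ((dint s (vint s B) m w - V (s m) w)\<^sup>2) \<partial>M) \<le> ennreal e" if "m \<le> N" for m
  proof -
    have "(\<integral>\<^sup>+w. ennreal ((dint s (vint s B) m w - V (s m) w)\<^sup>2) \<partial>M)
        \<le> 2 * dist2 T (simple_proc N s (vint s B)) X" unfolding simple_int_at[OF part that, symmetric]
      by (rule simple_int_ito_diff_le[OF V va]) (use grid_nonneg[OF part that] grid_le[OF part that] T in auto)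
    also have "... \<le> 2 * (ennreal p * ennreal T)" using VX by (rule mult_left_mono) simp
    also have "... = ennreal (2 * p * T)" using p0 T by (simp add: ennreal_mult mult.assoc)
    also have "... \<le> ennreal e" using small by (intro ennreal_leI) (simp add: p_def algebra_simps)
    finally show ?thesis .
  qed
  have DS: "D \<subseteq> s ` {..N}" using S by (auto simp: S_def)
  have "s (Suc l) - s l \<le> e" if "l < N" for l using mesh[OF that] pos by linarith
  then show ?thesis by (intro that[of N s B, OF part DS]) (use Bm BK fin in simp_all)
qed

end

section \<open>The upper bound\<close>

text \<open>The bound comes from (1 + 4 x) (1 - 2 x) - 1 = 2 x (1 - 4 x), which is nonnegative on
  this range.\<close>

lemma inverse_sqrt_le_exp:
  fixes x :: real
  assumes "0 \<le> x" "x \<le> 1/4"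
  shows "1 / sqrt (1 - 2 * x) \<le> exp (2 * x)"
proof -
  have "1 \<le> (1 + 4 * x) * (1 - 2 * x)"
    using mult_nonneg_nonneg[of x "1 - 4 * x"] assms by (simp add: algebra_simps)
  also have "... \<le> exp (4 * x) * (1 - 2 * x)"
    using assms exp_ge_add_one_self[of "4 * x"] by (intro mult_right_mono) auto
  finally have "1 / (1 - 2 * x) \<le> exp (4 * x)" using assms by (simp add: field_simps)
  then have "sqrt (1 / (1 - 2 * x)) \<le> sqrt (exp (4 * x))" by (rule real_sqrt_le_mono)
  also have "sqrt (exp (4 * x)) = exp (2 * x)"
  proof (rule real_sqrt_unique)
    show "(exp (2 * x))\<^sup>2 = exp (4 * x)" by (simp add: power2_eq_square flip: exp_add)
  qed simp
  finally show ?thesis by (simp add: real_sqrt_divide)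
qed

context prob_space
begin

lemma prob_le_of_nn_integral_le:
  assumes "S \<in> sets M" "0 < c" "0 \<le> e"
    and "\<And>w. w \<in> S \<Longrightarrow> ennreal c \<le> f w" and "(\<integral>\<^sup>+w. f w \<partial>M) \<le> ennreal e"
  shows "prob S \<le> e / c"
proof -
  have "ennreal (c * prob S) = (\<integral>\<^sup>+w. ennreal c * indicator S w \<partial>M)"
    using assms(1,2) by (simp add: nn_integral_cmult_indicator emeasure_eq_measure ennreal_mult)
  also have "... \<le> (\<integral>\<^sup>+w. f w \<partial>M)" by (intro nn_integral_mono) (auto simp: indicator_def assms(4))
  finally have "ennreal (c * prob S) \<le> ennreal e" using assms(5) by (rule order_trans)
  then show ?thesis using assms(2,3) by (simp add: field_simps)
qed

end

section \<open>Quadratic variation and summation by parts on a grid\<close>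

context brownian_setup
begin

lemma incr_measurable_M:
  assumes "grid T N s" "l < N"
  shows "incr s l \<in> borel_measurable M"
proof -
  have [measurable]: "W (s k) \<in> borel_measurable M" if "k \<le> N" for k
    by (rule W_measurable[OF grid_nonneg[OF assms(1) that]])
  have [measurable]: "W (s l) \<in> borel_measurable M" "W (s (Suc l)) \<in> borel_measurable M"
    using assms(2) by auto
  show ?thesis unfolding incr_def by measurable
qed

text \<open>Freezing contributes one factor (1 - 2 R dt)^(-d/2) per cell. The mesh bound gives R dt
  at most 1/4, where this is at most exp (2 R d dt), and these factors multiply to the exponential
  of the total time.\<close>

lemma nn_integral_exp_quadratic_variation:
  assumes part: "grid T N s" and R: "0 < R" and mesh: "\<And>l. l < N \<Longrightarrow> s (Suc l) - s l \<le> 1 / (4 * R)" and m: "m \<le> N"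
  shows "(\<integral>\<^sup>+w. ennreal (exp (R * (\<Sum>l<m. (norm (incr s l w))\<^sup>2))) \<partial>M) \<le> ennreal (exp (2 * R * real CARD('d) * s m))"
  using m
proof (induction m)
  case 0
  then show ?case using part by (simp add: grid_def emeasure_space_1)
next
  case (Suc m)
  let ?dt = "s (Suc m) - s m" and ?d = "real CARD('d)"
  let ?E = "\<lambda>w. exp (R * (\<Sum>l<m. (norm (incr s l w))\<^sup>2))"
  have sm: "0 \<le> s m" "s m < s (Suc m)" using Suc.prems grid_nonneg[OF part, of m] grid_less[OF part, of m "Suc m"] by auto
  have Rd: "0 \<le> R * ?dt" "R * ?dt \<le> 1/4" using mesh[of m] Suc.prems R sm by (auto simp: field_simps)
  have [measurable]: "incr s l \<in> borel_measurable (F (s m))" if "l \<in> {..<m}" for l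
    by (rule increment_measurable[OF part]) (use that Suc.prems in auto)
  have E: "?E \<in> borel_measurable (F (s m))" by measurable
  have EM [measurable]: "?E \<in> borel_measurable M" by (rule measurable_F_M[OF E sm(1)])
  define \<phi> where "\<phi> = (\<lambda>(w, z::real^'d). ennreal (?E w) * ennreal (exp (0 \<bullet> z + R * (norm z)\<^sup>2)))"
  have \<phi>: "\<phi> \<in> borel_measurable (F (s m) \<Otimes>\<^sub>M borel)" unfolding \<phi>_def using E by measurable
  have "(\<integral>\<^sup>+w. ennreal (exp (R * (\<Sum>l<Suc m. (norm (incr s l w))\<^sup>2))) \<partial>M)
      = (\<integral>\<^sup>+w. \<phi> (w, W (s (Suc m)) w - W (s m) w) \<partial>M)"
    unfolding \<phi>_def by (intro nn_integral_cong) (simp add: incr_def distrib_left exp_add ennreal_mult')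
  also have "... = (\<integral>\<^sup>+w. \<integral>\<^sup>+z. \<phi> (w, z) \<partial>gauss_vec ?dt \<partial>M)" by (rule nn_integral_freeze[OF sm \<phi>])
  also have "... \<le> (\<integral>\<^sup>+w. ennreal (exp (2 * R * ?d * ?dt)) * ennreal (?E w) \<partial>M)"
  proof (rule nn_integral_mono)
    fix w
    have q: "0 < ?dt" "2 * R * ?dt < 1" using sm Rd by auto
    have "(\<integral>\<^sup>+z. \<phi> (w, z) \<partial>gauss_vec ?dt) = ennreal (?E w) * (\<integral>\<^sup>+z. ennreal (exp (0 \<bullet> z + R * (norm z)\<^sup>2)) \<partial>(gauss_vec ?dt :: (real^'d) measure))"
      unfolding \<phi>_def prod.case by (rule nn_integral_cmult) measurable
    also have "... = ennreal (?E w) * ennreal (1 / sqrt (1 - 2 * (R * ?dt)) ^ CARD('d))"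
      by (subst nn_integral_exp_quadratic_gauss[OF q]) (simp add: mult.assoc)
    also have "... \<le> ennreal (?E w) * ennreal (exp (2 * R * ?d * ?dt))"
    proof (intro mult_left_mono ennreal_leI)
      have "1 / sqrt (1 - 2 * (R * ?dt)) ^ CARD('d) = (1 / sqrt (1 - 2 * (R * ?dt))) ^ CARD('d)"
        by (simp add: power_one_over)
      also have "... \<le> exp (2 * (R * ?dt)) ^ CARD('d)"
        by (intro power_mono inverse_sqrt_le_exp Rd) (use Rd in simp)
      also have "... = exp (2 * R * ?d * ?dt)" by (simp add: mult_ac flip: exp_of_nat_mult)
      finally show "1 / sqrt (1 - 2 * (R * ?dt)) ^ CARD('d) \<le> exp (2 * R * ?d * ?dt)" .
    qed simp
    finally show "(\<integral>\<^sup>+z. \<phi> (w, z) \<partial>gauss_vec ?dt) \<le> ennreal (exp (2 * R * ?d * ?dt)) * ennreal (?E w)"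
      by (simp add: mult.commute)
  qed
  also have "... = ennreal (exp (2 * R * ?d * ?dt)) * (\<integral>\<^sup>+w. ennreal (?E w) \<partial>M)"
    by (rule nn_integral_cmult) measurable
  also have "... \<le> ennreal (exp (2 * R * ?d * ?dt)) * ennreal (exp (2 * R * ?d * s m))"
    using Suc by (intro mult_left_mono) auto
  also have "... = ennreal (exp (2 * R * ?d * s (Suc m)))"
    by (simp add: ennreal_mult'[symmetric] algebra_simps flip: exp_add)
  finally show ?case .
qed

text \<open>Chernoff's bound: 2 d in the threshold cancels the exponential moment, the extra 1
  leaves \<open>exp (- R * T)\<close>. As \<open>R\<close> is limited only by the mesh, a finer grid
  makes this as small as desired.\<close>

lemma prob_quadratic_variation_gt:
  assumes part: "grid T N s" and R: "0 < R" and mesh: "\<And>l. l < N \<Longrightarrow> s (Suc l) - s l \<le> 1 / (4 * R)"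
  shows "prob {w\<in>space M. (2 * real CARD('d) + 1) * T < (\<Sum>l<N. (norm (incr s l w))\<^sup>2)} \<le> exp (- R * T)"
proof -
  let ?K = "(2 * real CARD('d) + 1) * T" and ?Q = "\<lambda>w. \<Sum>l<N. (norm (incr s l w))\<^sup>2"
  have [measurable]: "incr s l \<in> borel_measurable M" if "l \<in> {..<N}" for l
    using incr_measurable_M[OF part] that by auto
  have "prob {w\<in>space M. ?K < ?Q w} \<le> exp (2 * R * real CARD('d) * T) / exp (R * ?K)"
  proof (rule prob_le_of_nn_integral_le[where f = "\<lambda>w. ennreal (exp (R * ?Q w))"])
    show "{w\<in>space M. ?K < ?Q w} \<in> sets M" by measurable
    show "(\<integral>\<^sup>+w. ennreal (exp (R * ?Q w)) \<partial>M) \<le> ennreal (exp (2 * R * real CARD('d) * T))"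
      using nn_integral_exp_quadratic_variation[OF part R mesh le_refl] part by (simp add: grid_def)
    show "ennreal (exp (R * ?K)) \<le> ennreal (exp (R * ?Q w))" if "w \<in> {w\<in>space M. ?K < ?Q w}" for w
      using that R by (intro ennreal_leI) simp
  qed simp_all
  also have "... = exp (- R * T)" by (simp add: algebra_simps flip: exp_diff)
  finally show ?thesis .
qed

lemma vint_shifted:
  assumes "grid T N s" "m \<le> N" "w \<in> space M"
  shows "vint s (\<lambda>l w. c *\<^sub>R (B l w - A)) m w = c *\<^sub>R (vint s B m w - A *v W (s m) w)" using assms(2)
proof (induction m)
  case 0
  then show ?case using assms(1) W_0[OF assms(3)] by (simp add: vint_def grid_def)
next
  case (Suc m)
  have step: "vint s G (Suc m) w = vint s G m w + G m w *v incr s m w" for G by (simp add: vint_def)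
  have Ai: "A *v incr s m w = A *v W (s (Suc m)) w - A *v W (s m) w"
    by (simp add: incr_def matrix_vector_mult_diff_distrib)
  have "(c *\<^sub>R (B m w - A)) *v incr s m w = c *\<^sub>R (B m w *v incr s m w - A *v incr s m w)"
    by (simp add: scaleR_matrix_vector_assoc[symmetric] matrix_vector_mult_diff_rdistrib)
  moreover have "vint s (\<lambda>l w. c *\<^sub>R (B l w - A)) m w = c *\<^sub>R (vint s B m w - A *v W (s m) w)"
    using Suc by simp
  ultimately show ?case unfolding step Ai by (simp add: scaleR_right_diff_distrib scaleR_right_distrib)
qed

text \<open>Summation by parts, the discrete Ito formula: for symmetric \<open>A\<close>, twice the
  sum of A W against dW is the form of \<open>A\<close> at the current \<open>W\<close> minus the
  sum of the forms at the increments.\<close>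

lemma dint_shifted:
  assumes "grid T N s" "m \<le> N" "w \<in> space M" and sym: "\<And>x y. x \<bullet> (A *v y) = (A *v x) \<bullet> y"
  shows "2 * dint s (vint s (\<lambda>l w. c *\<^sub>R (B l w - A))) m w
    = c * (2 * dint s (vint s B) m w - W (s m) w \<bullet> (A *v W (s m) w) + (\<Sum>l<m. incr s l w \<bullet> (A *v incr s l w)))"
  using assms(2)
proof (induction m)
  case 0
  then show ?case using assms(1) W_0[OF assms(3)] by (simp add: dint_def grid_def)
next
  case (Suc m)
  let ?x = "W (s m) w" and ?z = "incr s m w"
  have W: "W (s (Suc m)) w = ?x + ?z" by (simp add: incr_def)
  have e: "(?x + ?z) \<bullet> (A *v (?x + ?z)) = ?x \<bullet> (A *v ?x) + 2 * ((A *v ?x) \<bullet> ?z) + ?z \<bullet> (A *v ?z)"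
    using sym[of ?x ?z] by (simp add: matrix_vector_right_distrib inner_add_left inner_add_right inner_commute)
  have "2 * dint s (vint s (\<lambda>l w. c *\<^sub>R (B l w - A))) (Suc m) w
      = 2 * dint s (vint s (\<lambda>l w. c *\<^sub>R (B l w - A))) m w + 2 * (vint s (\<lambda>l w. c *\<^sub>R (B l w - A)) m w \<bullet> ?z)"
    unfolding dint_def by simp
  also have "vint s (\<lambda>l w. c *\<^sub>R (B l w - A)) m w = c *\<^sub>R (vint s B m w - A *v ?x)"
    by (rule vint_shifted[OF assms(1) _ assms(3)]) (use Suc.prems in simp)
  finally have "2 * dint s (vint s (\<lambda>l w. c *\<^sub>R (B l w - A))) (Suc m) w
      = c * (2 * dint s (vint s B) m w - ?x \<bullet> (A *v ?x) + (\<Sum>l<m. incr s l w \<bullet> (A *v incr s l w)))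
        + 2 * (c * (vint s B m w \<bullet> ?z - (A *v ?x) \<bullet> ?z))" using Suc by (simp add: inner_diff_left)
  moreover have "dint s (vint s B) (Suc m) w = dint s (vint s B) m w + vint s B m w \<bullet> ?z"
    by (simp add: dint_def)
  ultimately show ?case unfolding W e by (simp add: algebra_simps)
qed

end

text \<open>Both parts of the theorem are instances: \<open>A\<close> is 0 with radius 1 for the
  upper bound, and a positive definite shift of \<beta> for the lower one. Positivity makes the sum
  of forms at the increments nonnegative, and \<open>a\<close> bounds it by the quadratic
  variation.\<close>

locale psd_double_integral = double_integral M F W b X V A \<rho>
  for M :: "'a measure" and F :: "real \<Rightarrow> 'a measure" and W :: "real \<Rightarrow> 'a \<Rightarrow> real^'d"
    and b :: "real \<Rightarrow> 'a \<Rightarrow> real^'d^'d" and X :: "real \<Rightarrow> 'a \<Rightarrow> real^'d" and V :: "real \<Rightarrow> 'a \<Rightarrow> real"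
    and A :: "real^'d^'d" and \<rho> :: real +
  fixes a :: real
  assumes sym: "\<And>x y. x \<bullet> (A *v y) = (A *v x) \<bullet> y"
    and psd: "\<And>x. 0 \<le> x \<bullet> (A *v x)" and A_le: "\<And>x. x \<bullet> (A *v x) \<le> a * (norm x)\<^sup>2" and a_nonneg: "0 \<le> a"
begin

text \<open>Twice the double integral of the constant matrix \<open>A\<close> is \<open>W \<bullet> A W - t tr A\<close>. Hence \<open>gap\<close> is, up to a term of
  order \<open>t\<close>, minus twice the double integral of \<open>b - A\<close>.\<close>

definition gap :: "real \<Rightarrow> 'a \<Rightarrow> real" where
  "gap t w = W t w \<bullet> (A *v W t w) - 2 * V t w"

text \<open>In the threshold, \<open>a (2 d + 1) T\<close> dominates the sum of the terms \<open>\<Delta>W \<bullet> A \<Delta>W\<close>, and the last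
  summand \<open>T\<close> absorbs the approximation error.\<close>

lemma prob_exceed_finite_le:
  assumes T: "0 < T" and D: "finite D" "D \<subseteq> {0..T}" and p: "0 < p" "2 * p * T < 1"
  shows "prob {w\<in>space M. \<exists>t\<in>D. \<rho> * \<alpha> + (a * (2 * real CARD('d) + 1) + 1) * T < \<bar>gap t w\<bar>}
    \<le> 2 * (exp (- p * \<alpha>) / sqrt (1 - 2 * p * T) ^ CARD('d))"
    (is "prob ?S \<le> 2 * ?c")
proof (rule field_le_epsilon)
  note \<rho> = \<rho>_pos
  fix \<eta> :: real assume \<eta>: "0 < \<eta>"
  \<comment> \<open>\<open>R\<close> makes the quadratic variation fail with probability at most
    \<open>\<eta> / 2\<close>. In \<open>e\<close> the first entry is the mesh this requires; the
    second makes the Chebyshev bounds 4 e / T^2, summed over \<open>D\<close>, at most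
    \<open>\<eta> / 2\<close>.\<close>
  define R where "R = (\<bar>ln (\<eta> / 2)\<bar> + 1) / T"
  define e where "e = min (1 / (4 * R)) (\<eta> * T\<^sup>2 / (8 * (real (card D) + 1)))"
  have R: "0 < R" using T by (simp add: R_def)
  have e: "0 < e" using R \<eta> T by (simp add: e_def)
  have expR: "exp (- R * T) \<le> \<eta> / 2"
  proof -
    have "- R * T \<le> ln (\<eta> / 2)" using T by (simp add: R_def)
    then have "exp (- R * T) \<le> exp (ln (\<eta> / 2))" by simp
    then show ?thesis using \<eta> by simp
  qed
  obtain N s B where part: "grid T N s" and Ds: "D \<subseteq> s ` {..N}" and mesh_all: "\<forall>l<N. s (Suc l) - s l \<le> e"
    and Bm_all: "\<forall>l<N. B l \<in> borel_measurable (F (s l))" and BK_all: "\<forall>l w. B l w \<in> op_ball A \<rho>"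
    and VB_all: "\<forall>m\<le>N. (\<integral>\<^sup>+w. ennreal ((dint s (vint s B) m w - V (s m) w)\<^sup>2) \<partial>M) \<le> ennreal e"
    by (rule ito_approx[OF T D e])
  note Bm = Bm_all[rule_format] and BK = BK_all[rule_format] and VB = VB_all[rule_format]
  have mesh: "s (Suc l) - s l \<le> 1 / (4 * R)" if "l < N" for l using mesh_all that by (simp add: e_def)
  obtain idx where idx: "\<And>t. t \<in> D \<Longrightarrow> idx t \<le> N \<and> s (idx t) = t"
  proof -
    have "\<forall>t\<in>D. \<exists>m. m \<le> N \<and> s m = t" using Ds by auto
    from bchoice[OF this] obtain f where "\<forall>t\<in>D. f t \<le> N \<and> s (f t) = t" ..
    then show ?thesis using that by blast
  qed
  \<comment> \<open>Division by \<open>\<rho>\<close> turns the ball around \<open>A\<close> into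
    contractions. The signs 1 and -1 of \<open>\<sigma>\<close> yield the two sides of the absolute
    value, hence the factor 2 in the claim.\<close>
  define \<beta> where "\<beta> \<sigma> = (\<lambda>l w. (\<sigma> / \<rho>) *\<^sub>R (B l w - A))" for \<sigma> :: real
  define E1 where "E1 \<sigma> = {w\<in>space M. \<exists>m\<le>N. \<alpha> \<le> 2 * dint s (vint s (\<beta> \<sigma>)) m w}" for \<sigma>
  define E3 where "E3 = {w\<in>space M. (2 * real CARD('d) + 1) * T < (\<Sum>l<N. (norm (incr s l w))\<^sup>2)}"
  define E4 where "E4 t = {w\<in>space M. T \<le> \<bar>2 * dint s (vint s B) (idx t) w - 2 * V t w\<bar>}" for t
  have \<beta>m: "\<beta> \<sigma> l \<in> borel_measurable (F (s l))" if "l < N" for \<sigma> l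
    unfolding \<beta>_def using Bm[OF that] by measurable
  have P1: "prob (E1 \<sigma>) \<le> ?c" if \<sigma>: "\<bar>\<sigma>\<bar> = 1" for \<sigma> unfolding E1_def
  proof (rule prob_max_iterated_integral_le[OF part \<beta>m _ p])
    fix l w and y :: "real^'d"
    have "norm (\<beta> \<sigma> l w *v y) = norm ((B l w - A) *v y) / \<rho>"
      using \<sigma> \<rho> by (simp add: \<beta>_def scaleR_matrix_vector_assoc[symmetric])
    also have "... \<le> norm y" using BK[of l w] \<rho> by (simp add: op_ball_def field_simps)
    finally show "norm (\<beta> \<sigma> l w *v y) \<le> norm y" .
  qed
  have vm: "vint s (\<beta> \<sigma>) l \<in> borel_measurable (F (s l))" if "l < N" for \<sigma> l
    by (rule vint_measurable[OF part]) (use that \<beta>m in auto)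
  have E1M: "E1 \<sigma> \<in> sets M" for \<sigma>
  proof -
    have [measurable]: "dint s (vint s (\<beta> \<sigma>)) m \<in> borel_measurable M" if "m \<in> {..N}" for m
      by (rule measurable_F_M[OF dint_measurable[OF part] grid_nonneg[OF part]]) (use that vm in auto)
    have "{w\<in>space M. \<exists>m\<in>{..N}. \<alpha> \<le> 2 * dint s (vint s (\<beta> \<sigma>)) m w} \<in> sets M" by measurable
    then show ?thesis by (simp add: E1_def Bex_def)
  qed
  have P3: "prob E3 \<le> \<eta> / 2" unfolding E3_def using prob_quadratic_variation_gt[OF part R mesh] expR by simp
  have E3M: "E3 \<in> sets M"
  proof -
    have [measurable]: "incr s l \<in> borel_measurable M" if "l \<in> {..<N}" for l
      using incr_measurable_M[OF part] that by auto
    show ?thesis unfolding E3_def by measurable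
  qed
  have vmB: "vint s B l \<in> borel_measurable (F (s l))" if "l < N" for l
    by (rule vint_measurable[OF part]) (use that Bm in auto)
  have E4M: "E4 t \<in> sets M" if "t \<in> D" for t
  proof -
    have [measurable]: "dint s (vint s B) (idx t) \<in> borel_measurable M"
      by (rule measurable_F_M[OF dint_measurable[OF part] grid_nonneg[OF part]]) (use idx[OF that] vmB in auto)
    have [measurable]: "V t \<in> borel_measurable M" using V_measurable D that by auto
    show ?thesis unfolding E4_def by measurable
  qed
  have P4: "prob (E4 t) \<le> e / (T\<^sup>2 / 4)" if "t \<in> D" for t
  proof (rule prob_le_of_nn_integral_le[OF E4M[OF that]])
    show "(\<integral>\<^sup>+w. ennreal ((dint s (vint s B) (idx t) w - V t w)\<^sup>2) \<partial>M) \<le> ennreal e"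
      using VB[of "idx t"] idx[OF that] by simp
    fix w assume "w \<in> E4 t"
    then have "T \<le> \<bar>2 * (dint s (vint s B) (idx t) w - V t w)\<bar>" by (simp add: E4_def)
    then have "T\<^sup>2 \<le> \<bar>2 * (dint s (vint s B) (idx t) w - V t w)\<bar>\<^sup>2" using T by (intro power_mono) auto
    then have "T\<^sup>2 / 4 \<le> (dint s (vint s B) (idx t) w - V t w)\<^sup>2"
      unfolding power2_abs power_mult_distrib by simp
    then show "ennreal (T\<^sup>2 / 4) \<le> ennreal ((dint s (vint s B) (idx t) w - V t w)\<^sup>2)" by (rule ennreal_leI)
  qed (use T e in auto)
  have P4': "prob (\<Union>t\<in>D. E4 t) \<le> \<eta> / 2"
  proof -
    have "prob (\<Union>t\<in>D. E4 t) \<le> (\<Sum>t\<in>D. prob (E4 t))" by (rule measure_UNION_le[OF D(1)]) (rule E4M)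
    also have "... \<le> (\<Sum>t\<in>D. e / (T\<^sup>2 / 4))" by (intro sum_mono P4)
    also have "... = real (card D) * (4 * e / T\<^sup>2)" by simp
    also have "... \<le> (real (card D) + 1) * (4 * (\<eta> * T\<^sup>2 / (8 * (real (card D) + 1))) / T\<^sup>2)"
      using e T by (intro mult_mono divide_right_mono) (auto simp: e_def)
    also have "... = \<eta> / 2"
    proof -
      have gen: "q * (4 * (\<eta> * T\<^sup>2 / (8 * q)) / T\<^sup>2) = \<eta> / 2" if "0 < q" for q :: real
        using T that by (simp add: field_simps)
      show ?thesis by (rule gen) simp
    qed
    finally show ?thesis .
  qed
  have UM: "(\<Union>t\<in>D. E4 t) \<in> sets M" by (rule sets.finite_UN[OF D(1)]) (rule E4M)
  \<comment> \<open>Off these events \<open>Y - 2 * V t w\<close> is decomposed into U - 2 V, the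
    sum Q, and -(U - Y + Q): the first is controlled by \<open>E4\<close>, the second by
    \<open>E3\<close>, the third by the two events \<open>E1\<close>.\<close>
  have "?S \<subseteq> (E1 1 \<union> E1 (-1)) \<union> (E3 \<union> (\<Union>t\<in>D. E4 t))"
  proof
    fix w assume "w \<in> ?S"
    then obtain t where w: "w \<in> space M" and t: "t \<in> D"
      and gt: "\<rho> * \<alpha> + (a * (2 * real CARD('d) + 1) + 1) * T < \<bar>gap t w\<bar>" by auto
    define m where "m = idx t"
    have m: "m \<le> N" "s m = t" using idx[OF t] by (auto simp: m_def)
    define Q where "Q = (\<Sum>l<m. incr s l w \<bullet> (A *v incr s l w))"
    define U where "U = 2 * dint s (vint s B) m w"
    define Y where "Y = W t w \<bullet> (A *v W t w)"
    have key: "2 * dint s (vint s (\<beta> \<sigma>)) m w = (\<sigma> / \<rho>) * (U - Y + Q)" for \<sigma>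
      unfolding \<beta>_def dint_shifted[OF part m(1) w sym] U_def Y_def Q_def m(2) ..
    show "w \<in> (E1 1 \<union> E1 (-1)) \<union> (E3 \<union> (\<Union>t\<in>D. E4 t))"
    proof (rule ccontr)
      assume n: "w \<notin> (E1 1 \<union> E1 (-1)) \<union> (E3 \<union> (\<Union>t\<in>D. E4 t))"
      have "2 * dint s (vint s (\<beta> \<sigma>)) m w < \<alpha>" if "w \<notin> E1 \<sigma>" for \<sigma>
      proof (rule ccontr)
        assume "\<not> 2 * dint s (vint s (\<beta> \<sigma>)) m w < \<alpha>"
        then have "w \<in> E1 \<sigma>" unfolding E1_def using m(1) w by (auto simp: not_less)
        then show False using that by simp
      qed
      from this[of 1] this[of "-1"] n have "2 * dint s (vint s (\<beta> 1)) m w < \<alpha>" "2 * dint s (vint s (\<beta> (-1))) m w < \<alpha>"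
        by auto
      then have "U - Y + Q < \<rho> * \<alpha>" "- (U - Y + Q) < \<rho> * \<alpha>" unfolding key using \<rho> by (auto simp: field_simps)
      moreover have "\<bar>U - 2 * V t w\<bar> < T" using n t w by (auto simp: E4_def U_def m_def not_le)
      moreover have "0 \<le> Q" unfolding Q_def by (intro sum_nonneg psd)
      moreover have "Q \<le> a * ((2 * real CARD('d) + 1) * T)"
      proof -
        have "Q \<le> (\<Sum>l<m. a * (norm (incr s l w))\<^sup>2)" unfolding Q_def by (intro sum_mono A_le)
        also have "... \<le> (\<Sum>l<N. a * (norm (incr s l w))\<^sup>2)" using m(1) a_nonneg by (intro sum_mono2) auto
        also have "... = a * (\<Sum>l<N. (norm (incr s l w))\<^sup>2)" by (simp add: sum_distrib_left)
        also have "... \<le> a * ((2 * real CARD('d) + 1) * T)"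
          using n w a_nonneg by (intro mult_left_mono) (auto simp: E3_def not_less)
        finally show ?thesis .
      qed
      moreover have "\<rho> * \<alpha> + a * ((2 * real CARD('d) + 1) * T) + T < \<bar>Y - 2 * V t w\<bar>" using gt by (simp add: Y_def gap_def algebra_simps)
      ultimately show False by linarith
    qed
  qed
  then have "prob ?S \<le> prob ((E1 1 \<union> E1 (-1)) \<union> (E3 \<union> (\<Union>t\<in>D. E4 t)))"
    by (rule finite_measure_mono) (intro sets.Un E1M E3M UM)
  also have "... \<le> (prob (E1 1) + prob (E1 (-1))) + (prob E3 + prob (\<Union>t\<in>D. E4 t))"
    by (intro order_trans[OF measure_Un_le] add_mono measure_Un_le sets.Un E1M E3M UM)
  also have "... \<le> (?c + ?c) + (\<eta> / 2 + \<eta> / 2)" by (intro add_mono P1 P3 P4') auto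
  finally show "prob ?S \<le> 2 * ?c + \<eta>" by simp
qed

text \<open>The bound for finite sets of times does not depend on the set, and the events along
  dyadic times increase, so their union inherits it. Outside the union the estimate holds on a dense
  set of times and extends to all of them along continuous paths.\<close>

lemma ex_exceed_event:
  assumes T: "0 < T" and p: "0 < p" "2 * p * T < 1"
  shows "\<exists>E. E \<in> sets M \<and> prob E \<le> 2 * (exp (- p * \<alpha>) / sqrt (1 - 2 * p * T) ^ CARD('d)) \<and>
    (AE w in M. w \<notin> E \<longrightarrow> (\<forall>t\<in>{0..T}. \<bar>gap t w\<bar> \<le> \<rho> * \<alpha> + (a * (2 * real CARD('d) + 1) + 1) * T))"
proof -
  define c where "c = \<rho> * \<alpha> + (a * (2 * real CARD('d) + 1) + 1) * T"
  define D where "D n = (\<lambda>k. real k * T / 2 ^ n) ` {..2 ^ n}" for n :: nat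
  define E where "E n = {w\<in>space M. \<exists>t\<in>D n. c < \<bar>gap t w\<bar>}" for n
  have D: "finite (D n)" "D n \<subseteq> {0..T}" for n
  proof -
    have "real k * T / 2 ^ n \<le> T" if "k \<le> 2 ^ n" for k
    proof -
      have "real k \<le> 2 ^ n" using that by (metis of_nat_le_iff of_nat_numeral of_nat_power)
      then show ?thesis using T by (simp add: divide_le_eq)
    qed
    then show "finite (D n)" "D n \<subseteq> {0..T}" using T by (auto simp: D_def)
  qed
  have YM: "gap t \<in> borel_measurable M" if "0 \<le> t" for t
  proof -
    have [measurable]: "W t \<in> borel_measurable M" using that by (rule W_measurable)
    have [measurable]: "V t \<in> borel_measurable M" using that by (rule V_measurable)
    show ?thesis unfolding gap_def by measurable
  qed
  have EM: "E n \<in> sets M" for n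
  proof -
    have [measurable]: "gap t \<in> borel_measurable M" if "t \<in> D n" for t using YM D(2)[of n] that by auto
    have [measurable]: "countable (D n)" using D(1) by (rule countable_finite)
    show ?thesis unfolding E_def by measurable
  qed
  have inc: "incseq E"
  proof (rule incseq_SucI)
    fix n
    have "D n \<subseteq> D (Suc n)"
    proof
      fix t assume "t \<in> D n"
      then obtain k where k: "k \<le> 2 ^ n" "t = real k * T / 2 ^ n" by (auto simp: D_def)
      then have "t = real (2 * k) * T / 2 ^ Suc n" "2 * k \<le> 2 ^ Suc n" by auto
      then show "t \<in> D (Suc n)" unfolding D_def by blast
    qed
    then show "E n \<subseteq> E (Suc n)" by (auto simp: E_def)
  qed
  have bd: "prob (E n) \<le> 2 * (exp (- p * \<alpha>) / sqrt (1 - 2 * p * T) ^ CARD('d))" for n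
    unfolding E_def c_def by (rule prob_exceed_finite_le[OF T D p])
  have lim: "(\<lambda>n. prob (E n)) \<longlonglongrightarrow> prob (\<Union>n. E n)" by (rule finite_Lim_measure_incseq) (use EM inc in auto)
  have "prob (\<Union>n. E n) \<le> 2 * (exp (- p * \<alpha>) / sqrt (1 - 2 * p * T) ^ CARD('d))"
    by (rule LIMSEQ_le_const2[OF lim]) (use bd in auto)
  moreover have "(\<Union>n. E n) \<in> sets M" using EM by auto
  moreover have "AE w in M. w \<notin> (\<Union>n. E n) \<longrightarrow> (\<forall>t\<in>{0..T}. \<bar>gap t w\<bar> \<le> c)"
  proof -
    have cW: "AE w in M. continuous_on {0..} (\<lambda>t. W t w)" using brownian by (simp add: brownian_motion_def)
    have cV: "AE w in M. continuous_on {0..} (\<lambda>t. V t w)" using V by (simp add: ito_integral_def)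
    show ?thesis using cW cV AE_space
    proof eventually_elim
      case (elim w)
      have cY: "continuous_on {0..} (\<lambda>t. gap t w)"
        unfolding gap_def by (intro continuous_intros elim continuous_on_compose2[OF matrix_vector_mult_linear_continuous_on elim(1)]) auto
      show ?case
      proof (intro impI ballI)
        fix t assume n: "w \<notin> (\<Union>n. E n)" and t: "t \<in> {0..T}"
        define k where "k n = nat \<lfloor>t * 2 ^ n / T\<rfloor>" for n :: nat
        define u where "u n = real (k n) * T / 2 ^ n" for n
        have k: "real (k n) \<le> t * 2 ^ n / T" "t * 2 ^ n / T < real (k n) + 1" for n
        proof -
          have "real (k n) = of_int \<lfloor>t * 2 ^ n / T\<rfloor>" using t T by (simp add: k_def)
          then show "real (k n) \<le> t * 2 ^ n / T" "t * 2 ^ n / T < real (k n) + 1"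
            using floor_correct[of "t * 2 ^ n / T"] by simp_all
        qed
        have uD: "u n \<in> D n" for n
        proof -
          have "t * 2 ^ n / T \<le> 2 ^ n" using t T by (simp add: divide_le_eq)
          then have "real (k n) \<le> 2 ^ n" using k(1)[of n] by linarith
          then have "k n \<le> 2 ^ n" by (metis of_nat_le_iff of_nat_numeral of_nat_power)
          then show ?thesis unfolding u_def D_def by blast
        qed
        have "u \<longlonglongrightarrow> t"
        proof (rule tendsto_sandwich)
          show "\<forall>\<^sub>F n in sequentially. t - T / 2 ^ n \<le> u n"
          proof (intro always_eventually allI)
            fix n
            have "t * 2 ^ n \<le> (real (k n) + 1) * T" using k(2)[of n] T by (simp add: pos_divide_less_eq)
            then have "t \<le> (real (k n) + 1) * T / 2 ^ n" by (simp add: pos_le_divide_eq)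
            then show "t - T / 2 ^ n \<le> u n" by (simp add: u_def distrib_right add_divide_distrib)
          qed
          show "\<forall>\<^sub>F n in sequentially. u n \<le> t"
            using k(1) T by (intro always_eventually allI) (simp add: u_def field_simps)
          show "(\<lambda>n. t - T / 2 ^ n) \<longlonglongrightarrow> t" by real_asymp
        qed simp
        then have "(\<lambda>n. gap (u n) w) \<longlonglongrightarrow> gap t w"
        proof (rule continuous_on_tendsto_compose[OF cY])
          show "t \<in> {0..}" using t by simp
          show "\<forall>\<^sub>F n in sequentially. u n \<in> {0..}" using uD D(2) by (intro always_eventually allI) force
        qed
        then have "(\<lambda>n. \<bar>gap (u n) w\<bar>) \<longlonglongrightarrow> \<bar>gap t w\<bar>" by (rule tendsto_rabs)
        then show "\<bar>gap t w\<bar> \<le> c"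
        proof (rule LIMSEQ_le_const2)
          show "\<exists>N. \<forall>n\<ge>N. \<bar>gap (u n) w\<bar> \<le> c" using n uD elim(3) by (force simp: E_def not_less)
        qed
      qed
    qed
  qed
  ultimately show ?thesis unfolding c_def by blast
qed

end

section \<open>Passage to small times along geometric scales\<close>

lemma lil_h_pos: "0 < t \<Longrightarrow> t < exp (-1) \<Longrightarrow> 0 < lil_h t"
proof -
  assume t: "0 < t" "t < exp (-1)"
  have "ln t < -1" using t by (metis exp_gt_zero ln_exp ln_less_cancel_iff)
  then have "1 < ln (1 / t)" using t by (simp add: ln_div)
  then have "0 < ln (ln (1 / t))" by simp
  then show ?thesis using t by (simp add: lil_h_def)
qed

lemma eventually_lil_h_pos: "\<forall>\<^sub>F t in at_right 0. 0 < lil_h t"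
  by (rule eventually_at_rightI[of 0 "exp (-1)"]) (auto intro: lil_h_pos)

lemma ex_power_cell:
  fixes \<theta> t :: real
  assumes "0 < \<theta>" "\<theta> < 1" "0 < t" "t < \<theta> ^ m"
  shows "\<exists>k\<ge>m. \<theta> ^ Suc k < t \<and> t \<le> \<theta> ^ k"
proof -
  obtain n where n: "\<theta> ^ n < t" using real_arch_pow_inv[OF assms(3,2)] ..
  have "\<theta> ^ Suc n \<le> \<theta> ^ n" using assms by (intro power_decreasing) auto
  then have ex: "\<exists>n. \<theta> ^ Suc n < t" using n by (intro exI[of _ n]) linarith
  define k where "k = (LEAST n. \<theta> ^ Suc n < t)"
  have k: "\<theta> ^ Suc k < t" unfolding k_def using ex by (rule LeastI_ex)
  have "t \<le> \<theta> ^ k"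
  proof (cases k)
    case 0
    have "\<theta> ^ m \<le> 1" using assms by (intro power_le_one) auto
    then show ?thesis using assms 0 by simp
  next
    case (Suc j)
    then have "\<not> \<theta> ^ Suc j < t" unfolding k_def by (metis not_less_Least lessI)
    then show ?thesis using Suc by simp
  qed
  moreover have "m \<le> k"
  proof (rule ccontr)
    assume "\<not> m \<le> k"
    then have "\<theta> ^ m \<le> \<theta> ^ Suc k" using assms by (intro power_decreasing) auto
    then show False using k assms by simp
  qed
  ultimately show ?thesis using k by blast
qed

context psd_double_integral
begin

lemma AE_eventually_le_aux:
  assumes \<eta>: "0 < \<eta>" "\<eta> < 1"
  shows "AE w in M. \<forall>\<^sub>F t in at_right 0. \<bar>gap t w\<bar> \<le> (\<rho> * (1 + \<eta>)\<^sup>2 / (1 - \<eta>) + \<eta>) * lil_h t"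
proof -
  define \<theta> where "\<theta> = 1 - \<eta>"
  define q where "q = ln (1 / \<theta>)"
  define T where "T m = \<theta> ^ m" for m :: nat
  define L where "L m = ln (real m * q)" for m :: nat
  \<comment> \<open>One factor 1 + \<eta> keeps 2 p T away from 1, so that the prefactor is the
    constant 1 / \<open>C\<close>. In \<open>\<alpha>\<close> one factor 1 + \<eta> cancels against
    \<open>p\<close> and the other remains: the exponential becomes (m q)^(-(1 + \<eta>)), which is
    summable.\<close>
  define p where "p m = 1 / (2 * T m * (1 + \<eta>))" for m
  define \<alpha> where "\<alpha> m = (1 + \<eta>)\<^sup>2 * (2 * T m * L m)" for m
  define K where "K = a * (2 * real CARD('d) + 1) + 1"
  define C where "C = sqrt (\<eta> / (1 + \<eta>)) ^ CARD('d)"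
  have \<theta>: "0 < \<theta>" "\<theta> < 1" using \<eta> by (auto simp: \<theta>_def)
  have q: "0 < q" using \<theta> by (simp add: q_def ln_div)
  have T: "0 < T m" for m using \<theta> by (simp add: T_def)
  have lnT: "ln (1 / T m) = real m * q" for m using \<theta> by (simp add: T_def q_def ln_div ln_realpow)
  have C: "0 < C" using \<eta> by (simp add: C_def)
  have K: "0 < K" using a_nonneg by (simp add: K_def add_nonneg_pos)
  have kT: "2 * p m * T m = 1 / (1 + \<eta>)" for m using T[of m] \<eta> by (simp add: p_def)
  let ?P = "\<lambda>m E. E \<in> sets M \<and> prob E \<le> 2 * (exp (- p m * \<alpha> m) / sqrt (1 - 2 * p m * T m) ^ CARD('d)) \<and>
    (AE w in M. w \<notin> E \<longrightarrow> (\<forall>t\<in>{0..T m}. \<bar>gap t w\<bar> \<le> \<rho> * \<alpha> m + (a * (2 * real CARD('d) + 1) + 1) * T m))"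
  have "\<exists>E. ?P m E" for m
  proof (rule ex_exceed_event[OF T])
    show "0 < p m" using T[of m] \<eta> by (simp add: p_def)
    show "2 * p m * T m < 1" unfolding kT using \<eta> by simp
  qed
  then have "\<forall>m. \<exists>E. ?P m E" ..
  from choice[OF this] obtain E where H: "\<forall>m. ?P m (E m)" ..
  note EM = H[rule_format, THEN conjunct1] and EP = H[rule_format, THEN conjunct2, THEN conjunct1]
    and EA = H[THEN spec, THEN conjunct2, THEN conjunct2]
  have Kc: "\<rho> * \<alpha> m + (a * (2 * real CARD('d) + 1) + 1) * T m = \<rho> * \<alpha> m + K * T m" for m by (simp add: K_def)
  have EP': "prob (E m) \<le> 2 / C * q powr (- (1 + \<eta>)) * real m powr (- (1 + \<eta>))" if "1 \<le> m" for m
  proof -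
    have "p m * \<alpha> m = (1 + \<eta>) * L m" using T[of m] \<eta> by (simp add: p_def \<alpha>_def power2_eq_square)
    then have "exp (- p m * \<alpha> m) = (real m * q) powr (- (1 + \<eta>))"
      using that q by (simp add: powr_def L_def algebra_simps)
    also have "... = real m powr (- (1 + \<eta>)) * q powr (- (1 + \<eta>))" using q by (simp add: powr_mult)
    finally have e: "exp (- p m * \<alpha> m) = real m powr (- (1 + \<eta>)) * q powr (- (1 + \<eta>))" .
    have "1 - 2 * p m * T m = \<eta> / (1 + \<eta>)" unfolding kT using \<eta> by (simp add: field_simps)
    then show ?thesis using EP[of m] unfolding e C_def by (simp add: mult_ac)
  qed
  have "summable (\<lambda>m. prob (E m))"
  proof (rule summable_comparison_test')
    show "summable (\<lambda>m. 2 / C * q powr (- (1 + \<eta>)) * real m powr (- (1 + \<eta>)))"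
      using \<eta> by (intro summable_mult) (simp add: summable_real_powr_iff)
    show "norm (prob (E m)) \<le> 2 / C * q powr (- (1 + \<eta>)) * real m powr (- (1 + \<eta>))" if "1 \<le> m" for m
      using EP'[OF that] by simp
  qed
  then have ev: "AE w in M. \<forall>\<^sub>F m in sequentially. w \<in> space M - E m"
    by (intro borel_cantelli_AE1) (use EM in \<open>auto simp: less_top[symmetric]\<close>)
  have EA': "AE w in M. \<forall>m. w \<notin> E m \<longrightarrow> (\<forall>t\<in>{0..T m}. \<bar>gap t w\<bar> \<le> \<rho> * \<alpha> m + K * T m)"
    using EA unfolding Kc by (simp add: AE_all_countable)
  \<comment> \<open>The summand \<open>K * T m\<close> is of order t and hence negligible against
    the iterated logarithm, because \<open>L m\<close> tends to infinity.\<close>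
  have Lev: "\<forall>\<^sub>F m in sequentially. 0 < L m \<and> K / (2 * \<theta> * L m) \<le> \<eta>"
  proof -
    have Lt: "filterlim L at_top sequentially" unfolding L_def using q by real_asymp
    have "\<forall>\<^sub>F m in sequentially. 1 + K / (2 * \<theta> * \<eta>) \<le> L m" using Lt unfolding filterlim_at_top by blast
    then show ?thesis
    proof eventually_elim
      case (elim m)
      have "0 < K / (2 * \<theta> * \<eta>)" using K \<theta> \<eta> by simp
      then have L: "0 < L m" "K / (2 * \<theta> * \<eta>) \<le> L m" using elim by linarith+
      then have "K \<le> L m * (2 * \<theta> * \<eta>)" using \<theta> \<eta> by (simp add: pos_divide_le_eq)
      then have "K / (2 * \<theta> * L m) \<le> \<eta>" using \<theta> L(1) by (simp add: pos_divide_le_eq mult_ac)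
      then show ?case using L(1) by simp
    qed
  qed
  show ?thesis using ev EA'
  proof eventually_elim
    case (elim w)
    have "\<forall>\<^sub>F m in sequentially. w \<notin> E m \<and> (0 < L m \<and> K / (2 * \<theta> * L m) \<le> \<eta>) \<and> 1 \<le> m"
      using elim(1) Lev eventually_ge_at_top[of 1] by eventually_elim auto
    then obtain m0 where m0: "\<And>m. m0 \<le> m \<Longrightarrow> w \<notin> E m" "\<And>m. m0 \<le> m \<Longrightarrow> 0 < L m"
      "\<And>m. m0 \<le> m \<Longrightarrow> K / (2 * \<theta> * L m) \<le> \<eta>" "\<And>m. m0 \<le> m \<Longrightarrow> 1 \<le> m" unfolding eventually_sequentially by blast
    show ?case
    proof (rule eventually_at_rightI[of 0 "T m0"])
      fix t assume "t \<in> {0<..<T m0}"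
      then obtain m where m: "m0 \<le> m" "\<theta> ^ Suc m < t" "t \<le> \<theta> ^ m" and t: "0 < t"
        using ex_power_cell[OF \<theta>, of t m0] by (auto simp: T_def)
      have tT: "t \<le> T m" "\<theta> * T m < t" using m by (auto simp: T_def)
      have Lm: "0 < L m" by (rule m0(2)[OF m(1)])
      have "1 / T m \<le> 1 / t" using tT t T[of m] by (intro divide_left_mono) auto
      then have "ln (1 / T m) \<le> ln (1 / t)" using T[of m] by (intro ln_mono) auto
      then have "real m * q \<le> ln (1 / t)" unfolding lnT .
      moreover have "0 < real m * q" using m0(4)[OF m(1)] q by simp
      ultimately have "L m \<le> ln (ln (1 / t))" unfolding L_def by (intro ln_mono) auto
      then have "2 * t * L m \<le> lil_h t" using t by (simp add: lil_h_def)
      moreover have "2 * (\<theta> * T m) * L m \<le> 2 * t * L m" using tT Lm by (intro mult_right_mono mult_left_mono) auto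
      ultimately have h: "2 * (\<theta> * T m) * L m \<le> lil_h t" by linarith
      have "\<bar>gap t w\<bar> \<le> \<rho> * \<alpha> m + K * T m" using elim(2) m0(1)[OF m(1)] tT t by auto
      \<comment> \<open>The estimate was made at scale \<open>T m\<close>, while \<open>t\<close>
        may be as small as \<open>\<theta> * T m\<close>; comparing with the latter costs the factor
        1 / \<theta>.\<close>
      also have "... = (\<rho> * (1 + \<eta>)\<^sup>2 / \<theta> + K / (2 * \<theta> * L m)) * (2 * (\<theta> * T m) * L m)"
        using \<theta> Lm by (simp add: \<alpha>_def field_simps)
      also have "... \<le> (\<rho> * (1 + \<eta>)\<^sup>2 / \<theta> + \<eta>) * (2 * (\<theta> * T m) * L m)"
        using m0(3)[OF m(1)] \<theta> Lm T[of m] by (intro mult_right_mono add_left_mono) auto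
      also have "... \<le> (\<rho> * (1 + \<eta>)\<^sup>2 / \<theta> + \<eta>) * lil_h t" using h \<theta> \<rho>_pos \<eta> by (intro mult_left_mono) auto
      finally show "\<bar>gap t w\<bar> \<le> (\<rho> * (1 + \<eta>)\<^sup>2 / (1 - \<eta>) + \<eta>) * lil_h t" by (simp add: \<theta>_def)
    qed (rule T)
  qed
qed

text \<open>Countably many values of \<eta> share one null set, and the coefficient tends to
  \<open>\<rho>\<close> along them; positivity of \<open>lil_h\<close> near 0 lets the coefficient
  be enlarged.\<close>

lemma AE_eventually_le: "AE w in M. \<forall>e>0. \<forall>\<^sub>F t in at_right 0. \<bar>gap t w\<bar> \<le> (\<rho> + e) * lil_h t"
proof -
  define \<eta> where "\<eta> n = 1 / (real n + 2)" for n :: nat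
  have "AE w in M. \<forall>\<^sub>F t in at_right 0. \<bar>gap t w\<bar> \<le> (\<rho> * (1 + \<eta> n)\<^sup>2 / (1 - \<eta> n) + \<eta> n) * lil_h t" for n
    by (rule AE_eventually_le_aux) (auto simp: \<eta>_def)
  then have "AE w in M. \<forall>n. \<forall>\<^sub>F t in at_right 0. \<bar>gap t w\<bar> \<le> (\<rho> * (1 + \<eta> n)\<^sup>2 / (1 - \<eta> n) + \<eta> n) * lil_h t"
    by (simp add: AE_all_countable)
  then show ?thesis
  proof eventually_elim
    case (elim w)
    show ?case
    proof (intro allI impI)
      fix e :: real assume e: "0 < e"
      have "(\<lambda>n. \<rho> * (1 + \<eta> n)\<^sup>2 / (1 - \<eta> n) + \<eta> n) \<longlonglongrightarrow> \<rho>" unfolding \<eta>_def by real_asymp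
      then have "\<forall>\<^sub>F n in sequentially. \<rho> * (1 + \<eta> n)\<^sup>2 / (1 - \<eta> n) + \<eta> n < \<rho> + e"
        using e by (intro order_tendstoD(2)) auto
      then obtain n where n: "\<rho> * (1 + \<eta> n)\<^sup>2 / (1 - \<eta> n) + \<eta> n < \<rho> + e"
        unfolding eventually_sequentially by blast
      show "\<forall>\<^sub>F t in at_right 0. \<bar>gap t w\<bar> \<le> (\<rho> + e) * lil_h t"
        using elim[rule_format, of n] eventually_lil_h_pos
      proof eventually_elim
        case (elim t)
        then show ?case using mult_right_mono[OF less_imp_le[OF n], of "lil_h t"] by linarith
      qed
    qed
  qed
qed

end

context brownian_setup
begin

section \<open>The lower bound in the law of the iterated logarithm\<close>

lemma nn_integral_exp_incr:
  fixes e :: "real^'d"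
  assumes st: "0 \<le> s" "s < t" and e: "norm e = 1"
  shows "(\<integral>\<^sup>+w. ennreal (exp (c * (e \<bullet> (W t w - W s w)))) \<partial>M) = ennreal (exp ((t - s) * c\<^sup>2 / 2))"
proof -
  have [measurable]: "W t \<in> borel_measurable M" "W s \<in> borel_measurable M" using W_measurable st by auto
  have "(\<integral>\<^sup>+w. ennreal (exp (c * (e \<bullet> (W t w - W s w)))) \<partial>M) = (\<integral>\<^sup>+w. ennreal (exp ((c *\<^sub>R e) \<bullet> (W t w - W s w))) \<partial>M)"
    by simp
  also have "... = (\<integral>\<^sup>+z. ennreal (exp ((c *\<^sub>R e) \<bullet> z)) \<partial>distr M borel (\<lambda>w. W t w - W s w))"
    by (rule nn_integral_distr[symmetric]) measurable
  also have "... = ennreal (exp ((t - s) * c\<^sup>2 / 2))"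
    unfolding distr_increment[OF st] using nn_integral_exp_gauss[of "t - s" "c *\<^sub>R e"] st e
    by (simp add: power_mult_distrib)
  finally show ?thesis .
qed

text \<open>Chernoff's bound for each sign, with the optimal exponent x / sqrt (t - s).\<close>

lemma prob_incr_ge:
  fixes e :: "real^'d"
  assumes st: "0 \<le> s" "s < t" and e: "norm e = 1" and x: "0 \<le> x"
  shows "prob {w\<in>space M. x * sqrt (t - s) \<le> \<bar>e \<bullet> (W t w - W s w)\<bar>} \<le> 2 * exp (- x\<^sup>2 / 2)"
proof -
  have [measurable]: "W t \<in> borel_measurable M" "W s \<in> borel_measurable M" using W_measurable st by auto
  define r where "r = sqrt (t - s)"
  have r: "0 < r" "r\<^sup>2 = t - s" using st by (auto simp: r_def)
  define S where "S \<sigma> = {w\<in>space M. x * r \<le> \<sigma> * (e \<bullet> (W t w - W s w))}" for \<sigma> :: real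
  have SM: "S \<sigma> \<in> sets M" for \<sigma> unfolding S_def by measurable
  have P: "prob (S \<sigma>) \<le> exp (- x\<^sup>2 / 2)" if "\<bar>\<sigma>\<bar> = 1" for \<sigma>
  proof -
    have "prob (S \<sigma>) \<le> exp (x\<^sup>2 / 2) / exp (x\<^sup>2)"
    proof (rule prob_le_of_nn_integral_le[OF SM])
      have "\<sigma>\<^sup>2 = 1" using that by (metis power2_abs one_power2)
      then have "(t - s) * (\<sigma> * x / r)\<^sup>2 / 2 = x\<^sup>2 / 2"
        unfolding r(2)[symmetric] using r(1) by (simp add: power_mult_distrib power_divide)
      then show "(\<integral>\<^sup>+w. ennreal (exp ((\<sigma> * x / r) * (e \<bullet> (W t w - W s w)))) \<partial>M) \<le> ennreal (exp (x\<^sup>2 / 2))"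
        by (simp only: nn_integral_exp_incr[OF st e] order_refl)
      fix w assume "w \<in> S \<sigma>"
      then have "x * r \<le> \<sigma> * (e \<bullet> (W t w - W s w))" by (simp add: S_def)
      then have "(x / r) * (x * r) \<le> (x / r) * (\<sigma> * (e \<bullet> (W t w - W s w)))"
        using x r by (intro mult_left_mono) auto
      then have "x\<^sup>2 \<le> (\<sigma> * x / r) * (e \<bullet> (W t w - W s w))" using r by (simp add: power2_eq_square mult_ac)
      then show "ennreal (exp (x\<^sup>2)) \<le> ennreal (exp ((\<sigma> * x / r) * (e \<bullet> (W t w - W s w))))"
        by (intro ennreal_leI) simp
    qed auto
    also have "... = exp (- x\<^sup>2 / 2)" by (simp flip: exp_diff)
    finally show ?thesis .
  qed
  have "{w\<in>space M. x * sqrt (t - s) \<le> \<bar>e \<bullet> (W t w - W s w)\<bar>} \<subseteq> S 1 \<union> S (-1)"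
    by (auto simp: S_def r_def abs_if split: if_splits)
  then have "prob {w\<in>space M. x * sqrt (t - s) \<le> \<bar>e \<bullet> (W t w - W s w)\<bar>} \<le> prob (S 1 \<union> S (-1))"
    by (rule finite_measure_mono) (intro sets.Un SM)
  also have "... \<le> prob (S 1) + prob (S (-1))" by (rule measure_Un_le[OF SM SM])
  finally show ?thesis using P[of 1] P[of "-1"] by simp
qed

text \<open>Exponential tilting by \<open>exp (x (1 + p) Y)\<close>, where \<open>Y\<close> is the normalised increment: the tilted law puts most
  of its mass between \<open>x\<close> and \<open>x (1 + 2 p)\<close>.\<close>

lemma prob_incr_gt_lower:
  fixes e :: "real^'d"
  assumes st: "0 \<le> s" "s < t" and e: "norm e = 1" and x: "0 < x" and p: "0 < p"
    and small: "exp (- p\<^sup>2 * x\<^sup>2 / 2) \<le> 1/4"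
  shows "exp (- x\<^sup>2 * (1 + 4 * p + 3 * p\<^sup>2) / 2) / 2 \<le> prob {w\<in>space M. x * sqrt (t - s) < e \<bullet> (W t w - W s w)}"
proof -
  have [measurable]: "W t \<in> borel_measurable M" "W s \<in> borel_measurable M" using W_measurable st by auto
  define r where "r = sqrt (t - s)"
  have r: "0 < r" "r\<^sup>2 = t - s" using st by (auto simp: r_def)
  define Y where "Y w = (e \<bullet> (W t w - W s w)) / r" for w
  have [measurable]: "Y \<in> borel_measurable M" unfolding Y_def by measurable
  have mgf: "(\<integral>\<^sup>+w. ennreal (exp (c * Y w)) \<partial>M) = ennreal (exp (c\<^sup>2 / 2))" for c
  proof -
    have "(t - s) * (c / r)\<^sup>2 / 2 = c\<^sup>2 / 2" unfolding r(2)[symmetric] using r(1) by (simp add: power_divide)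
    then show ?thesis using nn_integral_exp_incr[OF st e, of "c / r"] by (simp add: Y_def)
  qed
  define S where "S = {w\<in>space M. x < Y w}"
  have SM [measurable]: "S \<in> sets M" unfolding S_def by measurable
  have S_eq: "S = {w\<in>space M. x * sqrt (t - s) < e \<bullet> (W t w - W s w)}"
    using r by (auto simp: S_def Y_def r_def[symmetric] field_simps)
  define Z where "Z = exp ((x * (1 + p))\<^sup>2 / 2)"
  \<comment> \<open>The constants are fitted to the ends of the window:
    \<open>c1 * exp (x * y)\<close> meets exp (x (1 + p) y) at y = x, the term with
    \<open>c2\<close> meets it at y = x (1 + 2 p), and \<open>c3\<close> is its value at the upper
    end, its maximum over the window.\<close>
  define c1 where "c1 = exp (p * x\<^sup>2)"
  define c2 where "c2 = exp (- (p * (1 + 2 * p) * x\<^sup>2))"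
  define c3 where "c3 = exp (x\<^sup>2 * (1 + p) * (1 + 2 * p))"
  have pw: "exp (x * (1 + p) * y) \<le> c1 * exp (x * y) + c2 * exp (x * (1 + 2 * p) * y) + c3 * (if x < y then 1 else 0)" for y
  proof -
    consider "y \<le> x" | "x * (1 + 2 * p) \<le> y" | "x < y" "y < x * (1 + 2 * p)" by linarith
    then show ?thesis
    proof cases
      case 1
      have "x * p * y \<le> x * p * x" using 1 x p by (intro mult_left_mono) auto
      then have "x * (1 + p) * y \<le> p * x\<^sup>2 + x * y" by (simp add: algebra_simps power2_eq_square)
      then have "exp (x * (1 + p) * y) \<le> c1 * exp (x * y)" by (simp add: c1_def flip: exp_add)
      moreover have "0 \<le> c2 * exp (x * (1 + 2 * p) * y)" "0 \<le> c3 * (if x < y then 1 else 0)" by (auto simp: c2_def c3_def)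
      ultimately show ?thesis by linarith
    next
      case 2
      have "x * p * (x * (1 + 2 * p)) \<le> x * p * y" using 2 x p by (intro mult_left_mono) auto
      then have "x * (1 + p) * y \<le> - (p * (1 + 2 * p) * x\<^sup>2) + x * (1 + 2 * p) * y" by (simp add: algebra_simps power2_eq_square)
      then have "exp (x * (1 + p) * y) \<le> c2 * exp (x * (1 + 2 * p) * y)" by (simp add: c2_def flip: exp_add)
      moreover have "0 \<le> c1 * exp (x * y)" "0 \<le> c3 * (if x < y then 1 else 0)" by (auto simp: c1_def c3_def)
      ultimately show ?thesis by linarith
    next
      case 3
      have "x * (1 + p) * y \<le> x * (1 + p) * (x * (1 + 2 * p))" using 3 x p by (intro mult_left_mono) auto
      then have "exp (x * (1 + p) * y) \<le> c3" by (simp add: c3_def power2_eq_square mult_ac)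
      moreover have "0 \<le> c1 * exp (x * y)" "0 \<le> c2 * exp (x * (1 + 2 * p) * y)" by (auto simp: c1_def c2_def)
      ultimately show ?thesis using 3 by simp
    qed
  qed
  have c: "0 \<le> c1" "0 \<le> c2" "0 \<le> c3" by (auto simp: c1_def c2_def c3_def)
  have "ennreal Z = (\<integral>\<^sup>+w. ennreal (exp (x * (1 + p) * Y w)) \<partial>M)" unfolding mgf Z_def ..
  also have "... \<le> (\<integral>\<^sup>+w. ennreal c1 * ennreal (exp (x * Y w)) + ennreal c2 * ennreal (exp (x * (1 + 2 * p) * Y w)) + ennreal c3 * indicator S w \<partial>M)"
  proof (rule nn_integral_mono)
    fix w assume w: "w \<in> space M"
    have "ennreal (exp (x * (1 + p) * Y w)) \<le> ennreal (c1 * exp (x * Y w) + c2 * exp (x * (1 + 2 * p) * Y w) + c3 * (if x < Y w then 1 else 0))"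
      by (intro ennreal_leI pw)
    also have "... = ennreal c1 * ennreal (exp (x * Y w)) + ennreal c2 * ennreal (exp (x * (1 + 2 * p) * Y w)) + ennreal c3 * indicator S w"
      using c w by (auto simp: S_def indicator_def ennreal_mult')
    finally show "ennreal (exp (x * (1 + p) * Y w)) \<le> ..." .
  qed
  also have "... = ennreal c1 * ennreal (exp (x\<^sup>2 / 2)) + ennreal c2 * ennreal (exp ((x * (1 + 2 * p))\<^sup>2 / 2)) + ennreal c3 * ennreal (prob S)"
    by (subst nn_integral_add, simp, simp, subst nn_integral_add)
      (auto simp: nn_integral_cmult mgf nn_integral_cmult_indicator emeasure_eq_measure)
  also have "... = ennreal (c1 * exp (x\<^sup>2 / 2) + c2 * exp ((x * (1 + 2 * p))\<^sup>2 / 2) + c3 * prob S)"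
    using c by (simp add: ennreal_mult')
  finally have "Z \<le> c1 * exp (x\<^sup>2 / 2) + c2 * exp ((x * (1 + 2 * p))\<^sup>2 / 2) + c3 * prob S"
    using c by (subst (asm) ennreal_le_iff) auto
  \<comment> \<open>By the symmetric choice of the window both tails receive the same share
    \<open>exp (- p\<^sup>2 * x\<^sup>2 / 2)\<close> of the tilted mass \<open>Z\<close>. Each share
    is at most a quarter, so at least half of \<open>Z\<close> stays inside.\<close>
  moreover have "c1 * exp (x\<^sup>2 / 2) = Z * exp (- p\<^sup>2 * x\<^sup>2 / 2)"
    unfolding c1_def Z_def exp_add[symmetric] by (simp add: power2_eq_square field_simps)
  moreover have "c2 * exp ((x * (1 + 2 * p))\<^sup>2 / 2) = Z * exp (- p\<^sup>2 * x\<^sup>2 / 2)"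
    unfolding c2_def Z_def exp_add[symmetric] by (simp add: power2_eq_square field_simps)
  moreover have "Z * exp (- p\<^sup>2 * x\<^sup>2 / 2) \<le> Z * (1/4)"
    using small by (intro mult_left_mono) (auto simp: Z_def)
  ultimately have "Z / 2 \<le> c3 * prob S" by linarith
  then have "Z / 2 / c3 \<le> prob S" by (simp add: c3_def field_simps)
  moreover have "Z / c3 = exp (- x\<^sup>2 * (1 + 4 * p + 3 * p\<^sup>2) / 2)"
    unfolding Z_def c3_def exp_diff[symmetric] by (simp add: power2_eq_square field_simps)
  ultimately show ?thesis unfolding S_eq by simp
qed

end

lemma le_Limsup_of_frequently:
  fixes f :: "'b \<Rightarrow> ereal"
  assumes "frequently (\<lambda>x. c \<le> f x) G"
  shows "c \<le> Limsup G f"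
proof (rule ccontr)
  assume "\<not> c \<le> Limsup G f"
  then have "\<forall>\<^sub>F x in G. f x < c" using Limsup_le_iff[of G f "Limsup G f"] by (simp add: not_le)
  then have "\<forall>\<^sub>F x in G. \<not> c \<le> f x" by eventually_elim (simp add: not_le)
  then show False using assms by (simp add: frequently_def)
qed

section \<open>Large increments over a decreasing sequence of times\<close>

context brownian_setup
begin

text \<open>Since \<open>t\<close> decreases, larger indices mean earlier times. The increment with
  the smallest index is the latest one, so it is the one split off: all others are known at its
  starting time \<open>t (Suc N)\<close>.\<close>

lemma prob_no_increment_in:
  fixes t :: "nat \<Rightarrow> real" and B :: "nat \<Rightarrow> (real^'d) set"
  assumes t: "\<And>n. 0 \<le> t n" "\<And>n. t (Suc n) < t n" and B: "\<And>n. B n \<in> sets borel"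
  shows "prob {w\<in>space M. \<forall>n. N \<le> n \<and> n < N + k \<longrightarrow> W (t n) w - W (t (Suc n)) w \<notin> B n}
    = (\<Prod>i<k. 1 - prob {w\<in>space M. W (t (N + i)) w - W (t (Suc (N + i))) w \<in> B (N + i)})"
proof (induction k arbitrary: N)
  case 0
  have "{w\<in>space M. \<forall>n. N \<le> n \<and> n < N + 0 \<longrightarrow> W (t n) w - W (t (Suc n)) w \<notin> B n} = space M" by auto
  then show ?case by (simp only: prob_space lessThan_0 prod.empty)
next
  case (Suc k)
  let ?E = "\<lambda>n w. W (t n) w - W (t (Suc n)) w"
  define J where "J = {w\<in>space M. \<forall>n. Suc N \<le> n \<and> n < Suc N + k \<longrightarrow> ?E n w \<notin> B n}"
  let ?D = "\<lambda>w. W (t N) w - W (t (Suc N)) w"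
  have dec: "t n \<le> t m" if "m \<le> n" for m n
    using that by (induction rule: dec_induct) (auto intro: order_trans less_imp_le t(2))
  have JF: "J \<in> sets (F (t (Suc N)))"
  proof -
    have [measurable]: "?E n \<in> borel_measurable (F (t (Suc N)))" if "n \<in> {Suc N..<Suc N + k}" for n
      using that dec t(1) by (intro borel_measurable_diff measurable_F_mono[OF W_adapted]) auto
    have [measurable]: "B n \<in> sets borel" for n by (rule B)
    have "{w\<in>space (F (t (Suc N))). \<forall>n\<in>{Suc N..<Suc N + k}. ?E n w \<notin> B n} \<in> sets (F (t (Suc N)))"
      by measurable
    also have "{w\<in>space (F (t (Suc N))). \<forall>n\<in>{Suc N..<Suc N + k}. ?E n w \<notin> B n} = J"
      unfolding J_def space_F[OF t(1)] by auto
    finally show ?thesis .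
  qed
  have DM: "?D \<in> borel_measurable M" using W_measurable t(1) by (intro borel_measurable_diff) auto
  have "{w\<in>space M. \<forall>n. N \<le> n \<and> n < N + Suc k \<longrightarrow> ?E n w \<notin> B n} = J \<inter> {w\<in>space M. ?D w \<in> - B N}"
    by (auto simp: J_def Suc_le_eq dest: le_neq_implies_less)
  then have "prob {w\<in>space M. \<forall>n. N \<le> n \<and> n < N + Suc k \<longrightarrow> ?E n w \<notin> B n}
      = prob J * prob {w\<in>space M. ?D w \<in> - B N}" using increment_indep[OF t(1) t(2) JF, of "- B N"] B by simp
  also have "prob {w\<in>space M. ?D w \<in> - B N} = 1 - prob {w\<in>space M. ?D w \<in> B N}"
  proof -
    have "{w\<in>space M. ?D w \<in> B N} \<in> events" using measurable_sets_Collect[OF DM, of "\<lambda>x. x \<in> B N"] B by simp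
    moreover have "{w\<in>space M. ?D w \<in> - B N} = space M - {w\<in>space M. ?D w \<in> B N}" by auto
    ultimately show ?thesis by (simp add: prob_compl)
  qed
  also have "prob J = (\<Prod>i<k. 1 - prob {w\<in>space M. W (t (Suc N + i)) w - W (t (Suc (Suc N + i))) w \<in> B (Suc N + i)})"
    unfolding J_def by (rule Suc.IH)
  finally show ?case unfolding prod.lessThan_Suc_shift by (simp add: mult.commute)
qed

text \<open>The second Borel-Cantelli lemma: the probability of no occurrence among \<open>k\<close>
  consecutive indices is a product below exp of minus the partial sum, so a positive limit would
  bound the partial sums.\<close>

lemma AE_infinitely_often_increment:
  fixes t :: "nat \<Rightarrow> real" and B :: "nat \<Rightarrow> (real^'d) set"
  assumes t: "\<And>n. 0 \<le> t n" "\<And>n. t (Suc n) < t n" and B: "\<And>n. B n \<in> sets borel"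
    and div: "\<not> summable (\<lambda>n. prob {w\<in>space M. W (t n) w - W (t (Suc n)) w \<in> B n})"
  shows "AE w in M. \<forall>N. \<exists>n\<ge>N. W (t n) w - W (t (Suc n)) w \<in> B n"
proof -
  let ?D = "\<lambda>n w. W (t n) w - W (t (Suc n)) w"
  define p where "p n = prob {w\<in>space M. ?D n w \<in> B n}" for n
  have "AE w in M. \<exists>n\<ge>N. ?D n w \<in> B n" for N
  proof -
    define S where "S = {w\<in>space M. \<forall>n\<in>{N..}. ?D n w \<notin> B n}"
    have [measurable]: "?D n \<in> borel_measurable M" for n
      using W_measurable t(1) by (intro borel_measurable_diff) auto
    have [measurable]: "B n \<in> sets borel" for n by (rule B)
    have SM: "S \<in> sets M" unfolding S_def by measurable
    have le: "prob S \<le> exp (- (\<Sum>i<k. p (N + i)))" for k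
    proof -
      have JM: "{w\<in>space M. \<forall>n. N \<le> n \<and> n < N + k \<longrightarrow> ?D n w \<notin> B n} \<in> sets M" by measurable
      have "prob S \<le> prob {w\<in>space M. \<forall>n. N \<le> n \<and> n < N + k \<longrightarrow> ?D n w \<notin> B n}"
        by (rule finite_measure_mono[OF _ JM]) (auto simp: S_def)
      also have "... = (\<Prod>i<k. 1 - p (N + i))"
        unfolding p_def by (rule prob_no_increment_in[where t = t and B = B, OF t B])
      also have "... \<le> (\<Prod>i<k. exp (- p (N + i)))"
      proof (rule prod_mono)
        fix i
        have "p (N + i) \<le> 1" by (simp add: p_def)
        then show "0 \<le> 1 - p (N + i) \<and> 1 - p (N + i) \<le> exp (- p (N + i))"
          using exp_ge_add_one_self[of "- p (N + i)"] by simp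
      qed
      also have "... = exp (- (\<Sum>i<k. p (N + i)))" by (simp add: exp_sum[symmetric] sum_negf)
      finally show ?thesis .
    qed
    have "prob S = 0"
    proof (rule ccontr)
      assume "prob S \<noteq> 0"
      then have pos: "0 < prob S" by (simp add: zero_less_measure_iff)
      have "(\<Sum>i<k. p (i + N)) \<le> - ln (prob S)" for k
      proof -
        have "ln (prob S) \<le> - (\<Sum>i<k. p (N + i))" using le[of k] pos by (metis exp_gt_zero ln_exp ln_le_cancel_iff)
        then show ?thesis by (simp add: add.commute)
      qed
      then have "summable (\<lambda>i. p (i + N))" by (intro summableI_nonneg_bounded) (auto simp: p_def)
      then have "summable p" by (simp add: summable_iff_shift)
      then show False using div unfolding p_def by simp
    qed
    then have "S \<in> null_sets M" using SM by (auto simp: emeasure_eq_measure)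
    then show ?thesis by (rule AE_I') (auto simp: S_def)
  qed
  then show ?thesis by (simp add: AE_all_countable)
qed

text \<open>Along the times y^n with small \<open>y\<close>, almost all of \<open>W (t n)\<close> is
  the increment from \<open>t (Suc n)\<close>. The increments are independent and large infinitely
  often; the remaining \<open>W (t (Suc n))\<close> is eventually too small to cancel them.\<close>

lemma AE_frequently_ge_aux:
  fixes e :: "real^'d"
  assumes e: "norm e = 1" and c: "0 < c" "c < 1"
  shows "AE w in M. \<exists>\<^sub>F t in at_right 0. c * lil_h t \<le> (e \<bullet> W t w)\<^sup>2"
proof -
  \<comment> \<open>Three losses as functions of \<open>y\<close>: the shorter increment and the
    tilting in the first root, the remainder \<open>W (t (Suc n))\<close> in the second, and the
    comparison of logarithms in 1 + y. All disappear as \<open>y\<close> tends to 0.\<close>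
  have "((\<lambda>y::real. (sqrt ((1 - y) / (1 + 4 * y + 3 * y\<^sup>2)) - sqrt (2 * y))\<^sup>2 / (1 + y)) \<longlongrightarrow> 1) (at_right 0)"
    by real_asymp
  from order_tendstoD(1)[OF this c(2)]
  have ev1: "\<forall>\<^sub>F y in at_right (0::real). c < (sqrt ((1 - y) / (1 + 4 * y + 3 * y\<^sup>2)) - sqrt (2 * y))\<^sup>2 / (1 + y)" .
  have "((\<lambda>y::real. sqrt ((1 - y) / (1 + 4 * y + 3 * y\<^sup>2)) - sqrt (2 * y)) \<longlongrightarrow> 1) (at_right 0)" by real_asymp
  from order_tendstoD(1)[OF this zero_less_one]
  have ev2: "\<forall>\<^sub>F y in at_right (0::real). 0 < sqrt ((1 - y) / (1 + 4 * y + 3 * y\<^sup>2)) - sqrt (2 * y)" .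
  have "\<forall>\<^sub>F y in at_right (0::real). y \<in> {0<..<1}" by (rule eventually_at_right_real) simp
  then have "\<forall>\<^sub>F y in at_right (0::real). c < (sqrt ((1 - y) / (1 + 4 * y + 3 * y\<^sup>2)) - sqrt (2 * y))\<^sup>2 / (1 + y)
      \<and> 0 < sqrt ((1 - y) / (1 + 4 * y + 3 * y\<^sup>2)) - sqrt (2 * y) \<and> 0 < y \<and> y < 1"
    using ev1 ev2 by eventually_elim auto
  from eventually_happens'[OF trivial_limit_at_right_real this]
  obtain y where y: "c < (sqrt ((1 - y) / (1 + 4 * y + 3 * y\<^sup>2)) - sqrt (2 * y))\<^sup>2 / (1 + y)"
      "0 < sqrt ((1 - y) / (1 + 4 * y + 3 * y\<^sup>2)) - sqrt (2 * y)" "0 < y" "y < 1" by blast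
  define g where "g = 1 + 4 * y + 3 * y\<^sup>2"
  define \<beta> where "\<beta> = sqrt ((1 - y) / g) - sqrt (2 * y)"
  define t where "t n = y ^ n" for n :: nat
  \<comment> \<open>With \<open>y\<close> as tilting parameter the lower bound for the increment is
    exp (- x^2 g / 2) / 2, and this \<open>x\<close> turns it into 1 / (2 n): the harmonic series
    diverges.\<close>
  define x where "x n = sqrt (2 * ln (real n) / g)" for n :: nat
  have g: "1 \<le> g" using y by (simp add: g_def)
  have \<beta>: "0 < \<beta>" "c * (1 + y) < \<beta>\<^sup>2" using y by (auto simp: \<beta>_def g_def pos_less_divide_eq)
  have t: "0 < t n" "t (Suc n) < t n" for n using y by (auto simp: t_def)
  have tt: "t n - t (Suc n) = t n * (1 - y)" for n by (simp add: t_def algebra_simps)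
  define B where "B n = {z :: real^'d. x n * sqrt (t n - t (Suc n)) < e \<bullet> z}" for n
  have BM: "B n \<in> sets borel" for n unfolding B_def by measurable
  have io: "AE w in M. \<forall>N. \<exists>n\<ge>N. W (t n) w - W (t (Suc n)) w \<in> B n"
  proof (rule AE_infinitely_often_increment[where t = t and B = B, OF less_imp_le[OF t(1)] t(2) BM], rule notI)
    assume s: "summable (\<lambda>n. prob {w\<in>space M. W (t n) w - W (t (Suc n)) w \<in> B n})"
    have "((\<lambda>n. exp (- y\<^sup>2 * (2 * ln (real n) / g) / 2)) \<longlonglongrightarrow> 0)" using y(3) g by real_asymp
    then have "\<forall>\<^sub>F n in sequentially. exp (- y\<^sup>2 * (2 * ln (real n) / g) / 2) < 1/4"
      by (rule order_tendstoD(2)) simp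
    then have "\<forall>\<^sub>F n in sequentially. norm (inverse (real n)) \<le> 2 * prob {w\<in>space M. W (t n) w - W (t (Suc n)) w \<in> B n}"
      using eventually_ge_at_top[of 2]
    proof eventually_elim
      case (elim n)
      have x0: "0 < x n" "(x n)\<^sup>2 = 2 * ln (real n) / g" using elim(2) g by (auto simp: x_def)
      have "exp (- (x n)\<^sup>2 * (1 + 4 * y + 3 * y\<^sup>2) / 2) / 2 \<le> prob {w\<in>space M. x n * sqrt (t n - t (Suc n)) < e \<bullet> (W (t n) w - W (t (Suc n)) w)}"
        by (rule prob_incr_gt_lower[OF less_imp_le[OF t(1)] t(2) e x0(1) y(3)])
          (use elim(1) x0(2) in simp)
      moreover have "exp (- (x n)\<^sup>2 * (1 + 4 * y + 3 * y\<^sup>2) / 2) = inverse (real n)"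
        using elim(2) g unfolding x0(2) g_def[symmetric] by (simp add: exp_minus)
      ultimately show ?case by (simp add: B_def)
    qed
    then have "summable (\<lambda>n. inverse (real n))" by (rule summable_comparison_test_ev) (intro summable_mult s)
    then show False using not_summable_harmonic[where 'a=real] by simp
  qed
  \<comment> \<open>A Gaussian tail at 2 sqrt (ln n) costs at most 2 n^-2, which is summable. The
    size it allows is only sqrt (2 y) times the normalisation sqrt (2 t ln n), since
    \<open>t (Suc n)\<close> is \<open>y\<close> times \<open>t n\<close>.\<close>
  define U where "U n = {w\<in>space M. (2 * sqrt (ln (real n))) * sqrt (t (Suc n) - 0) \<le> \<bar>e \<bullet> (W (t (Suc n)) w - W 0 w)\<bar>}" for n
  have UM: "U n \<in> sets M" for n
  proof -
    have [measurable]: "W (t (Suc n)) \<in> borel_measurable M" "W 0 \<in> borel_measurable M"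
      using W_measurable t(1)[of "Suc n"] by auto
    show ?thesis unfolding U_def by measurable
  qed
  have "AE w in M. \<forall>\<^sub>F n in sequentially. w \<in> space M - U n"
  proof (rule borel_cantelli_AE1)
    have UP: "norm (prob (U n)) \<le> 2 * real n powr (-2)" if "1 \<le> n" for n
    proof -
      have "prob (U n) \<le> 2 * exp (- (2 * sqrt (ln (real n)))\<^sup>2 / 2)"
        unfolding U_def by (rule prob_incr_ge[OF order_refl t(1) e]) (use that in simp)
      also have "- (2 * sqrt (ln (real n)))\<^sup>2 / 2 = -2 * ln (real n)" using that by (simp add: power_mult_distrib)
      finally show ?thesis using that by (simp add: powr_def)
    qed
    show "summable (\<lambda>n. prob (U n))"
      by (rule summable_comparison_test'[OF _ UP]) (intro summable_mult, simp add: summable_real_powr_iff)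
  qed (use UM in \<open>auto simp: less_top[symmetric]\<close>)
  then show ?thesis using io AE_space
  proof eventually_elim
    case (elim w)
    have t0: "t \<longlonglongrightarrow> 0" unfolding t_def using y by (intro LIMSEQ_power_zero) simp
    \<comment> \<open>At time \<open>t n\<close> the iterated logarithm is ln n plus a constant, so
      eventually it is at most 1 + y times ln n.\<close>
    have l: "\<forall>\<^sub>F n in sequentially. ln (real n * ln (1 / y)) \<le> (1 + y) * ln (real n)"
    proof -
      have "0 < ln (1 / y)" using y by (simp add: ln_div)
      then show ?thesis using y(3) by real_asymp
    qed
    show ?case unfolding frequently_def
    proof
      assume "\<forall>\<^sub>F t in at_right 0. \<not> c * lil_h t \<le> (e \<bullet> W t w)\<^sup>2"
      then obtain r where r: "0 < r" "\<And>u. 0 < u \<Longrightarrow> u < r \<Longrightarrow> \<not> c * lil_h u \<le> (e \<bullet> W u w)\<^sup>2"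
        unfolding eventually_at_right_field by blast
      have "\<forall>\<^sub>F n in sequentially. t n < r" using t0 r(1) by (rule order_tendstoD(2))
      then have "\<forall>\<^sub>F n in sequentially. w \<notin> U n \<and> t n < r \<and> ln (real n * ln (1 / y)) \<le> (1 + y) * ln (real n) \<and> 2 \<le> n"
        using elim(1) l eventually_ge_at_top[of 2] by eventually_elim auto
      then obtain N where N: "\<And>n. N \<le> n \<Longrightarrow> w \<notin> U n \<and> t n < r \<and> ln (real n * ln (1 / y)) \<le> (1 + y) * ln (real n) \<and> 2 \<le> n"
        unfolding eventually_sequentially by blast
      obtain n where n: "N \<le> n" "W (t n) w - W (t (Suc n)) w \<in> B n" using elim(2) by blast
      have n2: "w \<notin> U n" "t n < r" "ln (real n * ln (1 / y)) \<le> (1 + y) * ln (real n)" "2 \<le> n" using N[OF n(1)] by auto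
      have ln0: "0 < ln (real n)" using n2(4) by simp
      define R where "R = sqrt (2 * t n * ln (real n))"
      have R0: "0 \<le> R" and R2: "R\<^sup>2 = 2 * t n * ln (real n)" using t(1)[of n] ln0 by (auto simp: R_def)
      have a: "x n * sqrt (t n - t (Suc n)) = R * sqrt ((1 - y) / g)"
        unfolding x_def tt R_def by (simp add: real_sqrt_mult[symmetric] field_simps)
      have b: "2 * sqrt (ln (real n)) * sqrt (t (Suc n)) = R * sqrt (2 * y)"
      proof -
        have "2 * sqrt (ln (real n)) * sqrt (t (Suc n)) = sqrt (4 * ln (real n) * t (Suc n))"
          by (simp add: real_sqrt_mult)
        also have "4 * ln (real n) * t (Suc n) = (2 * t n * ln (real n)) * (2 * y)" by (simp add: t_def)
        finally show ?thesis unfolding R_def real_sqrt_mult[of "2 * t n * ln (real n)" "2 * y", symmetric] .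
      qed
      have "R * sqrt ((1 - y) / g) < e \<bullet> (W (t n) w - W (t (Suc n)) w)" using n(2) by (simp add: B_def a)
      moreover have "\<bar>e \<bullet> W (t (Suc n)) w\<bar> < R * sqrt (2 * y)"
        using n2(1) elim(3) W_0[OF elim(3)] by (simp add: U_def b)
      ultimately have "R * sqrt ((1 - y) / g) - R * sqrt (2 * y) \<le> e \<bullet> W (t n) w"
        unfolding inner_diff_right by linarith
      then have "R * \<beta> \<le> e \<bullet> W (t n) w" by (simp add: \<beta>_def algebra_simps)
      then have "(R * \<beta>)\<^sup>2 \<le> (e \<bullet> W (t n) w)\<^sup>2" using R0 \<beta> by (intro power_mono) auto
      moreover have "c * lil_h (t n) \<le> (R * \<beta>)\<^sup>2"
      proof -
        have "ln (1 / t n) = real n * ln (1 / y)" using y by (simp add: t_def ln_div ln_realpow)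
        then have "c * lil_h (t n) = 2 * t n * (c * ln (real n * ln (1 / y)))" by (simp add: lil_h_def)
        also have "... \<le> 2 * t n * (c * ((1 + y) * ln (real n)))"
          using n2(3) c t(1)[of n] by (intro mult_left_mono) auto
        also have "... = R\<^sup>2 * (c * (1 + y))" by (simp add: R2)
        also have "... \<le> R\<^sup>2 * \<beta>\<^sup>2" using \<beta>(2) by (intro mult_left_mono) auto
        finally show ?thesis by (simp add: power_mult_distrib)
      qed
      ultimately have "c * lil_h (t n) \<le> (e \<bullet> W (t n) w)\<^sup>2" by linarith
      then show False using r(2)[OF t(1) n2(2)] by simp
    qed
  qed
qed

lemma AE_frequently_ge:
  fixes e :: "real^'d"
  assumes e: "norm e = 1"
  shows "AE w in M. \<forall>c<1. \<exists>\<^sub>F t in at_right 0. c * lil_h t \<le> (e \<bullet> W t w)\<^sup>2"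
proof -
  define k where "k n = 1 - 1 / (real n + 2)" for n :: nat
  have "AE w in M. \<exists>\<^sub>F t in at_right 0. k n * lil_h t \<le> (e \<bullet> W t w)\<^sup>2" for n
    by (rule AE_frequently_ge_aux[OF e]) (auto simp: k_def field_simps)
  then have "AE w in M. \<forall>n. \<exists>\<^sub>F t in at_right 0. k n * lil_h t \<le> (e \<bullet> W t w)\<^sup>2"
    by (simp add: AE_all_countable)
  then show ?thesis
  proof eventually_elim
    case (elim w)
    show ?case
    proof (intro allI impI)
      fix c :: real assume "c < 1"
      moreover have "k \<longlonglongrightarrow> 1" unfolding k_def by real_asymp
      ultimately have "\<forall>\<^sub>F n in sequentially. c < k n" by (intro order_tendstoD(1)) auto
      then obtain n where n: "c < k n" unfolding eventually_sequentially by blast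
      have "\<exists>\<^sub>F t in at_right 0. k n * lil_h t \<le> (e \<bullet> W t w)\<^sup>2 \<and> 0 < lil_h t"
        using frequently_eventually_conj[OF elim[rule_format, of n] eventually_lil_h_pos] by (simp add: conj_commute)
      then show "\<exists>\<^sub>F t in at_right 0. c * lil_h t \<le> (e \<bullet> W t w)\<^sup>2"
      proof (rule frequently_elim1)
        fix t assume "k n * lil_h t \<le> (e \<bullet> W t w)\<^sup>2 \<and> 0 < lil_h t"
        then show "c * lil_h t \<le> (e \<bullet> W t w)\<^sup>2" using mult_right_mono[of c "k n" "lil_h t"] n by linarith
      qed
    qed
  qed
qed

end

section \<open>Limits superior of double integrals\<close>

lemma norm_matrix_le_onorm:
  fixes \<beta> :: "real^'d^'d"
  shows "norm (\<beta> *v y) \<le> onorm ((*v) \<beta>) * norm y" by (rule onorm[OF matrix_vector_mul_bounded_linear])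

lemma norm_matrix_le_of_mat_norm_le:
  fixes \<beta> :: "real^'d^'d"
  assumes "mat_norm \<beta> \<le> C"
  shows "norm (\<beta> *v y) \<le> C * norm y"
proof (cases "y = 0")
  case False
  let ?u = "(1 / norm y) *\<^sub>R y"
  \<comment> \<open>A real \<open>Sup\<close> is informative only for a set known to be bounded;
    \<open>onorm\<close> supplies the bound.\<close>
  have bdd: "bdd_above {norm (\<beta> *v y) | y. norm y = 1}"
  proof (rule bdd_aboveI)
    fix x assume "x \<in> {norm (\<beta> *v y) | y. norm y = 1}"
    then obtain v where "x = norm (\<beta> *v v)" "norm v = 1" by auto
    then show "x \<le> onorm ((*v) \<beta>)" using norm_matrix_le_onorm[of \<beta> v] by simp
  qed
  have "norm (\<beta> *v ?u) \<le> mat_norm \<beta>" unfolding mat_norm_def by (rule cSup_upper[OF _ bdd]) (use False in auto)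
  then have "norm (\<beta> *v y) / norm y \<le> C" using assms by (simp add: matrix_vector_mult_scaleR)
  then show ?thesis using False by (simp add: field_simps)
qed simp

lemma abs_quadratic_form_le:
  fixes \<beta> :: "real^'d^'d"
  shows "\<bar>y \<bullet> (\<beta> *v y)\<bar> \<le> onorm ((*v) \<beta>) * (norm y)\<^sup>2"
proof -
  have "\<bar>y \<bullet> (\<beta> *v y)\<bar> \<le> norm y * norm (\<beta> *v y)" by (rule Cauchy_Schwarz_ineq2)
  also have "... \<le> norm y * (onorm ((*v) \<beta>) * norm y)" by (intro mult_left_mono norm_matrix_le_onorm) simp
  finally show ?thesis by (simp add: power2_eq_square mult_ac)
qed

lemma quadratic_form_nonneg_of_mat_ge:
  fixes \<beta> :: "real^'d^'d"
  assumes "mat_ge b \<beta>"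
  shows "y \<bullet> (\<beta> *v y) \<le> y \<bullet> (b *v y)"
proof (cases "y = 0")
  case False
  let ?u = "(1 / norm y) *\<^sub>R y"
  have bdd: "bdd_below {y \<bullet> ((b - \<beta>) *v y) | y. norm y = 1}"
  proof (rule bdd_belowI)
    fix x assume "x \<in> {y \<bullet> ((b - \<beta>) *v y) | y. norm y = 1}"
    then obtain v where "x = v \<bullet> ((b - \<beta>) *v v)" "norm v = 1" by auto
    then show "- onorm ((*v) (b - \<beta>)) \<le> x" using abs_quadratic_form_le[of v "b - \<beta>"] by simp
  qed
  have "lambda_min (b - \<beta>) \<le> ?u \<bullet> ((b - \<beta>) *v ?u)" unfolding lambda_min_def
  proof (rule cInf_lower[OF _ bdd])
    have "norm ?u = 1" using False by simp
    then show "?u \<bullet> ((b - \<beta>) *v ?u) \<in> {y \<bullet> ((b - \<beta>) *v y) | y. norm y = 1}" by blast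
  qed
  then have "0 \<le> ?u \<bullet> ((b - \<beta>) *v ?u)" using assms by (simp add: mat_ge_def)
  then have "0 \<le> (norm y)\<^sup>2 * (?u \<bullet> ((b - \<beta>) *v ?u))" by (rule mult_nonneg_nonneg[OF zero_le_power2])
  also have "... = y \<bullet> ((b - \<beta>) *v y)" using False by (simp add: matrix_vector_mult_scaleR power2_eq_square)
  finally have "0 \<le> y \<bullet> ((b - \<beta>) *v y)" .
  then show ?thesis by (simp add: matrix_vector_mult_diff_rdistrib inner_diff_right)
qed simp

lemma inner_symmetric_mat:
  fixes \<beta> :: "real^'d^'d"
  assumes "symmetric_mat \<beta>"
  shows "x \<bullet> (\<beta> *v y) = (\<beta> *v x) \<bullet> y"
  using assms unfolding symmetric_mat_def by (metis dot_lmul_matrix vector_transpose_matrix)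

text \<open>Polarisation: \<open>S *v y\<close> is rescaled to the length of \<open>y\<close>, the
  pairing is written as a difference of two forms, and the parallelogram law adds up their
  bounds.\<close>

lemma norm_le_of_quadratic_form_le:
  fixes S :: "real^'d^'d"
  assumes sym: "\<And>x y. x \<bullet> (S *v y) = (S *v x) \<bullet> y" and S: "\<And>y. \<bar>y \<bullet> (S *v y)\<bar> \<le> \<rho> * (norm y)\<^sup>2" and \<rho>: "0 \<le> \<rho>"
  shows "norm (S *v y) \<le> \<rho> * norm y"
proof (cases "S *v y = 0 \<or> y = 0")
  case False
  define x where "x = (norm y / norm (S *v y)) *\<^sub>R (S *v y)"
  have nx: "norm x = norm y" using False by (simp add: x_def)
  have xS: "x \<bullet> (S *v y) = norm y * norm (S *v y)"
    using False by (simp add: x_def power2_norm_eq_inner[symmetric] power2_eq_square)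
  have "4 * (x \<bullet> (S *v y)) = (x + y) \<bullet> (S *v (x + y)) - (x - y) \<bullet> (S *v (x - y))"
    using sym[of x y] by (simp add: matrix_vector_right_distrib matrix_vector_mult_diff_distrib inner_simps inner_commute)
  also have "... \<le> \<rho> * (norm (x + y))\<^sup>2 + \<rho> * (norm (x - y))\<^sup>2" using S[of "x + y"] S[of "x - y"] by linarith
  also have "... = 2 * \<rho> * ((norm x)\<^sup>2 + (norm y)\<^sup>2)"
    by (simp add: power2_norm_eq_inner inner_simps algebra_simps)
  also have "... = 4 * \<rho> * norm y * norm y" by (simp add: nx power2_eq_square)
  finally have "norm y * norm (S *v y) \<le> norm y * (\<rho> * norm y)" unfolding xS by (simp add: mult_ac)
  then show ?thesis using False by simp
qed (use \<rho> in auto)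

text \<open>The form is nonnegative at x - (p / l) v, the point on the line through \<open>x\<close>
  in direction \<open>v\<close> where it is smallest.\<close>

lemma cauchy_schwarz_psd:
  fixes A :: "real^'d^'d"
  assumes sym: "\<And>x y. x \<bullet> (A *v y) = (A *v x) \<bullet> y" and psd: "\<And>x. 0 \<le> x \<bullet> (A *v x)" and v: "0 < v \<bullet> (A *v v)"
  shows "((A *v v) \<bullet> x)\<^sup>2 / (v \<bullet> (A *v v)) \<le> x \<bullet> (A *v x)"
proof -
  define l where "l = v \<bullet> (A *v v)"
  define p where "p = (A *v v) \<bullet> x"
  have e: "x \<bullet> (A *v v) = p" "v \<bullet> (A *v x) = p" using sym[of v x] by (simp_all add: p_def inner_commute)
  have "0 \<le> (x - (p / l) *\<^sub>R v) \<bullet> (A *v (x - (p / l) *\<^sub>R v))" by (rule psd)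
  also have "... = x \<bullet> (A *v x) - 2 * (p / l) * p + (p / l)\<^sup>2 * l"
    by (simp add: matrix_vector_mult_diff_distrib matrix_vector_mult_scaleR inner_diff_left inner_diff_right e l_def[symmetric] power2_eq_square)
  also have "... = x \<bullet> (A *v x) - p\<^sup>2 / l" using v by (simp add: l_def[symmetric] power2_eq_square)
  finally show ?thesis by (simp add: l_def p_def)
qed

section \<open>The upper and the lower bound\<close>

context brownian_setup
begin

lemma Limsup_double_integral_le:
  fixes b :: "real \<Rightarrow> 'a \<Rightarrow> real^'d^'d"
  assumes rows: "\<And>i. ito_integral M F W (\<lambda>t w. b t w $ i) (\<lambda>t w. X t w $ i)"
    and V: "ito_integral M F W X V"
    and b: "\<And>t w. 0 \<le> t \<Longrightarrow> w \<in> space M \<Longrightarrow> mat_norm (b t w) \<le> 1"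
  shows "AE w in M. Limsup (at_right 0) (\<lambda>t. ereal (\<bar>2 * V t w\<bar> / lil_h t)) \<le> 1"
proof -
  have bK: "b t w \<in> op_ball 0 1" if "0 \<le> t" "w \<in> space M" for t w
    using norm_matrix_le_of_mat_norm_le[OF b[OF that]] by (simp add: op_ball_def)
  \<comment> \<open>For the matrix 0 the quadratic form disappears and \<open>gap\<close> is just
    minus twice the double integral.\<close>
  interpret psd_double_integral M F W b X V 0 1 0 by unfold_locales (use rows V bK in auto)
  have "AE w in M. \<forall>e>0. \<forall>\<^sub>F t in at_right 0. \<bar>2 * V t w\<bar> \<le> (1 + e) * lil_h t"
    using AE_eventually_le by (simp add: gap_def)
  then show ?thesis
  proof eventually_elim
    case (elim w)
    show ?case
    proof (rule ereal_le_epsilon2)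
      fix e :: real assume e: "0 < e"
      have "\<forall>\<^sub>F t in at_right 0. ereal (\<bar>2 * V t w\<bar> / lil_h t) \<le> ereal (1 + e)"
        using elim[rule_format, OF e] eventually_lil_h_pos by eventually_elim (simp add: pos_divide_le_eq)
      then show "Limsup (at_right 0) (\<lambda>t. ereal (\<bar>2 * V t w\<bar> / lil_h t)) \<le> 1 + ereal e"
        using Limsup_bounded[of "\<lambda>t. ereal (\<bar>2 * V t w\<bar> / lil_h t)" "ereal (1 + e)"] by (simp add: one_ereal_def)
    qed
  qed
qed

lemma Limsup_double_integral_ge:
  fixes b :: "real \<Rightarrow> 'a \<Rightarrow> real^'d^'d"
  assumes rows: "\<And>i. ito_integral M F W (\<lambda>t w. b t w $ i) (\<lambda>t w. X t w $ i)"
    and V: "ito_integral M F W X V"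
    and \<beta>: "symmetric_mat \<beta>"
    and b: "\<And>t w. 0 \<le> t \<Longrightarrow> w \<in> space M \<Longrightarrow> mat_norm (b t w) \<le> C"
      "\<And>t w. 0 \<le> t \<Longrightarrow> w \<in> space M \<Longrightarrow> symmetric_mat (b t w) \<and> mat_ge (b t w) \<beta>"
    and v: "norm v = 1"
  shows "AE w in M. ereal (v \<bullet> (\<beta> *v v)) \<le> Limsup (at_right 0) (\<lambda>t. ereal (2 * V t w / lil_h t))"
proof -
  define \<nu> where "\<nu> = onorm ((*v) \<beta>)"
  \<comment> \<open>The form of b - \<beta> is at most \<bar>C\<bar> + \<nu>, so subtracting \<rho>
    from it leaves values between -\<rho> and \<rho>. The extra 1 makes the form of \<open>A\<close>
    at least that of the identity, so that \<open>l\<close> is at least 1.\<close>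
  define \<rho> where "\<rho> = \<bar>C\<bar> + \<nu> + 1"
  define A where "A = \<beta> + \<rho> *\<^sub>R mat 1"
  have \<nu>: "0 \<le> \<nu>" unfolding \<nu>_def by (rule onorm_pos_le[OF matrix_vector_mul_bounded_linear])
  have \<rho>: "0 < \<rho>" "\<nu> + 1 \<le> \<rho>" using \<nu> by (auto simp: \<rho>_def)
  have Av: "A *v y = \<beta> *v y + \<rho> *\<^sub>R y" for y
    by (simp add: A_def matrix_vector_mult_add_rdistrib scaleR_matrix_vector_assoc[symmetric])
  have q: "\<bar>y \<bullet> (\<beta> *v y)\<bar> \<le> \<nu> * (norm y)\<^sup>2" for y unfolding \<nu>_def by (rule abs_quadratic_form_le)
  have yA: "y \<bullet> (A *v y) = y \<bullet> (\<beta> *v y) + \<rho> * (norm y)\<^sup>2" for y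
    by (simp add: Av inner_add_right power2_norm_eq_inner)
  have sym: "x \<bullet> (A *v y) = (A *v x) \<bullet> y" for x y
    using inner_symmetric_mat[OF \<beta>, of x y] by (simp add: Av inner_add_left inner_add_right)
  have psd: "0 \<le> x \<bullet> (A *v x)" for x
  proof -
    have "\<nu> * (norm x)\<^sup>2 \<le> \<rho> * (norm x)\<^sup>2" using \<rho> by (intro mult_right_mono) auto
    then show ?thesis unfolding yA using q[of x] by linarith
  qed
  have Aa: "x \<bullet> (A *v x) \<le> (\<nu> + \<rho>) * (norm x)\<^sup>2" for x unfolding yA distrib_right using q[of x] by linarith
  have bK: "b t w \<in> op_ball A \<rho>" if t: "0 \<le> t" "w \<in> space M" for t w unfolding op_ball_def
  proof (intro CollectI allI norm_le_of_quadratic_form_le)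
    note bs = b(2)[OF t, THEN conjunct1] and bg = b(2)[OF t, THEN conjunct2]
    show "x \<bullet> ((b t w - A) *v y) = ((b t w - A) *v x) \<bullet> y" for x y
      unfolding matrix_vector_mult_diff_rdistrib inner_diff_left inner_diff_right
      by (simp only: sym inner_symmetric_mat[OF bs])
    show "\<bar>y \<bullet> ((b t w - A) *v y)\<bar> \<le> \<rho> * (norm y)\<^sup>2" for y
    proof -
      have e: "y \<bullet> ((b t w - A) *v y) = y \<bullet> (b t w *v y) - y \<bullet> (\<beta> *v y) - \<rho> * (norm y)\<^sup>2"
        unfolding matrix_vector_mult_diff_rdistrib inner_diff_right yA by simp
      have "y \<bullet> (b t w *v y) \<le> norm y * norm (b t w *v y)" by (rule norm_cauchy_schwarz)
      also have "... \<le> norm y * (C * norm y)"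
        by (intro mult_left_mono norm_matrix_le_of_mat_norm_le b(1) t) simp
      also have "... \<le> \<bar>C\<bar> * (norm y)\<^sup>2" by (simp add: power2_eq_square mult_ac mult_right_mono)
      finally have u: "y \<bullet> (b t w *v y) \<le> \<bar>C\<bar> * (norm y)\<^sup>2" .
      have "(\<bar>C\<bar> + \<nu>) * (norm y)\<^sup>2 \<le> \<rho> * (norm y)\<^sup>2" by (intro mult_right_mono) (auto simp: \<rho>_def)
      then have "\<bar>C\<bar> * (norm y)\<^sup>2 + \<nu> * (norm y)\<^sup>2 \<le> \<rho> * (norm y)\<^sup>2" by (simp add: distrib_right)
      moreover have "0 \<le> \<rho> * (norm y)\<^sup>2" using \<rho> by simp
      ultimately show ?thesis
        unfolding e using u q[of y] quadratic_form_nonneg_of_mat_ge[OF bg, of y] by linarith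
    qed
  qed (use \<rho> in auto)
  interpret psd_double_integral M F W b X V A \<rho> "\<nu> + \<rho>"
    by unfold_locales (use rows V bK sym psd Aa \<nu> \<rho> in auto)
  define l where "l = v \<bullet> (A *v v)"
  have l: "l = v \<bullet> (\<beta> *v v) + \<rho>" using v by (simp add: l_def yA)
  have l1: "1 \<le> l" using q[of v] \<rho> v unfolding l by simp
  have nA: "l \<le> norm (A *v v)" unfolding l_def using norm_cauchy_schwarz[of v "A *v v"] v by simp
  define u where "u = (1 / norm (A *v v)) *\<^sub>R (A *v v)"
  have nu: "norm u = 1" using nA l1 by (auto simp: u_def)
  have low: "AE w in M. \<forall>c<1. \<exists>\<^sub>F t in at_right 0. c * lil_h t \<le> (u \<bullet> W t w)\<^sup>2"
    by (rule AE_frequently_ge[OF nu])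
  \<comment> \<open>Normalising A v to the unit vector \<open>u\<close> loses nothing in this
    direction: \<open>l\<close> is at most the length of A v, which makes up for the division by
    \<open>l\<close>.\<close>
  have quad: "l * (u \<bullet> x)\<^sup>2 \<le> x \<bullet> (A *v x)" for x
  proof -
    have "l * (u \<bullet> x)\<^sup>2 = (l * l) * (u \<bullet> x)\<^sup>2 / l" using l1 by simp
    also have "... \<le> (norm (A *v v))\<^sup>2 * (u \<bullet> x)\<^sup>2 / l"
      unfolding power2_eq_square[of "norm (A *v v)"] using nA l1 by (intro divide_right_mono mult_right_mono mult_mono) auto
    also have "(norm (A *v v))\<^sup>2 * (u \<bullet> x)\<^sup>2 = ((A *v v) \<bullet> x)\<^sup>2"
      using nA l1 by (simp add: u_def power_mult_distrib[symmetric])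
    also have "... / l \<le> x \<bullet> (A *v x)"
      unfolding l_def by (rule cauchy_schwarz_psd[OF sym psd]) (use l1 in \<open>simp add: l_def\<close>)
    finally show ?thesis .
  qed
  show ?thesis using AE_eventually_le low
  proof eventually_elim
    case (elim w)
    show ?case
    proof (rule ereal_le_epsilon2)
      fix e :: real assume e: "0 < e"
      \<comment> \<open>The tolerance is shared equally: replacing 1 by \<open>c\<close> costs
        \<open>e / 2\<close> after multiplication by \<open>l\<close>, and the bound on
        \<open>gap\<close> costs the other half.\<close>
      define c where "c = 1 - e / (2 * l)"
      have c: "c < 1" "l * c = l - e / 2" using e l1 by (auto simp: c_def field_simps)
      have e2: "0 < e / 2" using e by simp
      have "\<exists>\<^sub>F t in at_right 0. (\<bar>gap t w\<bar> \<le> (\<rho> + e / 2) * lil_h t \<and> 0 < lil_h t) \<and> c * lil_h t \<le> (u \<bullet> W t w)\<^sup>2"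
        by (rule frequently_eventually_conj[OF elim(2)[rule_format, OF c(1)]
            eventually_conj[OF elim(1)[rule_format, OF e2] eventually_lil_h_pos]])
      then have "\<exists>\<^sub>F t in at_right 0. ereal (v \<bullet> (\<beta> *v v) - e) \<le> ereal (2 * V t w / lil_h t)"
      proof (rule frequently_elim1)
        fix t assume *: "(\<bar>gap t w\<bar> \<le> (\<rho> + e / 2) * lil_h t \<and> 0 < lil_h t) \<and> c * lil_h t \<le> (u \<bullet> W t w)\<^sup>2"
        have "l * (c * lil_h t) \<le> l * (u \<bullet> W t w)\<^sup>2" using * l1 by (intro mult_left_mono) auto
        also have "... \<le> W t w \<bullet> (A *v W t w)" by (rule quad)
        finally have "l * c * lil_h t \<le> W t w \<bullet> (A *v W t w)" by (simp add: mult.assoc)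
        then have "l * c * lil_h t - (\<rho> + e / 2) * lil_h t \<le> 2 * V t w" using * by (auto simp: gap_def)
        also have "l * c * lil_h t - (\<rho> + e / 2) * lil_h t = (v \<bullet> (\<beta> *v v) - e) * lil_h t"
          unfolding c(2) unfolding l by (simp add: algebra_simps)
        finally have "(v \<bullet> (\<beta> *v v) - e) * lil_h t \<le> 2 * V t w" .
        then show "ereal (v \<bullet> (\<beta> *v v) - e) \<le> ereal (2 * V t w / lil_h t)"
          using * by (simp add: pos_le_divide_eq)
      qed
      then have "ereal (v \<bullet> (\<beta> *v v) - e) \<le> Limsup (at_right 0) (\<lambda>t. ereal (2 * V t w / lil_h t))"
        by (rule le_Limsup_of_frequently)
      then have "ereal (v \<bullet> (\<beta> *v v) - e) + ereal e \<le> Limsup (at_right 0) (\<lambda>t. ereal (2 * V t w / lil_h t)) + ereal e"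
        by (rule add_right_mono)
      then show "ereal (v \<bullet> (\<beta> *v v)) \<le> Limsup (at_right 0) (\<lambda>t. ereal (2 * V t w / lil_h t)) + ereal e" by simp
    qed
  qed
qed

text \<open>Unit vectors that approximate the supremum replace a maximiser. A sequence of them is
  enough, so that the exceptional null sets can be united.\<close>

lemma Limsup_double_integral_ge_lambda_max:
  fixes b :: "real \<Rightarrow> 'a \<Rightarrow> real^'d^'d"
  assumes rows: "\<And>i. ito_integral M F W (\<lambda>t w. b t w $ i) (\<lambda>t w. X t w $ i)"
    and V: "ito_integral M F W X V"
    and \<beta>: "symmetric_mat \<beta>"
    and b: "\<And>t w. 0 \<le> t \<Longrightarrow> w \<in> space M \<Longrightarrow> mat_norm (b t w) \<le> C"
      "\<And>t w. 0 \<le> t \<Longrightarrow> w \<in> space M \<Longrightarrow> symmetric_mat (b t w) \<and> mat_ge (b t w) \<beta>"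
  shows "AE w in M. ereal (lambda_max \<beta>) \<le> Limsup (at_right 0) (\<lambda>t. ereal (2 * V t w / lil_h t))"
proof -
  let ?Q = "{y \<bullet> (\<beta> *v y) | y. norm y = 1}"
  have "norm (axis undefined 1 :: real^'d) = 1" by simp
  then have ne: "?Q \<noteq> {}" by blast
  have "\<exists>v. norm v = 1 \<and> lambda_max \<beta> - 1 / real (Suc n) < v \<bullet> (\<beta> *v v)" for n
  proof -
    have "lambda_max \<beta> - 1 / real (Suc n) < Sup ?Q" by (simp add: lambda_max_def)
    from less_cSupD[OF ne this] show ?thesis by auto
  qed
  then obtain v where v: "\<And>n. norm (v n) = 1" "\<And>n. lambda_max \<beta> - 1 / real (Suc n) < v n \<bullet> (\<beta> *v v n)"
    by metis
  have "AE w in M. \<forall>n. ereal (v n \<bullet> (\<beta> *v v n)) \<le> Limsup (at_right 0) (\<lambda>t. ereal (2 * V t w / lil_h t))"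
    unfolding AE_all_countable using Limsup_double_integral_ge[OF rows V \<beta> b v(1)] by blast
  then show ?thesis
  proof eventually_elim
    case (elim w)
    show ?case
    proof (rule tendsto_upperbound)
      show "(\<lambda>n. ereal (lambda_max \<beta> - 1 / real (Suc n))) \<longlonglongrightarrow> ereal (lambda_max \<beta>)"
        by (intro tendsto_intros) real_asymp
      show "\<forall>\<^sub>F n in sequentially. ereal (lambda_max \<beta> - 1 / real (Suc n)) \<le> Limsup (at_right 0) (\<lambda>t. ereal (2 * V t w / lil_h t))"
        using elim v(2) by (intro always_eventually allI) (meson ereal_less_eq(3) less_imp_le order_trans)
    qed simp
  qed
qed

end

theorem theorem3p1:
  fixes M :: "'a measure" and F :: "real \<Rightarrow> 'a measure"
    and W :: "real \<Rightarrow> 'a \<Rightarrow> real^'d"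
  assumes "prob_space M" and "complete_measure M"
    and "usual_filtration M F" and "brownian_motion M F W"
  shows
    "(\<forall>(b :: real \<Rightarrow> 'a \<Rightarrow> real^'d^'d) X V.
        progressive F b \<and> (\<forall>t\<ge>0. \<forall>\<omega>\<in>space M. mat_norm (b t \<omega>) \<le> 1) \<and>
        (\<forall>i. ito_integral M F W (\<lambda>t \<omega>. b t \<omega> $ i) (\<lambda>t \<omega>. X t \<omega> $ i)) \<and>
        ito_integral M F W X V
        \<longrightarrow> (AE \<omega> in M. Limsup (at_right 0) (\<lambda>t. ereal (\<bar>2 * V t \<omega>\<bar> / lil_h t)) \<le> 1))
     \<and>
     (\<forall>(\<beta> :: real^'d^'d) (b :: real \<Rightarrow> 'a \<Rightarrow> real^'d^'d) X V.
        symmetric_mat \<beta> \<and> lambda_max \<beta> \<ge> 0 \<and>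
        progressive F b \<and> (\<exists>C. \<forall>t\<ge>0. \<forall>\<omega>\<in>space M. mat_norm (b t \<omega>) \<le> C) \<and>
        (\<forall>t\<ge>0. \<forall>\<omega>\<in>space M. symmetric_mat (b t \<omega>) \<and> mat_ge (b t \<omega>) \<beta>) \<and>
        (\<forall>i. ito_integral M F W (\<lambda>t \<omega>. b t \<omega> $ i) (\<lambda>t \<omega>. X t \<omega> $ i)) \<and>
        ito_integral M F W X V
        \<longrightarrow> (AE \<omega> in M. Limsup (at_right 0) (\<lambda>t. ereal (2 * V t \<omega> / lil_h t)) \<ge> ereal (lambda_max \<beta>)))"
proof -
  interpret brownian_setup M F W
    using assms by (simp add: brownian_setup_def brownian_setup_axioms_def)
  show ?thesis
  proof (intro conjI allI impI; elim conjE)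
    fix b :: "real \<Rightarrow> 'a \<Rightarrow> real^'d^'d" and X V
    assume "\<forall>t\<ge>0. \<forall>w\<in>space M. mat_norm (b t w) \<le> 1"
      and "\<forall>i. ito_integral M F W (\<lambda>t w. b t w $ i) (\<lambda>t w. X t w $ i)" and "ito_integral M F W X V"
    then show "AE w in M. Limsup (at_right 0) (\<lambda>t. ereal (\<bar>2 * V t w\<bar> / lil_h t)) \<le> 1"
      by (intro Limsup_double_integral_le[of b X V]) simp_all
  next
    fix \<beta> :: "real^'d^'d" and b :: "real \<Rightarrow> 'a \<Rightarrow> real^'d^'d" and X V
    assume \<beta>: "symmetric_mat \<beta>" and "\<exists>C. \<forall>t\<ge>0. \<forall>w\<in>space M. mat_norm (b t w) \<le> C"
      and b: "\<forall>t\<ge>0. \<forall>w\<in>space M. symmetric_mat (b t w) \<and> mat_ge (b t w) \<beta>"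
      and ito: "\<forall>i. ito_integral M F W (\<lambda>t w. b t w $ i) (\<lambda>t w. X t w $ i)" "ito_integral M F W X V"
    then obtain C where C: "\<forall>t\<ge>0. \<forall>w\<in>space M. mat_norm (b t w) \<le> C" by blast
    show "AE w in M. ereal (lambda_max \<beta>) \<le> Limsup (at_right 0) (\<lambda>t. ereal (2 * V t w / lil_h t))"
      by (rule Limsup_double_integral_ge_lambda_max[where C = C, OF ito(1)[rule_format] ito(2) \<beta>])
        (use C b in simp_all)
  qed
qed

end
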